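(* Assume in addition that $\log\mathsf E[e^{\theta X^2}]<\infty$ for some $\theta>0$ and that $\mathrm V(\sigma^2,\zeta)>0$. Let $\{\xi_n\}_{n\ge1}$ be any positive sequence with $\xi_n\to0$ and $\sqrt{n/\log n}\,\xi_n\to\infty$. Then, for both the spherical and the i.i.d. Gaussian codebook, $$\liminf_{n\to\infty}-\frac1{n\xi_n^2}\log P_{e,n}\Big(\Big\lceil \exp\Big(n\big(\tfrac12\log\tfrac{\sigma^2}{D}+\xi_n\big)\Big)\Big\rceil\Big)=\frac{1}{2\mathrm V(\sigma^2,\zeta)},$$ i.e. $\nu^*_{\rm sp}=\nu^*_{\rm iid}=\frac{1}{2\mathrm V(\sigma^2,\zeta)}$.
   Context: Let $X$ be a real-valued random variable (the source) with $\sigma^2:=\mathsf E[X^2]$, $\zeta:=\mathsf E[X^4]<\infty$ and $\mathsf E[X^6]<\infty$, and let $X^n=(X_1,\dots,X_n)$ consist of i.i.d. copies of $X$. Fix a distortion level $0<D<\sigma^2$. For $x^n,y^n\in\mathbb R^n$ let $d(x^n,y^n)=\frac1n\|x^n-y^n\|^2$. A random codebook consists of $M$ codewords $Y^n(1),\dots,Y^n(M)$, i.i.d. and independent of $X^n$, each distributed either uniformly on the sphere $\{y^n\in\mathbb R^n:\|y^n\|^2=n(\sigma^2-D)\}$ (spherical codebook) or as $\mathcal N(0,(\sigma^2-D)I_n)$ (i.i.d. Gaussian codebook). The encoder maps $X^n$ to a codeword minimizing $d(X^n,Y^n(i))$ over $i$. The ensemble excess-distortion probability is $P_{e,n}(M):=\Pr\{\min_{1\le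 i\le M} d(X^n,Y^n(i))>D\}=\mathsf E\big[(1-\Pr\{d(X^n,Y^n)\le D\mid X^n\})^M\big]$, where $Y^n$ is one codeword independent of $X^n$ and the probability is over both source and codebook. All logarithms are natural. Define $\mathrm V(\sigma^2,\zeta):=\frac{\zeta-\sigma^4}{4\sigma^4}$. The moderate deviations constant $\nu^*_{\rm sp}$ (resp. $\nu^*_{\rm iid}$) is the left-hand side liminf in the claim computed with the spherical (resp. i.i.d. Gaussian) codebook. *)

theory Defs
  imports "HOL-Probability.Probability"
begin

text \<open>Vectors in R^n are represented as extensional functions nat => real on {..<n}.\<close>

definition sqnorm :: "nat \<Rightarrow> (nat \<Rightarrow> real) \<Rightarrow> real" where
  "sqnorm n x = (\<Sum>i<n. (x i)^2)"

definition distortion :: "nat \<Rightarrow> (nat \<Rightarrow> real) \<Rightarrow> (nat \<Rightarrow> real) \<Rightarrow> real" where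
  "distortion n x y = (\<Sum>i<n. (x i - y i)^2) / real n"

definition lebn :: "nat \<Rightarrow> (nat \<Rightarrow> real) measure" where
  "lebn n = PiM {..<n} (\<lambda>_. lborel)"

text \<open>Uniform (normalized surface) measure on the sphere of radius r in R^n,
  defined as the cone measure: mu(A) = Leb(cone over A) / Leb(ball of radius r).\<close>
definition sphere_unif :: "nat \<Rightarrow> real \<Rightarrow> (nat \<Rightarrow> real) measure" where
  "sphere_unif n r = measure_of (space (lebn n)) (sets (lebn n))
     (\<lambda>A. emeasure (lebn n)
            {x \<in> space (lebn n). 0 < sqnorm n x \<and> sqnorm n x \<le> r^2 \<and>
               restrict (\<lambda>i. r / sqrt (sqnorm n x) * x i) {..<n} \<in> A}
          / emeasure (lebn n) {x \<in> space (lebn n). sqnorm n x \<le> r^2})"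

definition spherical_cb :: "real \<Rightarrow> real \<Rightarrow> nat \<Rightarrow> (nat \<Rightarrow> real) measure" where
  "spherical_cb s2 D n = sphere_unif n (sqrt (real n * (s2 - D)))"

definition gaussian_cb :: "real \<Rightarrow> real \<Rightarrow> nat \<Rightarrow> (nat \<Rightarrow> real) measure" where
  "gaussian_cb s2 D n = PiM {..<n} (\<lambda>_. density lborel (normal_density 0 (sqrt (s2 - D))))"

definition excess_prob ::
  "real measure \<Rightarrow> (nat \<Rightarrow> (nat \<Rightarrow> real) measure) \<Rightarrow> real \<Rightarrow> nat \<Rightarrow> nat \<Rightarrow> real" where
  "excess_prob P Q D n M =
     (\<integral>x. (1 - measure (Q n) {y \<in> space (Q n). distortion n x y \<le> D}) ^ M
        \<partial>(PiM {..<n} (\<lambda>_. P)))"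

definition dispersion :: "real \<Rightarrow> real \<Rightarrow> real" where
  "dispersion s2 z = (z - s2^2) / (4 * s2^2)"

definition cb_size :: "real \<Rightarrow> real \<Rightarrow> real \<Rightarrow> nat \<Rightarrow> nat" where
  "cb_size s2 D xi n = nat \<lceil>exp (real n * (ln (s2 / D) / 2 + xi))\<rceil>"

end

theory Submission
  imports Defs
begin

text \<open>
  Write \<open>p = s2 - D\<close>, \<open>w = \<parallel>x\<parallel>\<^sup>2/n\<close>, \<open>R0 = ln (s2/D)/2\<close>, \<open>v = E X\<^sup>4 - s2\<^sup>2\<close>, and let \<open>psi x\<close> be the probability
  that one codeword is within distortion \<open>D\<close> of \<open>x\<close>. For both codebooks
  \<open>psi x = exp (- n (R0 + (w - s2)/(2 s2) + O((w - s2)\<^sup>2 + \<eta>)))\<close> as soon as \<open>n \<eta>\<^sup>2\<close> is large.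
  For the Gaussian codebook the upper bound is Chernoff's and the lower bound comes from tilting the
  Gaussian so that a window of width \<open>\<eta>\<close> in \<open>\<parallel>y\<parallel>\<^sup>2/n\<close> and \<open>\<langle>x, y\<rangle>/n\<close> becomes typical. The spherical codebook
  is compared with the Gaussian one through Lebesgue measure: the uniform law is the cone measure, and
  the Gaussian density is constant up to a factor \<open>exp (O(n \<eta>))\<close> on a shell of relative width \<open>\<eta>\<close>.
  With \<open>\<eta>\<close> a small multiple of \<open>\<xi> n\<close>, the integrand \<open>(1 - psi x)\<^sup>M\<close> is doubly exponentially small when
  \<open>w - s2 \<le> 2 s2 (1 - \<epsilon>) \<xi> n\<close> and at least \<open>1/2\<close> when \<open>w - s2\<close> is slightly above \<open>2 s2 (1 + \<epsilon>) \<xi> n\<close>, so that the claim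
  is the moderate deviations principle \<open>exp (- n t\<^sup>2/(2 v))\<close> for \<open>P (w - s2 > t)\<close> at \<open>t = 2 s2 \<xi> n\<close>.
\<close>

section \<open>Gaussian vectors\<close>

text \<open>Two features force the shape. First, \<open>\<xi> n\<close> may tend to 0 only slightly
  more slowly than n^(-1/2), so the rate of \<open>psi x\<close> is needed at finite n with an error
  small against \<open>\<xi> n\<close>, uniformly in x near the typical sphere; a limit theorem for
  the rate would not do. Chernoff windows supply this: they ask only that
  \<open>n \<eta>\<^sup>2\<close> exceed a constant. Second, the error has to be quadratic in
  \<open>w - s2\<close>: at the decisive scale \<open>w - s2\<close> is of order
  \<open>\<xi> n\<close>, so a quadratic error is negligible while a linear one would change the
  constant. The slope \<open>1/(2 s2)\<close> is the derivative of the rate at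
  \<open>w = s2\<close>; it turns a rate above \<open>R0 + \<xi> n\<close> into
  \<open>w - s2 > 2 s2 \<xi> n\<close>, whence \<open>(2 s2)\<^sup>2/(2 v)\<close>, which is the
  claimed constant because the dispersion equals \<open>v/(4 s2\<^sup>2)\<close>. The volume of a
  ball is never evaluated: only quotients of volumes occur, and in these the Gaussian normalizing
  power \<open>sqrt (2 * pi * p) ^ n\<close> cancels.\<close>

definition iprod :: "nat \<Rightarrow> (nat \<Rightarrow> real) \<Rightarrow> (nat \<Rightarrow> real) \<Rightarrow> real" where
  "iprod n x y = (\<Sum>i<n. x i * y i)"

definition gauss :: "real \<Rightarrow> nat \<Rightarrow> (nat \<Rightarrow> real) measure" where
  "gauss p n = PiM {..<n} (\<lambda>_. density lborel (normal_density 0 (sqrt p)))"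

lemma gaussian_cb_eq_gauss: "gaussian_cb s2 D n = gauss (s2 - D) n"
  by (simp add: gaussian_cb_def gauss_def)

lemma sets_gauss[measurable_cong]: "sets (gauss p n) = sets (PiM {..<n} (\<lambda>_. borel))"
  unfolding gauss_def by (intro sets_PiM_cong) auto

lemma sets_lebn[measurable_cong]: "sets (lebn n) = sets (PiM {..<n} (\<lambda>_. borel))"
  unfolding lebn_def by (intro sets_PiM_cong) auto

lemma space_gauss: "space (gauss p n) = space (PiM {..<n} (\<lambda>_. borel :: real measure))"
  by (rule sets_eq_imp_space_eq[OF sets_gauss])

lemma space_lebn: "space (lebn n) = space (PiM {..<n} (\<lambda>_. borel :: real measure))"
  by (rule sets_eq_imp_space_eq[OF sets_lebn])

lemma measurable_sqnorm[measurable]: "sqnorm n \<in> borel_measurable (PiM {..<n} (\<lambda>_. borel))"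
  unfolding sqnorm_def[abs_def] by measurable

lemma measurable_iprod[measurable]:
  "(\<lambda>y. iprod n x y) \<in> borel_measurable (PiM {..<n} (\<lambda>_. borel))"
  unfolding iprod_def by measurable

lemma sqnorm_nonneg: "0 \<le> sqnorm n x"
  by (simp add: sqnorm_def sum_nonneg)

lemma distortion_altdef:
  "distortion n x y = (sqnorm n x - 2 * iprod n x y + sqnorm n y) / real n"
  by (simp add: distortion_def sqnorm_def iprod_def power2_diff sum.distrib sum_subtractf
      sum_distrib_left algebra_simps)

lemma prob_space_gauss:
  assumes "p > 0" shows "prob_space (gauss p n)"
  unfolding gauss_def using assms
  by (intro prob_space_PiM prob_space_normal_density) auto

section \<open>Exponential tilting and window estimates\<close>

lemma normal_density_tilt:
  fixes a b p t x y :: real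
  assumes "p > 0" "t > 0" "1 / (2 * t) = b + 1 / (2 * p)"
  shows "normal_density 0 (sqrt p) y * exp (a * (x * y) - b * y\<^sup>2) =
    sqrt (t / p) * exp (a\<^sup>2 * t / 2 * x\<^sup>2) * normal_density (a * x * t) (sqrt t) y"
proof -
  have e: "- y\<^sup>2 / (2 * p) + (a * (x * y) - b * y\<^sup>2) =
      a\<^sup>2 * t / 2 * x\<^sup>2 + - (y - a * x * t)\<^sup>2 / (2 * t)"
  proof -
    have "- y\<^sup>2 / (2 * p) + (a * (x * y) - b * y\<^sup>2) = a * x * y - y\<^sup>2 * (b + 1 / (2 * p))"
      by (simp add: field_simps)
    also have "\<dots> = a * x * y - y\<^sup>2 * (1 / (2 * t))" by (simp only: assms(3))
    also have "\<dots> = a\<^sup>2 * t / 2 * x\<^sup>2 + - (y - a * x * t)\<^sup>2 / (2 * t)"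
      using assms(2) by (simp add: field_simps power2_eq_square)
    finally show ?thesis .
  qed
  have "normal_density 0 (sqrt p) y * exp (a * (x * y) - b * y\<^sup>2) =
      1 / sqrt (2 * pi * p) * exp (- y\<^sup>2 / (2 * p) + (a * (x * y) - b * y\<^sup>2))"
    using assms(1) by (simp add: normal_density_def flip: exp_add)
  also have "\<dots> = 1 / sqrt (2 * pi * p) * (exp (a\<^sup>2 * t / 2 * x\<^sup>2) * exp (- (y - a * x * t)\<^sup>2 / (2 * t)))"
    by (simp only: e exp_add)
  also have "\<dots> = sqrt (t / p) * exp (a\<^sup>2 * t / 2 * x\<^sup>2) * normal_density (a * x * t) (sqrt t) y"
    using assms(1,2) by (simp add: normal_density_def real_sqrt_mult real_sqrt_divide)
  finally show ?thesis .
qed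

text \<open>Completing the square in each coordinate: the exponential turns N(0, p) into a multiple
  of the normal law with mean \<open>a * x i * t\<close> and variance \<open>t\<close>. Every
  Chernoff bound for Gaussian codewords below is an instance.\<close>

lemma gauss_mgf:
  fixes a b p t :: real
  assumes "p > 0" "t > 0" "1 / (2 * t) = b + 1 / (2 * p)"
  shows "integrable (gauss p n) (\<lambda>y. exp (a * iprod n x y - b * sqnorm n y))" (is ?I)
    and "(\<integral>y. exp (a * iprod n x y - b * sqnorm n y) \<partial>gauss p n) =
      exp (real n * (ln (t / p) / 2) + a\<^sup>2 * t / 2 * sqnorm n x)" (is ?E)
proof -
  let ?N = "density lborel (normal_density 0 (sqrt p))"
  interpret N: prob_space ?N using assms by (intro prob_space_normal_density) auto
  interpret product_sigma_finite "\<lambda>_::nat. ?N" by unfold_locales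
  have i1: "integrable ?N (\<lambda>y. exp (a * (x i * y) - b * y\<^sup>2))" for i
    using assms(1,2) by (subst integrable_density) (auto simp: normal_density_tilt[OF assms])
  have e1: "(\<integral>y. exp (a * (x i * y) - b * y\<^sup>2) \<partial>?N) = sqrt (t / p) * exp (a\<^sup>2 * t / 2 * (x i)\<^sup>2)" for i
    using assms(1,2) by (subst integral_density) (auto simp: normal_density_tilt[OF assms])
  have pr: "exp (a * iprod n x y - b * sqnorm n y) = (\<Prod>i<n. exp (a * (x i * y i) - b * (y i)\<^sup>2))" for y
    by (simp add: exp_sum[symmetric] iprod_def sqnorm_def sum_subtractf sum_distrib_left)
  show ?I unfolding pr gauss_def by (intro product_integrable_prod i1) auto
  have "(\<integral>y. exp (a * iprod n x y - b * sqnorm n y) \<partial>gauss p n) =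
      (\<Prod>i<n. sqrt (t / p) * exp (a\<^sup>2 * t / 2 * (x i)\<^sup>2))"
    unfolding pr gauss_def by (subst product_integral_prod) (auto simp: i1 e1)
  also have "\<dots> = sqrt (t / p) ^ n * exp (a\<^sup>2 * t / 2 * sqnorm n x)"
    by (simp add: prod.distrib exp_sum[symmetric] sqnorm_def sum_distrib_left)
  also have "sqrt (t / p) = exp (ln (t / p) / 2)"
  proof -
    have *: "t / p > 0" using assms by simp
    have "exp (ln (t / p) / 2) = exp (ln (sqrt (t / p)))" by (simp only: ln_sqrt[OF less_imp_le[OF *]])
    also have "\<dots> = sqrt (t / p)" using * by (intro exp_ln) simp
    finally show ?thesis ..
  qed
  finally show ?E by (simp only: exp_of_nat_mult[symmetric] exp_add)
qed

text \<open>Markov's inequality under a tilted law that is never formed: \<open>f\<close> is its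
  unnormalized density, at most \<open>B\<close> on the window \<open>S\<close>, and each
  \<open>g j\<close> dominates \<open>f\<close> on one way of leaving \<open>S\<close>. Once the
  integrals of the \<open>g j\<close> add up to at most half of that of \<open>f\<close>, the
  measure of \<open>S\<close> is at least the integral of \<open>f\<close> divided by
  \<open>2 * B\<close>.\<close>

lemma window_bound:
  fixes f :: "'a \<Rightarrow> real" and g :: "'i \<Rightarrow> 'a \<Rightarrow> real"
  assumes "finite_measure M" "S \<in> sets M" "integrable M f"
    and "finite J" "\<And>j. j \<in> J \<Longrightarrow> integrable M (g j)"
    and "\<And>j x. j \<in> J \<Longrightarrow> x \<in> space M \<Longrightarrow> 0 \<le> g j x"
    and "\<And>x. x \<in> S \<Longrightarrow> f x \<le> B"
    and "\<And>x. x \<in> space M \<Longrightarrow> x \<notin> S \<Longrightarrow> \<exists>j\<in>J. f x \<le> g j x"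
  shows "(\<integral>x. f x \<partial>M) \<le> B * measure M S + (\<Sum>j\<in>J. \<integral>x. g j x \<partial>M)"
proof -
  interpret finite_measure M by fact
  have "(\<integral>x. f x \<partial>M) \<le> (\<integral>x. B * indicator S x + (\<Sum>j\<in>J. g j x) \<partial>M)"
  proof (rule integral_mono)
    show "integrable M (\<lambda>x. B * indicator S x + (\<Sum>j\<in>J. g j x))"
      using assms by (auto intro!: integrable_add integrable_sum simp: emeasure_eq_measure)
    fix x assume x: "x \<in> space M"
    show "f x \<le> B * indicator S x + (\<Sum>j\<in>J. g j x)"
    proof (cases "x \<in> S")
      case True
      then have "f x \<le> B" by (rule assms)
      moreover have "0 \<le> (\<Sum>j\<in>J. g j x)" using assms(6) x by (intro sum_nonneg) auto
      ultimately show ?thesis using True by simp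
    next
      case False
      then obtain j where j: "j \<in> J" "f x \<le> g j x" using assms(8) x by blast
      have "g j x \<le> (\<Sum>j\<in>J. g j x)"
        using assms(4,6) x j by (intro member_le_sum) auto
      then show ?thesis using j False by simp
    qed
  qed fact
  also have "\<dots> = B * measure M S + (\<Sum>j\<in>J. \<integral>x. g j x \<partial>M)"
    using assms(2,5)
    by (subst Bochner_Integration.integral_add)
      (auto intro!: integrable_sum simp: emeasure_eq_measure)
  finally show ?thesis .
qed

lemma four_le_exp_2: "(4::real) \<le> exp 2"
proof -
  have "(4::real) = 2 ^ 2" by simp
  also have "\<dots> \<le> exp 1 ^ 2" using exp_ge_add_one_self[of "1::real"] by (intro power_mono) auto
  also have "\<dots> = exp 2" by (simp flip: exp_of_nat_mult)
  finally show ?thesis .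
qed

lemma neg_ln_one_minus_le:
  fixes u :: real
  assumes "\<bar>u\<bar> \<le> 1/2"
  shows "- ln (1 - u) \<le> u + 2 * u\<^sup>2"
proof -
  have "- u - 2 * u\<^sup>2 \<le> ln (1 - u)"
  proof (cases "u \<ge> 0")
    case True
    then show ?thesis using ln_one_minus_pos_lower_bound[of u] assms by simp
  next
    case False
    then have "- u - u\<^sup>2 \<le> ln (1 - u)" using ln_one_plus_pos_lower_bound[of "-u"] assms by simp
    moreover have "0 \<le> u\<^sup>2" by simp
    ultimately show ?thesis by linarith
  qed
  then show ?thesis by simp
qed

text \<open>The tilted law has mean \<open>\<beta> x\<close> and variance \<open>t\<close> per
  coordinate, so \<open>sqnorm n y / n\<close> has mean
  \<open>w * \<beta>\<^sup>2 + t = p - \<eta>\<close>, the middle of the window from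
  \<open>p - 2 * \<eta>\<close> to \<open>p\<close>. Perturbing \<open>b\<close> by \<open>s\<close>
  exhibits its cumulant: slope \<open>p - \<eta>\<close> and a remainder of second order in
  \<open>s\<close>.\<close>

lemma gauss_tilt_sqnorm:
  fixes a p t s w \<beta> \<eta> :: real
  assumes "t > 0" "\<eta> > 0" "w \<ge> 0" "sqnorm n x = real n * w" "w * \<beta>\<^sup>2 + t = p - \<eta>"
    and "\<bar>s\<bar> * p \<le> 1/4"
  defines "a \<equiv> \<beta> / t" and "b \<equiv> 1 / (2 * t) - 1 / (2 * p)"
  shows "integrable (gauss p n) (\<lambda>y. exp (a * iprod n x y - (b - s) * sqnorm n y))" (is ?I)
    and "(\<integral>y. exp (a * iprod n x y - (b - s) * sqnorm n y) \<partial>gauss p n) \<le>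
      exp (real n * (ln (t / p) / 2 + w * \<beta>\<^sup>2 / (2 * t) + s * (p - \<eta>) + 8 * p\<^sup>2 * s\<^sup>2))" (is ?E)
proof -
  have tp: "t \<le> p" "w * \<beta>\<^sup>2 \<le> p" "p > 0"
    using assms(1,2,3,5) by (auto simp: zero_le_mult_iff intro: add_pos_nonneg) (smt (verit) mult_nonneg_nonneg zero_le_power2)+
  \<comment> \<open>The perturbed variance is \<open>t / (1 - u)\<close>; the bound on
    \<open>\<bar>s\<bar> * p\<close> keeps \<open>1 - u\<close> above 1/2, where both its inverse
    and its logarithm are quadratic up to the constant 2.\<close>
  define u where "u = 2 * s * t"
  have u: "\<bar>u\<bar> \<le> 1/2"
  proof -
    have "\<bar>u\<bar> = 2 * (\<bar>s\<bar> * t)" using assms(1) by (simp add: u_def abs_mult)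
    also have "\<bar>s\<bar> * t \<le> \<bar>s\<bar> * p" using tp by (intro mult_left_mono) auto
    finally show ?thesis using assms(6) by simp
  qed
  define t' where "t' = t / (1 - u)"
  have t': "t' > 0" unfolding t'_def using u assms(1) by (auto intro!: divide_pos_pos)
  have c: "1 / (2 * t') = (b - s) + 1 / (2 * p)"
    using assms(1) u by (simp add: t'_def b_def u_def field_simps)
  note m = gauss_mgf[OF tp(3) t' c, of n a x]
  show ?I by (rule m(1))
  have l1: "ln (t' / p) \<le> ln (t / p) + u + 2 * u\<^sup>2"
  proof -
    have "ln (t' / p) = ln (t / p) - ln (1 - u)"
      using u assms(1) tp by (auto simp: t'_def ln_div ln_mult)
    then show ?thesis using neg_ln_one_minus_le[OF u] by simp
  qed
  have l2: "t' \<le> t * (1 + u + 2 * u\<^sup>2)"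
  proof -
    have "0 \<le> u\<^sup>2 * (1 - 2 * u)" using u by simp
    then have "1 \<le> (1 + u + 2 * u\<^sup>2) * (1 - u)" by (simp add: algebra_simps power2_eq_square)
    then have "1 / (1 - u) \<le> 1 + u + 2 * u\<^sup>2" using u by (simp add: divide_le_eq)
    from mult_left_mono[OF this, of t] show ?thesis using assms(1) by (simp add: t'_def)
  qed
  have "ln (t' / p) / 2 + a\<^sup>2 * t' / 2 * w \<le>
      (ln (t / p) + u + 2 * u\<^sup>2) / 2 + a\<^sup>2 * (t * (1 + u + 2 * u\<^sup>2)) / 2 * w"
    using assms(3) by (intro add_mono mult_right_mono divide_right_mono mult_left_mono l1 l2) auto
  also have "\<dots> = ln (t / p) / 2 + w * \<beta>\<^sup>2 / (2 * t) + s * (w * \<beta>\<^sup>2 + t) + s\<^sup>2 * (4 * t * t + 4 * (w * \<beta>\<^sup>2) * t)"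
    using assms(1) by (simp add: a_def u_def field_simps power2_eq_square)
  also have "\<dots> \<le> ln (t / p) / 2 + w * \<beta>\<^sup>2 / (2 * t) + s * (p - \<eta>) + s\<^sup>2 * (4 * p * p + 4 * p * p)"
    unfolding assms(5)
    using assms(1,3) tp by (intro add_left_mono mult_left_mono add_mono mult_mono) auto
  also have "\<dots> = ln (t / p) / 2 + w * \<beta>\<^sup>2 / (2 * t) + s * (p - \<eta>) + 8 * p\<^sup>2 * s\<^sup>2"
    by (simp add: power2_eq_square)
  finally have "ln (t' / p) / 2 + a\<^sup>2 * t' / 2 * w \<le> \<dots>" .
  from mult_left_mono[OF this, of "real n"]
  show ?E unfolding m(2) by (simp add: assms(4) algebra_simps)
qed

text \<open>The perturbation of \<open>a\<close> instead of \<open>b\<close>: under the same tilt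
  \<open>iprod n x y / n\<close> is normal with mean \<open>w * \<beta>\<close>, so its cumulant is
  exactly quadratic in \<open>s\<close>.\<close>

lemma gauss_tilt_iprod:
  fixes p t s w \<beta> :: real
  assumes "p > 0" "t > 0" "sqnorm n x = real n * w"
  defines "a \<equiv> \<beta> / t" and "b \<equiv> 1 / (2 * t) - 1 / (2 * p)"
  shows "integrable (gauss p n) (\<lambda>y. exp ((a + s) * iprod n x y - b * sqnorm n y))" (is ?I)
    and "(\<integral>y. exp ((a + s) * iprod n x y - b * sqnorm n y) \<partial>gauss p n) =
      exp (real n * (ln (t / p) / 2 + w * \<beta>\<^sup>2 / (2 * t) + s * (w * \<beta>) + s\<^sup>2 * t * w / 2))" (is ?E)
proof -
  have c: "1 / (2 * t) = b + 1 / (2 * p)" by (simp add: b_def)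
  note m = gauss_mgf[OF assms(1,2) c, of n "a + s" x]
  show ?I by (rule m(1))
  have "(a + s)\<^sup>2 * t / 2 * w = w * \<beta>\<^sup>2 / (2 * t) + s * (w * \<beta>) + s\<^sup>2 * t * w / 2"
    using assms(2) by (simp add: a_def field_simps power2_eq_square)
  then have "(a + s)\<^sup>2 * t / 2 * (real n * w) = real n * (w * \<beta>\<^sup>2 / (2 * t) + s * (w * \<beta>) + s\<^sup>2 * t * w / 2)"
    by (metis mult.assoc mult.commute)
  then show ?E unfolding m(2) by (simp add: assms(3) algebra_simps)
qed

text \<open>The tilt with parameters \<open>a\<close>, \<open>b\<close> below moves the mean of \<open>y\<close> to \<open>\<beta> x\<close> and the variance
  to \<open>t\<close>; each of the four ways to leave the window then has tilted probability at most \<open>1/8\<close>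
  by Chernoff's bound.\<close>

lemma gauss_window_lower:
  fixes p t w \<beta> \<eta> K :: real
  assumes "t > 0" "\<eta> > 0" "w \<ge> 0" "\<beta> \<ge> 0" "sqnorm n x = real n * w" "w * \<beta>\<^sup>2 + t = p - \<eta>"
    and "8 * p\<^sup>2 \<le> K" "p * w \<le> K" "12 * K \<le> real n * \<eta>\<^sup>2"
  shows "exp (real n * (ln (t / p) / 2 - \<eta> * (1/2 + \<beta>) / t)) / 2 \<le>
    measure (gauss p n) {y \<in> space (gauss p n). real n * (p - 2 * \<eta>) \<le> sqnorm n y \<and> sqnorm n y \<le> real n * p \<and>
      real n * (w * \<beta> - \<eta>) \<le> iprod n x y \<and> iprod n x y \<le> real n * (w * \<beta> + \<eta>)}"
    (is "_ \<le> measure _ ?S")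
proof -
  define a b where "a = \<beta> / t" and "b = 1 / (2 * t) - 1 / (2 * p)"
  have w\<beta>: "0 \<le> w * \<beta>\<^sup>2" using assms by simp
  have tp: "t \<le> p" "p > 0" "\<eta> \<le> p" using assms(1,2,6) w\<beta> by linarith+
  have K: "K > 0" using assms(7) tp(2) by (meson less_le_trans mult_pos_pos zero_less_numeral zero_less_power)
  have b0: "b \<ge> 0" using tp assms(1) by (simp add: b_def field_simps)
  \<comment> \<open>Minimizer of \<open>- s * \<eta> + K * s\<^sup>2\<close>, with minimum
    \<open>- \<eta>\<^sup>2 / (4 * K)\<close>. The hypothesis
    \<open>12 * K \<le> real n * \<eta>\<^sup>2\<close> makes the resulting exponent at most -3, and
    exp (-3) is below 1/8.\<close>
  define s where "s = \<eta> / (2 * K)"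
  have s: "s > 0" using assms K by (simp add: s_def)
  have sp: "\<bar>s\<bar> * p \<le> 1/4" "\<bar>- s\<bar> * p \<le> 1/4"
  proof -
    have "\<eta> * p \<le> p * p" using tp by (intro mult_right_mono) auto
    also have "\<dots> \<le> K / 8" using assms(7) by (simp add: power2_eq_square)
    finally show "\<bar>s\<bar> * p \<le> 1/4" using K s by (simp add: s_def field_simps)
    then show "\<bar>- s\<bar> * p \<le> 1/4" by simp
  qed
  have sK: "- s * \<eta> + K * s\<^sup>2 = - \<eta>\<^sup>2 / (4 * K)"
    using K by (simp add: s_def field_simps power2_eq_square)
  define E where "E = ln (t / p) / 2 + w * \<beta>\<^sup>2 / (2 * t)"
  define Z where "Z = exp (real n * E)"
  have small: "exp (real n * (E + r)) \<le> Z / 8" if "r \<le> - s * \<eta> + K * s\<^sup>2" for r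
  proof -
    have "real n * r \<le> real n * (- \<eta>\<^sup>2 / (4 * K))" using that sK by (intro mult_left_mono) auto
    also have "\<dots> = - ((real n * \<eta>\<^sup>2) / (4 * K))" by simp
    also have "\<dots> \<le> - 3" using assms(9) K by (simp add: field_simps)
    finally have "exp (real n * r) \<le> exp (- 3)" by simp
    also have "\<dots> \<le> 1 / (8::real)"
    proof -
      have "(8::real) = 2 ^ 3" by simp
      also have "\<dots> \<le> exp 1 ^ 3" using exp_ge_add_one_self[of "1::real"] by (intro power_mono) auto
      also have "\<dots> = exp (3::real)" by (simp flip: exp_of_nat_mult)
      finally show ?thesis by (simp add: exp_minus field_simps)
    qed
    finally have "exp (real n * r) \<le> 1 / 8" .
    from mult_left_mono[OF this, of Z] show ?thesis
      by (simp add: Z_def distrib_left exp_add)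
  qed
  define g where "g = (\<lambda>(a, b, k) y. exp (a * iprod n x y - b * sqnorm n y + real n * k))"
  \<comment> \<open>One entry per edge of the window: \<open>a\<close> or \<open>b\<close> is
    shifted by \<open>s\<close> so that the exponential grows on leaving, and the third component
    offsets the shift at the edge itself.\<close>
  define J where "J = {(a, b - s, - s * p), (a, b + s, s * (p - 2 * \<eta>)),
    (a - s, b, s * (w * \<beta> - \<eta>)), (a + s, b, - s * (w * \<beta> + \<eta>))}"
  have gsplit: "g (a', b', k') y = exp (a' * iprod n x y - b' * sqnorm n y) * exp (real n * k')" for a' b' k' y
    by (simp add: g_def exp_add)
  note t1 = gauss_tilt_sqnorm[OF assms(1-3,5,6), folded a_def b_def]
  note t2 = gauss_tilt_iprod[OF tp(2) assms(1,5), of \<beta>, folded a_def b_def]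
  have sw: "s\<^sup>2 * t * w / 2 \<le> K * s\<^sup>2"
  proof -
    have "t * w \<le> p * w" using tp assms by (intro mult_right_mono) auto
    also have "\<dots> \<le> K" by fact
    finally have "t * w / 2 \<le> K" using K by simp
    from mult_left_mono[OF this, of "s\<^sup>2"] show ?thesis by (simp add: algebra_simps)
  qed
  have sp2: "8 * p\<^sup>2 * s\<^sup>2 \<le> K * s\<^sup>2" using assms(7) by (intro mult_right_mono) auto
  have gI: "integrable (gauss p n) (g j) \<and> (\<integral>y. g j y \<partial>gauss p n) \<le> Z / 8" if "j \<in> J" for j
  proof -
    consider "j = (a, b - s, - s * p)" | "j = (a, b + s, s * (p - 2 * \<eta>))"
      | "j = (a - s, b, s * (w * \<beta> - \<eta>))" | "j = (a + s, b, - s * (w * \<beta> + \<eta>))"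
      using \<open>j \<in> J\<close> unfolding J_def by blast
    then show ?thesis
    proof cases
      case 1
      have "(\<integral>y. g j y \<partial>gauss p n) \<le> exp (real n * (E + s * (p - \<eta>) + 8 * p\<^sup>2 * s\<^sup>2)) * exp (real n * (- s * p))"
        unfolding 1 gsplit using t1(2)[OF sp(1)] by (simp add: E_def add.assoc)
      also have "\<dots> = exp (real n * (E + (- s * \<eta> + 8 * p\<^sup>2 * s\<^sup>2)))"
        by (simp add: algebra_simps flip: exp_add)
      also have "\<dots> \<le> Z / 8" by (rule small) (use sp2 in simp)
      finally show ?thesis using t1(1)[OF sp(1)] unfolding 1 gsplit by simp
    next
      case 2
      have "(\<integral>y. g j y \<partial>gauss p n) \<le> exp (real n * (E + - s * (p - \<eta>) + 8 * p\<^sup>2 * s\<^sup>2)) * exp (real n * (s * (p - 2 * \<eta>)))"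
        unfolding 2 gsplit using t1(2)[OF sp(2)] by (simp add: E_def add.assoc)
      also have "\<dots> = exp (real n * (E + (- s * \<eta> + 8 * p\<^sup>2 * s\<^sup>2)))"
        by (simp add: algebra_simps flip: exp_add)
      also have "\<dots> \<le> Z / 8" by (rule small) (use sp2 in simp)
      finally show ?thesis using t1(1)[OF sp(2)] unfolding 2 gsplit by simp
    next
      case 3
      have "(\<integral>y. g j y \<partial>gauss p n) = exp (real n * (E + - s * (w * \<beta>) + s\<^sup>2 * t * w / 2)) * exp (real n * (s * (w * \<beta> - \<eta>)))"
        unfolding 3 gsplit using t2(2)[of "- s"] by (simp add: E_def add.assoc)
      also have "\<dots> = exp (real n * (E + (- s * \<eta> + s\<^sup>2 * t * w / 2)))"
        by (simp add: algebra_simps flip: exp_add)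
      also have "\<dots> \<le> Z / 8" by (rule small) (use sw in simp)
      finally show ?thesis using t2(1)[of "- s"] unfolding 3 gsplit by simp
    next
      case 4
      have "(\<integral>y. g j y \<partial>gauss p n) = exp (real n * (E + s * (w * \<beta>) + s\<^sup>2 * t * w / 2)) * exp (real n * (- s * (w * \<beta> + \<eta>)))"
        unfolding 4 gsplit using t2(2)[of s] by (simp add: E_def add.assoc)
      also have "\<dots> = exp (real n * (E + (- s * \<eta> + s\<^sup>2 * t * w / 2)))"
        by (simp add: algebra_simps flip: exp_add)
      also have "\<dots> \<le> Z / 8" by (rule small) (use sw in simp)
      finally show ?thesis using t2(1)[of s] unfolding 4 gsplit by simp
    qed
  qed
  \<comment> \<open>Bound for the tilting exponent per dimension on the window, read off at the
    corner of largest inner product and smallest norm because \<open>a\<close> and \<open>b\<close>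
    are nonnegative.\<close>
  define F where "F = a * (w * \<beta> + \<eta>) - b * (p - 2 * \<eta>)"
  define B where "B = exp (real n * F)"
  interpret prob_space "gauss p n" by (rule prob_space_gauss) fact
  have Zeq: "(\<integral>y. exp (a * iprod n x y - b * sqnorm n y) \<partial>gauss p n) = Z"
    using t2(2)[of 0] by (simp add: Z_def E_def)
  have "(\<integral>y. exp (a * iprod n x y - b * sqnorm n y) \<partial>gauss p n) \<le>
      B * measure (gauss p n) ?S + (\<Sum>j\<in>J. \<integral>y. g j y \<partial>gauss p n)"
  proof (rule window_bound)
    show "finite_measure (gauss p n)" by (rule finite_measure_axioms)
    show "?S \<in> sets (gauss p n)" by measurable
    show "integrable (gauss p n) (\<lambda>y. exp (a * iprod n x y - b * sqnorm n y))"
      using t2(1)[of 0] by simp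
    show "finite J" by (simp add: J_def)
    show "integrable (gauss p n) (g j)" if "j \<in> J" for j using gI[OF that] by blast
    show "0 \<le> g j y" for j y by (cases j) (simp add: g_def)
    show "exp (a * iprod n x y - b * sqnorm n y) \<le> B" if "y \<in> ?S" for y
    proof -
      have "a * iprod n x y \<le> a * (real n * (w * \<beta> + \<eta>))"
        using that assms by (intro mult_left_mono) (auto simp: a_def)
      moreover have "b * (real n * (p - 2 * \<eta>)) \<le> b * sqnorm n y"
        using that b0 by (intro mult_left_mono) auto
      ultimately show ?thesis by (simp add: B_def F_def algebra_simps)
    qed
    show "\<exists>j\<in>J. exp (a * iprod n x y - b * sqnorm n y) \<le> g j y"
      if "y \<in> space (gauss p n)" "y \<notin> ?S" for y
    proof -
      from that consider "sqnorm n y > real n * p" | "sqnorm n y < real n * (p - 2 * \<eta>)"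
        | "iprod n x y < real n * (w * \<beta> - \<eta>)" | "iprod n x y > real n * (w * \<beta> + \<eta>)"
        by fastforce
      then show ?thesis
      proof cases
        case 1
        then have "s * (real n * p) \<le> s * sqnorm n y" using s by (intro mult_left_mono) auto
        then show ?thesis by (intro bexI[of _ "(a, b - s, - s * p)"]) (auto simp: J_def g_def algebra_simps)
      next
        case 2
        then have "s * sqnorm n y \<le> s * (real n * (p - 2 * \<eta>))" using s by (intro mult_left_mono) auto
        then show ?thesis by (intro bexI[of _ "(a, b + s, s * (p - 2 * \<eta>))"]) (auto simp: J_def g_def algebra_simps)
      next
        case 3
        then have "s * iprod n x y \<le> s * (real n * (w * \<beta> - \<eta>))" using s by (intro mult_left_mono) auto
        then show ?thesis by (intro bexI[of _ "(a - s, b, s * (w * \<beta> - \<eta>))"]) (auto simp: J_def g_def algebra_simps)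
      next
        case 4
        then have "s * (real n * (w * \<beta> + \<eta>)) \<le> s * iprod n x y" using s by (intro mult_left_mono) auto
        then show ?thesis by (intro bexI[of _ "(a + s, b, - s * (w * \<beta> + \<eta>))"]) (auto simp: J_def g_def algebra_simps)
      qed
    qed
  qed
  moreover have "(\<Sum>j\<in>J. \<integral>y. g j y \<partial>gauss p n) \<le> 4 * (Z / 8)"
  proof -
    have "(\<Sum>j\<in>J. \<integral>y. g j y \<partial>gauss p n) \<le> real (card J) * (Z / 8)"
      using gI by (intro sum_bounded_above) auto
    also have "\<dots> \<le> 4 * (Z / 8)"
    proof (rule mult_right_mono)
      have "card J \<le> 4" unfolding J_def by (auto simp: card_insert_if)
      then show "real (card J) \<le> 4" by simp
    qed (simp add: Z_def)
    finally show ?thesis .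
  qed
  ultimately have "Z / 2 \<le> B * measure (gauss p n) ?S" unfolding Zeq by simp
  then have h1: "Z / B / 2 \<le> measure (gauss p n) ?S" by (simp add: B_def field_simps)
  have h2: "exp (real n * (ln (t / p) / 2 - \<eta> * (1/2 + \<beta>) / t)) \<le> Z / B"
  proof -
    \<comment> \<open>Inserting the power identity leaves \<open>ln (t / p) / 2\<close> and terms of
      order \<open>\<eta>\<close> only; the positive term \<open>\<eta> / p\<close> is then
      dropped.\<close>
    have wb: "w * \<beta>\<^sup>2 = p - \<eta> - t" using assms(6) by simp
    have "E - F = ln (t / p) / 2 + (w * \<beta>\<^sup>2) / (2 * t) - (w * \<beta>\<^sup>2) / t - \<beta> * \<eta> / t + b * (p - 2 * \<eta>)"
      using assms(1) by (simp add: E_def F_def a_def field_simps power2_eq_square)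
    also have "\<dots> = ln (t / p) / 2 - \<eta> * (1/2 + \<beta>) / t + \<eta> / p"
      unfolding wb using assms(1) tp by (simp add: b_def field_simps)
    finally have "ln (t / p) / 2 - \<eta> * (1/2 + \<beta>) / t \<le> E - F" using assms(2) tp by simp
    from mult_left_mono[OF this, of "real n"] show ?thesis
      by (simp add: Z_def B_def right_diff_distrib flip: exp_diff)
  qed
  show ?thesis by (rule order_trans[OF divide_right_mono[OF h2] h1]) simp
qed

section \<open>Comparison with Lebesgue measure\<close>

lemma product_sigma_finite_lborel: "product_sigma_finite (\<lambda>_::nat. lborel :: real measure)"
  by (simp add: product_sigma_finite_def sigma_finite_lborel)

lemma gauss_eq_density:
  assumes "p > 0"
  shows "gauss p n = density (lebn n) (\<lambda>y. ennreal (exp (- sqnorm n y / (2 * p)) / sqrt (2 * pi * p) ^ n))"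
    (is "_ = ?R")
proof -
  let ?N = "density lborel (normal_density 0 (sqrt p))"
  interpret N: prob_space ?N using assms by (intro prob_space_normal_density) auto
  interpret P: product_sigma_finite "\<lambda>_::nat. ?N" by unfold_locales
  interpret L: product_sigma_finite "\<lambda>_::nat. lborel :: real measure"
    by (rule product_sigma_finite_lborel)
  have dens: "ennreal (exp (- sqnorm n y / (2 * p)) / sqrt (2 * pi * p) ^ n) =
      (\<Prod>i<n. ennreal (normal_density 0 (sqrt p) (y i)))" for y
    using assms
    by (simp add: prod_ennreal normal_density_def sqnorm_def prod.distrib prod_dividef
        sum_negf sum_divide_distrib flip: exp_sum)
  have fm: "(\<lambda>y. \<Prod>i<n. ennreal (normal_density 0 (sqrt p) (y i))) \<in> borel_measurable (lebn n)"
    unfolding dens[symmetric] by measurable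
  have "?R = Pi\<^sub>M {..<n} (\<lambda>_. ?N)"
  proof (rule P.PiM_eqI)
    show "sets ?R = sets (Pi\<^sub>M {..<n} (\<lambda>_. ?N))"
      by (simp add: sets_gauss[unfolded gauss_def] sets_lebn)
    fix A :: "nat \<Rightarrow> real set" assume A: "\<And>i. i \<in> {..<n} \<Longrightarrow> A i \<in> sets ?N"
    have AS: "Pi\<^sub>E {..<n} A \<in> sets (lebn n)"
      unfolding lebn_def using A by (intro sets_PiM_I_finite) auto
    have "emeasure ?R (Pi\<^sub>E {..<n} A) =
        (\<integral>\<^sup>+y. (\<Prod>i<n. ennreal (normal_density 0 (sqrt p) (y i))) * indicator (Pi\<^sub>E {..<n} A) y \<partial>lebn n)"
      using AS fm unfolding dens by (subst emeasure_density) auto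
    also have "\<dots> = (\<integral>\<^sup>+y. (\<Prod>i<n. ennreal (normal_density 0 (sqrt p) (y i)) * indicator (A i) (y i)) \<partial>lebn n)"
    proof (rule nn_integral_cong)
      fix y assume "y \<in> space (lebn n)"
      then have "indicator (Pi\<^sub>E {..<n} A) y = (\<Prod>i<n. indicator (A i) (y i) :: ennreal)"
        by (auto simp: lebn_def space_PiM PiE_def indicator_def Pi_iff)
      then show "(\<Prod>i<n. ennreal (normal_density 0 (sqrt p) (y i))) * indicator (Pi\<^sub>E {..<n} A) y =
          (\<Prod>i<n. ennreal (normal_density 0 (sqrt p) (y i)) * indicator (A i) (y i))"
        by (simp add: prod.distrib)
    qed
    also have "\<dots> = (\<Prod>i<n. \<integral>\<^sup>+t. ennreal (normal_density 0 (sqrt p) t) * indicator (A i) t \<partial>lborel)"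
      unfolding lebn_def using A by (intro L.product_nn_integral_prod) auto
    also have "\<dots> = (\<Prod>i<n. emeasure ?N (A i))"
      using A by (intro prod.cong refl, subst emeasure_density) auto
    finally show "emeasure ?R (Pi\<^sub>E {..<n} A) = (\<Prod>i<n. emeasure ?N (A i))" .
  qed simp
  then show ?thesis by (simp add: gauss_def)
qed

text \<open>The factor is the reciprocal of the Gaussian density at points with
  \<open>sqnorm n y = real n * q\<close>. The density decreases in the norm, so an upper bound on
  the norm gives this direction, and a lower bound gives the reverse one in
  \<open>gauss_le_lebn\<close>. The first claim is also the source of the finite volume of
  balls.\<close>

lemma lebn_le_gauss:
  assumes "p > 0" "A \<in> sets (lebn n)" "\<And>y. y \<in> A \<Longrightarrow> sqnorm n y \<le> real n * q"
  shows "emeasure (lebn n) A < \<infinity>"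
    and "measure (lebn n) A \<le> sqrt (2 * pi * p) ^ n * exp (real n * q / (2 * p)) * measure (gauss p n) A"
proof -
  interpret prob_space "gauss p n" by (rule prob_space_gauss) fact
  define C where "C = sqrt (2 * pi * p) ^ n * exp (real n * q / (2 * p))"
  have C: "C > 0" using assms by (simp add: C_def)
  have le: "emeasure (lebn n) A \<le> ennreal C * emeasure (gauss p n) A"
  proof -
    have "emeasure (lebn n) A = (\<integral>\<^sup>+y. indicator A y \<partial>lebn n)" using assms(2) by simp
    also have "\<dots> \<le> (\<integral>\<^sup>+y. ennreal C * (ennreal (exp (- sqnorm n y / (2 * p)) / sqrt (2 * pi * p) ^ n) * indicator A y) \<partial>lebn n)"
    proof (rule nn_integral_mono)
      fix y
      show "indicator A y \<le> ennreal C * (ennreal (exp (- sqnorm n y / (2 * p)) / sqrt (2 * pi * p) ^ n) * indicator A y)"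
      proof (cases "y \<in> A")
        case True
        have "C * (exp (- sqnorm n y / (2 * p)) / sqrt (2 * pi * p) ^ n) = exp ((real n * q - sqnorm n y) / (2 * p))"
          using assms(1) by (simp add: C_def diff_divide_distrib flip: exp_add)
        also have "\<dots> \<ge> 1" using assms(3)[OF True] assms(1) by simp
        finally have "1 \<le> ennreal (C * (exp (- sqnorm n y / (2 * p)) / sqrt (2 * pi * p) ^ n))"
          by simp
        also have "\<dots> = ennreal C * ennreal (exp (- sqnorm n y / (2 * p)) / sqrt (2 * pi * p) ^ n)"
          using C assms(1) by (intro ennreal_mult) auto
        finally show ?thesis using True by (simp only: indicator_simps mult_1_right)
      qed simp
    qed
    also have "\<dots> = ennreal C * emeasure (gauss p n) A"
      using assms(2) unfolding gauss_eq_density[OF assms(1)]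
      by (subst emeasure_density, measurable, subst nn_integral_cmult, measurable)
    finally show ?thesis .
  qed
  also have "\<dots> = ennreal (C * measure (gauss p n) A)"
    using C by (simp add: emeasure_eq_measure ennreal_mult)
  finally have le': "emeasure (lebn n) A \<le> ennreal (C * measure (gauss p n) A)" .
  then show "emeasure (lebn n) A < \<infinity>" by (rule le_less_trans) simp
  show "measure (lebn n) A \<le> sqrt (2 * pi * p) ^ n * exp (real n * q / (2 * p)) * measure (gauss p n) A"
    unfolding C_def[symmetric]
    using le' C by (simp add: measure_def) (metis enn2real_leI mult_nonneg_nonneg less_imp_le enn2real_nonneg)
qed

lemma gauss_le_lebn:
  assumes "p > 0" "A \<in> sets (lebn n)" "\<And>y. y \<in> A \<Longrightarrow> real n * q \<le> sqnorm n y"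
    and "emeasure (lebn n) A < \<infinity>"
  shows "sqrt (2 * pi * p) ^ n * exp (real n * q / (2 * p)) * measure (gauss p n) A \<le> measure (lebn n) A"
proof -
  interpret prob_space "gauss p n" by (rule prob_space_gauss) fact
  define C where "C = sqrt (2 * pi * p) ^ n * exp (real n * q / (2 * p))"
  have C: "C > 0" using assms by (simp add: C_def)
  have "ennreal (C * measure (gauss p n) A) = ennreal C * emeasure (gauss p n) A"
    using C by (simp add: emeasure_eq_measure ennreal_mult)
  also have "\<dots> = (\<integral>\<^sup>+y. ennreal C * (ennreal (exp (- sqnorm n y / (2 * p)) / sqrt (2 * pi * p) ^ n) * indicator A y) \<partial>lebn n)"
    using assms(2) unfolding gauss_eq_density[OF assms(1)]
    by (subst emeasure_density, measurable, subst nn_integral_cmult, measurable)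
  also have "\<dots> \<le> (\<integral>\<^sup>+y. indicator A y \<partial>lebn n)"
  proof (rule nn_integral_mono)
    fix y
    show "ennreal C * (ennreal (exp (- sqnorm n y / (2 * p)) / sqrt (2 * pi * p) ^ n) * indicator A y) \<le> indicator A y"
    proof (cases "y \<in> A")
      case True
      have "C * (exp (- sqnorm n y / (2 * p)) / sqrt (2 * pi * p) ^ n) = exp ((real n * q - sqnorm n y) / (2 * p))"
        using assms(1) by (simp add: C_def diff_divide_distrib flip: exp_add)
      also have "\<dots> \<le> 1" using assms(3)[OF True] assms(1) by (simp add: divide_le_0_iff)
      finally have le1: "ennreal (C * (exp (- sqnorm n y / (2 * p)) / sqrt (2 * pi * p) ^ n)) \<le> 1"
        by simp
      have "ennreal C * ennreal (exp (- sqnorm n y / (2 * p)) / sqrt (2 * pi * p) ^ n) =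
          ennreal (C * (exp (- sqnorm n y / (2 * p)) / sqrt (2 * pi * p) ^ n))"
        using C assms(1) by (intro ennreal_mult[symmetric]) auto
      also note le1
      finally show ?thesis using True by (simp only: indicator_simps mult_1_right)
    qed simp
  qed
  also have "\<dots> = emeasure (lebn n) A" using assms(2) by simp
  also have "\<dots> = ennreal (measure (lebn n) A)" using assms(4) by (simp add: emeasure_eq_ennreal_measure)
  finally show ?thesis by (simp add: C_def)
qed

lemma measurable_scale[measurable]:
  assumes "f \<in> borel_measurable (PiM {..<n} (\<lambda>_. borel))"
  shows "(\<lambda>y. restrict (\<lambda>i. f y * y i) {..<n}) \<in>
    measurable (PiM {..<n} (\<lambda>_. borel :: real measure)) (PiM {..<n} (\<lambda>_. borel :: real measure))"
  using assms by (intro measurable_restrict borel_measurable_times measurable_component_singleton) auto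

text \<open>The one-dimensional affine rule applied to each side of a box; agreement on boxes
  determines a product measure.\<close>

lemma emeasure_lebn_scale:
  fixes k :: real
  assumes "k > 0" "A \<in> sets (lebn n)"
  shows "emeasure (lebn n) A =
    ennreal (k ^ n) * emeasure (lebn n) {y \<in> space (lebn n). restrict (\<lambda>i. k * y i) {..<n} \<in> A}"
proof -
  interpret L: product_sigma_finite "\<lambda>_::nat. lborel :: real measure"
    by (rule product_sigma_finite_lborel)
  let ?T = "\<lambda>y. restrict (\<lambda>i. k * y i) {..<n}"
  let ?R = "scale_measure (ennreal (k ^ n)) (distr (lebn n) (lebn n) ?T)"
  have T[measurable]: "?T \<in> measurable (lebn n) (lebn n)" by measurable
  have l1: "emeasure lborel B = ennreal k * emeasure lborel ((\<lambda>t. k * t) -` B)"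
    if "B \<in> sets borel" for B :: "real set"
  proof -
    have "emeasure lborel B = emeasure (density (distr lborel borel (\<lambda>x. 0 + k * x)) (\<lambda>_. ennreal \<bar>k\<bar>)) B"
      using assms(1) by (subst lborel_real_affine[of k 0]) auto
    also have "\<dots> = ennreal k * emeasure lborel ((\<lambda>t. k * t) -` B)"
      using assms(1) that by (simp add: emeasure_density nn_integral_cmult_indicator emeasure_distr)
    finally show ?thesis .
  qed
  have "?R = Pi\<^sub>M {..<n} (\<lambda>_. lborel)"
  proof (rule L.PiM_eqI)
    show "sets ?R = sets (Pi\<^sub>M {..<n} (\<lambda>_. lborel))" by (simp add: lebn_def)
    fix A :: "nat \<Rightarrow> real set" assume A: "\<And>i. i \<in> {..<n} \<Longrightarrow> A i \<in> sets lborel"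
    have AS: "Pi\<^sub>E {..<n} A \<in> sets (lebn n)"
      unfolding lebn_def using A by (intro sets_PiM_I_finite) auto
    have eq: "?T -` Pi\<^sub>E {..<n} A \<inter> space (lebn n) = Pi\<^sub>E {..<n} (\<lambda>i. (\<lambda>t. k * t) -` A i)"
      by (auto simp: lebn_def space_PiM PiE_def Pi_iff)
    have mm: "(\<lambda>t. k * t) -` A i \<in> sets lborel" if "i < n" for i
    proof -
      have "(\<lambda>t. k * t) -` A i \<inter> space borel \<in> sets borel"
        using A that by (intro measurable_sets[of _ borel borel]) auto
      then show ?thesis by simp
    qed
    have "emeasure ?R (Pi\<^sub>E {..<n} A) = ennreal (k ^ n) * emeasure (lebn n) (Pi\<^sub>E {..<n} (\<lambda>i. (\<lambda>t. k * t) -` A i))"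
      using AS by (simp add: emeasure_distr eq)
    also have "\<dots> = ennreal (k ^ n) * (\<Prod>i<n. emeasure lborel ((\<lambda>t. k * t) -` A i))"
      unfolding lebn_def using mm by (subst L.emeasure_PiM) auto
    also have "\<dots> = (\<Prod>i<n. ennreal k * emeasure lborel ((\<lambda>t. k * t) -` A i))"
      using assms(1) by (simp add: prod.distrib ennreal_power)
    also have "\<dots> = (\<Prod>i<n. emeasure lborel (A i))"
      using A by (intro prod.cong refl l1[symmetric]) auto
    finally show "emeasure ?R (Pi\<^sub>E {..<n} A) = (\<Prod>i<n. emeasure lborel (A i))" .
  qed simp
  then have "emeasure (lebn n) A = emeasure ?R A" by (simp add: lebn_def)
  also have "\<dots> = ennreal (k ^ n) * emeasure (lebn n) (?T -` A \<inter> space (lebn n))"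
    using assms(2) by (simp add: emeasure_distr)
  also have "?T -` A \<inter> space (lebn n) = {y \<in> space (lebn n). ?T y \<in> A}" by auto
  finally show ?thesis .
qed

section \<open>The uniform measure on the sphere\<close>

text \<open>Projection to the sphere of radius \<open>r\<close> along rays. At the origin division
  by zero yields the zero vector, which is off the sphere; this is why \<open>cone_set\<close>
  requires a positive norm.\<close>

definition radial :: "nat \<Rightarrow> real \<Rightarrow> (nat \<Rightarrow> real) \<Rightarrow> nat \<Rightarrow> real" where
  "radial n r y = restrict (\<lambda>i. r / sqrt (sqnorm n y) * y i) {..<n}"

definition ball_set :: "nat \<Rightarrow> real \<Rightarrow> (nat \<Rightarrow> real) set" where
  "ball_set n r = {y \<in> space (lebn n). sqnorm n y \<le> r\<^sup>2}"

text \<open>The cutoff \<open>\<rho>\<close> is separate from the radius \<open>r\<close> of the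
  sphere carrying \<open>A\<close>: with \<open>\<rho> = r\<close> the volume is the numerator in
  \<open>sphere_unif\<close>, and a smaller \<open>\<rho>\<close> gives the inner part of the same
  cone.\<close>

definition cone_set :: "nat \<Rightarrow> real \<Rightarrow> real \<Rightarrow> (nat \<Rightarrow> real) set \<Rightarrow> (nat \<Rightarrow> real) set" where
  "cone_set n r \<rho> A = {y \<in> space (lebn n). 0 < sqnorm n y \<and> sqnorm n y \<le> \<rho>\<^sup>2 \<and> radial n r y \<in> A}"

lemma sqnorm_scale: "sqnorm n (restrict (\<lambda>i. k * y i) {..<n}) = k\<^sup>2 * sqnorm n y"
  by (simp add: sqnorm_def power_mult_distrib sum_distrib_left)

lemma iprod_scale: "iprod n x (restrict (\<lambda>i. k * y i) {..<n}) = k * iprod n x y"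
  by (simp add: iprod_def sum_distrib_left mult_ac)

lemma iprod_eq_0_if_sqnorm_eq_0: "sqnorm n y = 0 \<Longrightarrow> iprod n x y = 0"
  by (simp add: sqnorm_def iprod_def sum_nonneg_eq_0_iff)

lemma sqnorm_radial: "0 < sqnorm n y \<Longrightarrow> sqnorm n (radial n r y) = r\<^sup>2"
  unfolding radial_def sqnorm_scale by (simp add: power_divide)

lemma radial_scale:
  assumes "k > 0" shows "radial n r (restrict (\<lambda>i. k * y i) {..<n}) = radial n r y"
  using assms by (auto simp: radial_def sqnorm_scale real_sqrt_mult fun_eq_iff)

lemma measurable_radial[measurable]:
  "radial n r \<in> measurable (PiM {..<n} (\<lambda>_. borel :: real measure)) (PiM {..<n} (\<lambda>_. borel :: real measure))"
  unfolding radial_def[abs_def] by (rule measurable_scale) measurable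

lemma sets_ball_set[measurable]: "ball_set n r \<in> sets (lebn n)"
  unfolding ball_set_def by measurable

lemma sets_cone_set[measurable]:
  assumes [measurable]: "A \<in> sets (lebn n)" shows "cone_set n r \<rho> A \<in> sets (lebn n)"
proof -
  have [measurable]: "A \<in> sets (PiM {..<n} (\<lambda>_. borel :: real measure))"
    using assms by (simp add: sets_lebn)
  show ?thesis unfolding cone_set_def by measurable
qed

lemma emeasure_ball_set_finite:
  assumes "n > 0" shows "emeasure (lebn n) (ball_set n r) < \<infinity>"
  by (rule lebn_le_gauss(1)[of 1 _ _ "r\<^sup>2 / real n"]) (use assms in \<open>auto simp: ball_set_def\<close>)

lemma emeasure_ball_set_pos:
  assumes "n > 0" "r > 0" shows "emeasure (lebn n) (ball_set n r) > 0"
proof -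
  interpret L: product_sigma_finite "\<lambda>_::nat. lborel :: real measure"
    by (rule product_sigma_finite_lborel)
  \<comment> \<open>Half the side of the cube inscribed in the ball.\<close>
  define c where "c = r / sqrt (real n)"
  have c: "c > 0" using assms by (simp add: c_def)
  have "0 < (\<Prod>i<n. ennreal (2 * c))" using c by (simp add: ennreal_power)
  also have "\<dots> = emeasure (lebn n) (Pi\<^sub>E {..<n} (\<lambda>_. {-c..c}))"
    unfolding lebn_def using c by (subst L.emeasure_PiM) auto
  also have "\<dots> \<le> emeasure (lebn n) (ball_set n r)"
  proof (rule emeasure_mono)
    show "Pi\<^sub>E {..<n} (\<lambda>_. {-c..c}) \<subseteq> ball_set n r"
    proof
      fix y assume y: "y \<in> Pi\<^sub>E {..<n} (\<lambda>_. {-c..c})"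
      have "sqnorm n y \<le> (\<Sum>i<n. c\<^sup>2)" unfolding sqnorm_def
      proof (rule sum_mono)
        fix i assume "i \<in> {..<n}"
        then have "\<bar>y i\<bar> \<le> c" using y by (auto simp: PiE_def Pi_iff abs_le_iff minus_le_iff)
        then show "(y i)\<^sup>2 \<le> c\<^sup>2" using c by (simp add: abs_le_square_iff[symmetric])
      qed
      also have "\<dots> = r\<^sup>2" using assms by (simp add: c_def power_divide)
      finally show "y \<in> ball_set n r" using y by (auto simp: ball_set_def lebn_def space_PiM PiE_def)
    qed
  qed measurable
  finally show ?thesis .
qed

text \<open>\<open>measure_of\<close> takes the prescribed values only if these form a measure. They
  do, since they belong to the image under \<open>radial\<close> of Lebesgue measure on the
  punctured ball, rescaled by the volume of the ball; that volume must be positive and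
  finite.\<close>

lemma
  assumes "n > 0" "r > 0"
  shows sets_sphere_unif: "sets (sphere_unif n r) = sets (lebn n)"
    and space_sphere_unif: "space (sphere_unif n r) = space (lebn n)"
    and finite_measure_sphere_unif: "finite_measure (sphere_unif n r)"
    and measure_sphere_unif: "A \<in> sets (lebn n) \<Longrightarrow>
      measure (sphere_unif n r) A = measure (lebn n) (cone_set n r r A) / measure (lebn n) (ball_set n r)"
    and measure_sphere_unif_le_1: "measure (sphere_unif n r) A \<le> 1"
proof -
  define b where "b = emeasure (lebn n) (ball_set n r)"
  have b: "b < \<infinity>" "b > 0" using emeasure_ball_set_finite[OF assms(1)] emeasure_ball_set_pos[OF assms] by (auto simp: b_def)
  let ?S = "{y \<in> space (lebn n). 0 < sqnorm n y \<and> sqnorm n y \<le> r\<^sup>2}"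
  let ?M = "scale_measure (inverse b) (distr (density (lebn n) (indicator ?S)) (lebn n) (radial n r))"
  have S: "?S \<in> sets (lebn n)" by measurable
  have rad: "radial n r \<in> measurable (density (lebn n) (indicator ?S)) (lebn n)" by measurable
  have em: "emeasure ?M A = emeasure (lebn n) (cone_set n r r A) / b" if A: "A \<in> sets (lebn n)" for A
  proof -
    have A'[measurable]: "A \<in> sets (PiM {..<n} (\<lambda>_. borel :: real measure))"
      using A by (simp add: sets_lebn)
    have pre: "radial n r -` A \<inter> space (lebn n) \<in> sets (lebn n)"
      using rad A by (auto dest: measurable_sets)
    have "emeasure ?M A = inverse b * emeasure (density (lebn n) (indicator ?S)) (radial n r -` A \<inter> space (lebn n))"
      using A rad by (simp add: emeasure_distr)
    also have "emeasure (density (lebn n) (indicator ?S)) (radial n r -` A \<inter> space (lebn n)) =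
        emeasure (lebn n) (?S \<inter> (radial n r -` A \<inter> space (lebn n)))"
      using S pre by (simp add: emeasure_density flip: indicator_inter_arith)
    also have "?S \<inter> (radial n r -` A \<inter> space (lebn n)) = cone_set n r r A"
      by (auto simp: cone_set_def)
    finally show ?thesis by (simp add: divide_ennreal_def mult.commute)
  qed
  have eq: "sphere_unif n r = ?M"
  proof -
    have "sphere_unif n r = measure_of (space (lebn n)) (sets (lebn n)) (emeasure ?M)"
      unfolding sphere_unif_def
    proof (rule measure_of_eq)
      show "sets (lebn n) \<subseteq> Pow (space (lebn n))" by (rule sets.space_closed)
      fix A assume "A \<in> sigma_sets (space (lebn n)) (sets (lebn n))"
      then have "A \<in> sets (lebn n)" by (simp add: sets.sigma_sets_eq)
      from em[OF this]
      show "emeasure (lebn n) {x \<in> space (lebn n). 0 < sqnorm n x \<and> sqnorm n x \<le> r\<^sup>2 \<and>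
          (\<lambda>i\<in>{..<n}. r / sqrt (sqnorm n x) * x i) \<in> A} /
        emeasure (lebn n) {x \<in> space (lebn n). sqnorm n x \<le> r\<^sup>2} = emeasure ?M A"
        by (simp only: cone_set_def b_def ball_set_def radial_def)
    qed
    also have "\<dots> = ?M" using measure_of_of_measure[of ?M] by (simp add: space_scale_measure)
    finally show ?thesis .
  qed
  show 1: "sets (sphere_unif n r) = sets (lebn n)" by (simp add: eq)
  show 2: "space (sphere_unif n r) = space (lebn n)" by (rule sets_eq_imp_space_eq[OF 1])
  have sub: "cone_set n r r A \<subseteq> ball_set n r" for A by (auto simp: cone_set_def ball_set_def)
  have le1: "emeasure (sphere_unif n r) A \<le> 1" for A
  proof (cases "A \<in> sets (lebn n)")
    case True
    have "emeasure (lebn n) (cone_set n r r A) \<le> b"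
      unfolding b_def using sub by (rule emeasure_mono) measurable
    then have "emeasure (lebn n) (cone_set n r r A) / b \<le> b / b" by (rule divide_right_mono_ennreal)
    then show ?thesis using b unfolding eq em[OF True] by (simp add: ennreal_divide_self)
  next
    case False
    then show ?thesis using 1 by (simp add: emeasure_notin_sets)
  qed
  show 3: "finite_measure (sphere_unif n r)"
    by standard (metis le1 ennreal_one_less_top infinity_ennreal_def leD)
  show "measure (sphere_unif n r) A = measure (lebn n) (cone_set n r r A) / measure (lebn n) (ball_set n r)"
    if "A \<in> sets (lebn n)"
  proof -
    have f: "emeasure (lebn n) (cone_set n r r A) < \<infinity>"
      by (rule le_less_trans[OF emeasure_mono[OF sub] b(1)[unfolded b_def]]) measurable
    have "measure (sphere_unif n r) A = enn2real (ennreal (measure (lebn n) (cone_set n r r A)) / ennreal (measure (lebn n) (ball_set n r)))"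
      using f b(1) unfolding measure_def eq em[OF that] by (simp add: b_def)
    also have "\<dots> = measure (lebn n) (cone_set n r r A) / measure (lebn n) (ball_set n r)"
    proof -
      have "measure (lebn n) (ball_set n r) > 0" using b by (simp add: b_def measure_def enn2real_positive_iff)
      then show ?thesis by (simp add: divide_ennreal)
    qed
    finally show ?thesis .
  qed
  show "measure (sphere_unif n r) A \<le> 1"
    unfolding measure_def by (rule enn2real_leI) (use le1 in auto)
qed

text \<open>\<open>radial\<close> ignores the length of its argument, so a dilation moves only the
  cutoff of a cone. With \<open>k = 1 - \<eta>\<close> this says that the inner part of a cone is a
  fraction \<open>(1 - \<eta>) ^ n\<close> of it.\<close>

lemma measure_cone_set_scale:
  assumes "k > 0" "r > 0" "A \<in> sets (lebn n)"
  shows "measure (lebn n) (cone_set n r (k * r) A) = k ^ n * measure (lebn n) (cone_set n r r A)"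
proof -
  have "{y \<in> space (lebn n). restrict (\<lambda>i. k * y i) {..<n} \<in> cone_set n r (k * r) A} = cone_set n r r A"
    using assms(1)
    by (auto simp: cone_set_def sqnorm_scale radial_scale power_mult_distrib space_lebn space_PiM zero_less_mult_iff)
  with emeasure_lebn_scale[OF assms(1) sets_cone_set[OF assms(3), of r "k * r"]]
  have "emeasure (lebn n) (cone_set n r (k * r) A) = ennreal (k ^ n) * emeasure (lebn n) (cone_set n r r A)"
    by simp
  then show ?thesis using assms(1) by (simp add: measure_def enn2real_mult)
qed

lemma measurable_measure_distortion:
  assumes "finite_measure Q" "sets Q = sets (PiM {..<n} (\<lambda>_. borel :: real measure))"
  shows "(\<lambda>x. measure Q {y \<in> space Q. distortion n x y \<le> D}) \<in> borel_measurable (PiM {..<n} (\<lambda>_. borel))"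
proof -
  interpret finite_measure Q by fact
  note assms(2)[measurable_cong]
  let ?B = "PiM {..<n} (\<lambda>_. borel :: real measure)"
  let ?W = "{w \<in> space (?B \<Otimes>\<^sub>M Q). distortion n (fst w) (snd w) \<le> D}"
  have W: "?W \<in> sets (?B \<Otimes>\<^sub>M Q)" unfolding distortion_def by measurable
  have "(\<lambda>x. measure Q (Pair x -` ?W)) \<in> borel_measurable ?B"
    unfolding measure_def using measurable_emeasure_Pair[OF W] by measurable
  moreover have "measure Q (Pair x -` ?W) = measure Q {y \<in> space Q. distortion n x y \<le> D}"
    if "x \<in> space ?B" for x
    using that by (intro arg_cong[of _ _ "measure Q"]) (auto simp: space_pair_measure)
  ultimately show ?thesis by (subst measurable_cong[symmetric]) auto
qed

section \<open>Probability of a distortion ball\<close>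

text \<open>Chernoff's bound: the indicator is at most
  \<open>exp (n (D' - distortion n x y) / (2 D))\<close>. The slope \<open>1/(2 D)\<close> is
  optimal for \<open>w = p + D\<close> and \<open>D' = D\<close>, since the tilted mean
  \<open>p/(p + D) x\<close> and variance \<open>D p/(p + D)\<close> then give mean distortion
  exactly \<open>D\<close>. Keeping it for other \<open>w\<close> makes the exponent linear in
  \<open>w\<close>. The threshold \<open>D'\<close> is separate for the sake of the sphere, where
  points of a shell slightly exceed \<open>D\<close>.\<close>

lemma gauss_ball_upper:
  fixes p D D' :: real
  assumes "p > 0" "D > 0" "n > 0"
  shows "measure (gauss p n) {y \<in> space (gauss p n). distortion n x y \<le> D'} \<le>
    exp (- real n * (ln ((p + D) / D) / 2 + (sqnorm n x / real n - (p + D)) / (2 * (p + D)) - (D' - D) / (2 * D)))"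
proof -
  interpret prob_space "gauss p n" by (rule prob_space_gauss) fact
  let ?A = "{y \<in> space (gauss p n). distortion n x y \<le> D'}"
  define t where "t = D * p / (p + D)"
  have t: "t > 0" using assms by (simp add: t_def)
  have ct: "1 / (2 * t) = 1 / (2 * D) + 1 / (2 * p)" using assms by (simp add: t_def field_simps)
  note m = gauss_mgf[OF assms(1) t ct, of n "1 / D" x]
  define k where "k = real n * D' / (2 * D) - sqnorm n x / (2 * D)"
  have A: "?A \<in> sets (gauss p n)" unfolding distortion_altdef by measurable
  have "measure (gauss p n) ?A = (\<integral>y. indicator ?A y \<partial>gauss p n)" using A by simp
  also have "\<dots> \<le> (\<integral>y. exp (1 / D * iprod n x y - 1 / (2 * D) * sqnorm n y) * exp k \<partial>gauss p n)"
  proof (rule integral_mono)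
    show "integrable (gauss p n) (indicator ?A :: _ \<Rightarrow> real)"
      using A by (intro integrable_real_indicator) (auto simp: emeasure_eq_measure)
    show "integrable (gauss p n) (\<lambda>y. exp (1 / D * iprod n x y - 1 / (2 * D) * sqnorm n y) * exp k)"
      using m(1) by simp
    fix y
    show "indicator ?A y \<le> exp (1 / D * iprod n x y - 1 / (2 * D) * sqnorm n y) * exp k"
    proof (cases "y \<in> ?A")
      case True
      then have "sqnorm n x - 2 * iprod n x y + sqnorm n y \<le> D' * real n"
        using assms(3) by (simp add: distortion_altdef divide_le_eq)
      then have "0 \<le> (D' * real n - (sqnorm n x - 2 * iprod n x y + sqnorm n y)) / (2 * D)"
        using assms by simp
      also have "\<dots> = 1 / D * iprod n x y - 1 / (2 * D) * sqnorm n y + k"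
        using assms by (simp add: k_def field_simps)
      finally have "1 \<le> exp (1 / D * iprod n x y - 1 / (2 * D) * sqnorm n y + k)"
        by (simp only: one_le_exp_iff)
      then show ?thesis using True by (simp add: exp_add)
    qed simp
  qed
  also have "\<dots> = exp (real n * (ln (t / p) / 2) + (1 / D)\<^sup>2 * t / 2 * sqnorm n x + k)"
    using m by (simp add: exp_add)
  finally have fin: "measure (gauss p n) ?A \<le> exp (real n * (ln (t / p) / 2) + (1 / D)\<^sup>2 * t / 2 * sqnorm n x + k)" .
  have lnt: "ln (t / p) = - ln ((p + D) / D)"
    using assms by (simp add: t_def ln_div)
  have e: "(1 / D)\<^sup>2 * t / 2 * sqnorm n x + k = - real n * ((sqnorm n x / real n - (p + D)) / (2 * (p + D)) - (D' - D) / (2 * D))"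
  proof -
    have pD: "p + D \<noteq> 0" using assms by simp
    have "(1 / D)\<^sup>2 * t / 2 * sqnorm n x = p / (2 * D * (p + D)) * sqnorm n x"
      using assms pD by (simp add: t_def power2_eq_square)
    also have "p / (2 * D * (p + D)) = 1 / (2 * D) - 1 / (2 * (p + D))"
      using assms pD by (simp add: field_simps)
    finally have e1: "(1 / D)\<^sup>2 * t / 2 * sqnorm n x = sqnorm n x / (2 * D) - sqnorm n x / (2 * (p + D))"
      by (simp add: left_diff_distrib)
    have e2: "real n * ((sqnorm n x / real n - (p + D)) / (2 * (p + D))) = sqnorm n x / (2 * (p + D)) - real n / 2"
    proof -
      have "real n * ((X / real n - q) / (2 * q)) = X / (2 * q) - real n / 2" if "q \<noteq> 0" for X q :: real
        using that assms(3) by (simp add: field_simps)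
      from this[OF pD] show ?thesis .
    qed
    have e3: "real n * ((D' - D) / (2 * D)) = real n * D' / (2 * D) - real n / 2"
      using assms(2) by (simp add: field_simps)
    show ?thesis unfolding minus_mult_left[symmetric] right_diff_distrib e1 e2 e3 k_def by simp
  qed
  have gen: "N * (- l / 2) + Y + k = - N * (l / 2 + b - c)" if "Y + k = - N * (b - c)" for N l Y b c k :: real
    using that by (simp add: algebra_simps)
  show ?thesis using fin unfolding lnt gen[OF e] .
qed

text \<open>With \<open>c = p + u/2\<close>, the condition \<open>\<langle>x, y\<rangle> \<ge> n c\<close> on the sphere of squared radius \<open>n p\<close> says that
  the distortion is at most \<open>D\<close>; everything rests on the identity \<open>w t = p D - u\<^sup>2/4 - \<eta> L\<close>.\<close>

lemma window_rate:
  fixes p D u \<eta> :: real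
  assumes "p > 0" "D > 0" "\<bar>u\<bar> \<le> min p D" "0 < \<eta>" "\<eta> \<le> p * D / (20 * (p + D))"
  defines "w \<equiv> p + D + u" and "\<beta> \<equiv> (p + u / 2 + \<eta>) / (p + D + u)"
  defines "t \<equiv> p - \<eta> - w * \<beta>\<^sup>2"
  shows "t > 0" "\<beta> \<ge> 0" "w > 0" "p + u / 2 > 0" "w \<le> 2 * (p + D)"
    and "- (ln ((p + D) / D) / 2 + u / (2 * (p + D)) + (1 + 27 * (p + D)) / (p * D) * (u\<^sup>2 + \<eta>))
      \<le> ln (t / p) / 2 - \<eta> * (1/2 + \<beta>) / t"
proof -
  define s where "s = p + D"
  have s: "s > 0" using assms by (simp add: s_def)
  have pD: "p * D > 0" using assms by simp
  have us: "\<bar>u\<bar> \<le> s / 2" "\<bar>u\<bar> \<le> p" "\<bar>u\<bar> \<le> D" using assms(3) by (auto simp: s_def)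
  have w: "w = s + u" by (simp add: w_def s_def)
  have w1: "s / 2 \<le> w" "w \<le> 2 * s" using us s by (auto simp: w abs_le_iff)
  have eta: "\<eta> * (20 * s) \<le> p * D" using assms(5) s by (simp add: s_def le_divide_eq)
  have etap: "\<eta> \<le> p"
  proof -
    have "p * D \<le> p * (20 * s)" using assms(1,2) by (intro mult_left_mono) (auto simp: s_def)
    with eta have "\<eta> * (20 * s) \<le> p * (20 * s)" by linarith
    then show ?thesis using s by simp
  qed
  show w0: "w > 0" and "w \<le> 2 * (p + D)" using w1 s by (auto simp: s_def)
  show c0: "p + u / 2 > 0" using us assms(1) by linarith
  show b0: "\<beta> \<ge> 0" using c0 w0 assms(4) by (simp add: \<beta>_def w_def)
  have b5: "\<beta> \<le> 5"
  proof -
    have "p + u / 2 + \<eta> \<le> 5 * w" using us etap w1 assms(1,2) by (simp add: s_def abs_le_iff)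
    then show ?thesis using w0 by (simp add: \<beta>_def w_def divide_le_eq)
  qed
  define L where "L = s + 2 * u + 2 * p + \<eta>"
  have L: "0 < L" "L \<le> 5 * s" using us etap assms(1,2,4) by (auto simp: L_def s_def abs_le_iff)
  \<comment> \<open>Relative deficit of \<open>w * t\<close> from \<open>p * D\<close>. The 20 in
    the bound on \<open>\<eta>\<close> is what gives \<open>q \<le> 1/2\<close>: both
    \<open>u\<^sup>2 / 4\<close> and \<open>\<eta> * L\<close> are at most
    \<open>p * D / 4\<close>.\<close>
  define q where "q = (u\<^sup>2 / 4 + \<eta> * L) / (p * D)"
  have wt: "w * t = p * D * (1 - q)"
  proof -
    have "w * t = w * (p - \<eta>) - (w * \<beta>)\<^sup>2" by (simp add: t_def power2_eq_square algebra_simps)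
    \<comment> \<open>\<open>\<beta>\<close> places the lower edge
      \<open>w * \<beta> - \<eta>\<close> of the inner-product window exactly at
      \<open>p + u / 2\<close>. On expanding the square the terms linear in \<open>u\<close> cancel,
      so \<open>u\<close> enters the rate to first order through \<open>ln w\<close> alone.\<close>
    also have "w * \<beta> = p + u / 2 + \<eta>" using w0 by (simp add: \<beta>_def w_def)
    also have "w * (p - \<eta>) - (p + u / 2 + \<eta>)\<^sup>2 = p * D - (u\<^sup>2 / 4 + \<eta> * L)"
      by (simp add: w_def L_def s_def power2_eq_square algebra_simps)
    also have "\<dots> = p * D * (1 - q)" using assms(1,2) by (simp add: q_def right_diff_distrib)
    finally show ?thesis .
  qed
  have q0: "q \<ge> 0" using L assms(4) pD by (auto simp: q_def intro!: divide_nonneg_pos add_nonneg_nonneg)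
  have etaL: "\<eta> * L \<le> 5 * s * \<eta>" using mult_left_mono[OF L(2), of \<eta>] assms(4) by (simp add: mult_ac)
  have q1: "q \<le> 1/2"
  proof -
    have "u\<^sup>2 = \<bar>u\<bar> * \<bar>u\<bar>" by (simp add: power2_eq_square)
    also have "\<dots> \<le> p * D" using us assms(1) by (intro mult_mono) auto
    finally have "u\<^sup>2 / 4 + \<eta> * L \<le> p * D / 2" using etaL eta by (simp add: mult_ac)
    then show ?thesis using pD by (simp add: q_def divide_le_eq)
  qed
  have t_eq: "t = p * D * (1 - q) / w" using wt w0 by (simp add: eq_divide_eq mult.commute)
  show t0: "t > 0" unfolding t_eq using assms(1,2) q1 w0 by (intro divide_pos_pos mult_pos_pos) auto
  have t1: "p * D / (4 * s) \<le> t"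
  proof -
    have "p * D / (4 * s) = p * D * (1/2) / (2 * s)" by simp
    also have "\<dots> \<le> p * D * (1 - q) / w"
      using pD q1 w0 w1 s by (intro frac_le mult_left_mono) auto
    finally show ?thesis by (simp add: t_eq)
  qed
  have lt: "- (ln (s / D) + u / s + 2 * q) \<le> ln (t / p)"
  proof -
    have "ln (t / p) = ln D + ln (1 - q) - ln w"
      using assms(1,2) q1 w0 by (simp add: t_eq ln_div ln_mult)
    moreover have "ln w \<le> ln s + u / s"
    proof -
      have "ln w = ln s + ln (w / s)" using w0 s by (simp add: ln_div)
      also have "ln (w / s) \<le> w / s - 1" using w0 s by (intro ln_le_minus_one) simp
      also have "w / s - 1 = u / s" using s by (simp add: w field_simps)
      finally show ?thesis by simp
    qed
    moreover have "- ln (1 - q) \<le> 2 * q"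
    proof -
      have "- ln (1 - q) \<le> q + 2 * q\<^sup>2" using q0 q1 by (intro neg_ln_one_minus_le) auto
      also have "2 * q\<^sup>2 \<le> q" using mult_left_mono[OF q1 q0] by (simp add: power2_eq_square)
      finally show ?thesis by simp
    qed
    moreover have "ln (s / D) = ln s - ln D" using s assms by (simp add: ln_div)
    ultimately show ?thesis by linarith
  qed
  have "\<eta> * (1/2 + \<beta>) / t \<le> \<eta> * (11/2) / (p * D / (4 * s))"
    using t1 b5 b0 assms(4) pD s by (intro frac_le mult_left_mono) auto
  also have "\<dots> = 22 * s / (p * D) * \<eta>" using s pD by (simp add: field_simps)
  finally have et: "\<eta> * (1/2 + \<beta>) / t \<le> 22 * s / (p * D) * \<eta>" .
  \<comment> \<open>The constant 27 is 5 from \<open>\<eta> * L \<le> 5 * s * \<eta>\<close> plus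
    22, which comes from \<open>\<beta> \<le> 5\<close> and
    \<open>t \<ge> p * D / (4 * s)\<close>.\<close>
  have "q \<le> (u\<^sup>2 / 4 + 5 * s * \<eta>) / (p * D)"
    unfolding q_def using etaL pD by (intro divide_right_mono) auto
  then have "q + \<eta> * (1/2 + \<beta>) / t \<le> (u\<^sup>2 / 4 + 5 * s * \<eta>) / (p * D) + 22 * s / (p * D) * \<eta>"
    using et by simp
  also have "\<dots> = (u\<^sup>2 / 4 + 27 * s * \<eta>) / (p * D)" by (simp add: add_divide_distrib mult_ac)
  also have "\<dots> \<le> ((1 + 27 * s) * (u\<^sup>2 + \<eta>)) / (p * D)"
  proof (rule divide_right_mono)
    have "0 \<le> s * u\<^sup>2" using s by simp
    then show "u\<^sup>2 / 4 + 27 * s * \<eta> \<le> (1 + 27 * s) * (u\<^sup>2 + \<eta>)"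
      using assms(4) by (simp add: algebra_simps)
  qed (use pD in simp)
  finally have "q + \<eta> * (1/2 + \<beta>) / t \<le> (1 + 27 * s) / (p * D) * (u\<^sup>2 + \<eta>)" by simp
  moreover have "u / (2 * s) = (u / s) / 2" by simp
  ultimately have "- (ln (s / D) / 2 + u / (2 * s) + (1 + 27 * s) / (p * D) * (u\<^sup>2 + \<eta>))
      \<le> ln (t / p) / 2 - \<eta> * (1/2 + \<beta>) / t"
    using lt by linarith
  then show "- (ln ((p + D) / D) / 2 + u / (2 * (p + D)) + (1 + 27 * (p + D)) / (p * D) * (u\<^sup>2 + \<eta>))
      \<le> ln (t / p) / 2 - \<eta> * (1/2 + \<beta>) / t"
    by (simp only: s_def)
qed

text \<open>Pushing a point of \<open>S\<close> outward to the sphere multiplies its positive inner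
  product with \<open>x\<close> by at least 1, so \<open>S\<close> lies in the cone over the
  codewords within distortion \<open>D\<close>. Its volume is compared with its Gaussian mass at
  squared norm \<open>n (p - 2 \<eta>)\<close>, the ball with total mass 1 at squared norm
  \<open>n p\<close>; the quotient of the two conversion factors is
  \<open>exp (- n \<eta> / p)\<close>.\<close>

lemma sphere_ball_lower:
  fixes p D \<eta> w :: real
  assumes "p > 0" "D > 0" "n > 0" "sqnorm n x = real n * w" "w + p - D > 0"
    and S: "S \<in> sets (lebn n)"
    and "\<And>y. y \<in> S \<Longrightarrow> real n * (p - 2 * \<eta>) \<le> sqnorm n y \<and> sqnorm n y \<le> real n * p \<and>
      real n * ((w + p - D) / 2) \<le> iprod n x y"
  shows "exp (- real n * (\<eta> / p)) * measure (gauss p n) S \<le>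
    measure (sphere_unif n (sqrt (real n * p))) {y \<in> space (sphere_unif n (sqrt (real n * p))). distortion n x y \<le> D}"
proof -
  define r where "r = sqrt (real n * p)"
  have r: "r > 0" "r\<^sup>2 = real n * p" using assms by (auto simp: r_def)
  let ?A = "{y \<in> space (lebn n). distortion n x y \<le> D}"
  have A: "?A \<in> sets (lebn n)" unfolding distortion_altdef by measurable
  define N where "N = sqrt (2 * pi * p) ^ n"
  have N: "N > 0" using assms by (simp add: N_def)
  interpret prob_space "gauss p n" by (rule prob_space_gauss) fact
  have Bfin: "emeasure (lebn n) (ball_set n r) < \<infinity>" by (rule emeasure_ball_set_finite) fact
  have Bpos: "measure (lebn n) (ball_set n r) > 0"
    using Bfin emeasure_ball_set_pos[OF assms(3) r(1)] by (simp add: measure_def enn2real_positive_iff)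
  have sub: "S \<subseteq> cone_set n r r ?A"
  proof
    fix y assume y: "y \<in> S"
    have ysp: "y \<in> space (lebn n)" using y S by (auto dest: sets.sets_into_space)
    have ip: "real n * ((w + p - D) / 2) \<le> iprod n x y" using assms(7)[OF y] by simp
    have cp: "0 < real n * ((w + p - D) / 2)" using assms by simp
    \<comment> \<open>A positive inner product excludes the origin, which the cone omits.\<close>
    have "sqnorm n y \<noteq> 0" using iprod_eq_0_if_sqnorm_eq_0[of n y x] ip cp by auto
    then have y0: "0 < sqnorm n y" using sqnorm_nonneg[of n y] by simp
    have yr: "sqnorm n y \<le> r\<^sup>2" using assms(7)[OF y] r by simp
    have "iprod n x y \<le> iprod n x (radial n r y)"
    proof -
      have "sqrt (sqnorm n y) \<le> r" using yr r by (simp add: real_le_lsqrt)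
      then have "1 \<le> r / sqrt (sqnorm n y)" using y0 by simp
      then show ?thesis unfolding radial_def iprod_scale using ip cp
        by (metis less_le_trans less_imp_le mult_le_cancel_right1 not_less)
    qed
    then have "real n * (w + p - D) \<le> 2 * iprod n x (radial n r y)" using ip by simp
    then have "distortion n x (radial n r y) \<le> D"
      using assms(3) by (simp add: distortion_altdef sqnorm_radial[OF y0] r assms(4) divide_le_eq algebra_simps)
    moreover have "radial n r y \<in> space (lebn n)"
      by (auto simp: radial_def space_lebn space_PiM)
    ultimately show "y \<in> cone_set n r r ?A" using ysp y0 yr by (simp add: cone_set_def)
  qed
  have Cfin: "emeasure (lebn n) (cone_set n r r ?A) < \<infinity>"
  proof (rule le_less_trans[OF emeasure_mono Bfin])
    show "cone_set n r r ?A \<subseteq> ball_set n r" by (auto simp: cone_set_def ball_set_def)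
  qed measurable
  have Sfin: "emeasure (lebn n) S < \<infinity>"
    by (rule le_less_trans[OF emeasure_mono[OF sub] Cfin]) (rule sets_cone_set[OF A])
  have "N * exp (real n * (p - 2 * \<eta>) / (2 * p)) * measure (gauss p n) S \<le> measure (lebn n) S"
    unfolding N_def using assms(1,7) S Sfin by (intro gauss_le_lebn) auto
  also have "\<dots> \<le> measure (lebn n) (cone_set n r r ?A)"
    using sub S sets_cone_set[OF A] Cfin
    by (intro measure_mono_fmeasurable) (auto simp: fmeasurable_def)
  finally have 1: "N * exp (real n * (p - 2 * \<eta>) / (2 * p)) * measure (gauss p n) S \<le> measure (lebn n) (cone_set n r r ?A)" .
  have "measure (lebn n) (ball_set n r) \<le> N * exp (real n * p / (2 * p)) * measure (gauss p n) (ball_set n r)"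
    unfolding N_def using assms(1) r by (intro lebn_le_gauss) (auto simp: ball_set_def)
  also have "\<dots> \<le> N * exp (real n * p / (2 * p)) * 1"
    using N by (intro mult_left_mono) auto
  finally have 2: "measure (lebn n) (ball_set n r) \<le> N * exp (real n * p / (2 * p))" by simp
  have 3: "exp (- real n * (\<eta> / p)) * measure (gauss p n) S * (N * exp (real n * p / (2 * p))) =
      N * exp (real n * (p - 2 * \<eta>) / (2 * p)) * measure (gauss p n) S"
  proof -
    have "exp (- real n * (\<eta> / p)) * exp (real n * p / (2 * p)) = exp (real n * (p - 2 * \<eta>) / (2 * p))"
      unfolding exp_add[symmetric] using assms(1) by (intro arg_cong[of _ _ exp]) (simp add: field_simps)
    then show ?thesis by (metis mult.assoc mult.commute)
  qed
  have "exp (- real n * (\<eta> / p)) * measure (gauss p n) S * measure (lebn n) (ball_set n r) \<le>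
      exp (- real n * (\<eta> / p)) * measure (gauss p n) S * (N * exp (real n * p / (2 * p)))"
    by (intro mult_left_mono 2) auto
  also note 3
  also note 1
  finally have "exp (- real n * (\<eta> / p)) * measure (gauss p n) S \<le> measure (lebn n) (cone_set n r r ?A) / measure (lebn n) (ball_set n r)"
    using Bpos by (simp add: le_divide_eq)
  then show ?thesis
    unfolding r_def[symmetric] space_sphere_unif[OF assms(3) r(1)] measure_sphere_unif[OF assms(3) r(1) A] .
qed

text \<open>At least half of the volume of a cone over a spherical cap lies in the shell of relative
  width \<open>\<eta>\<close> below the sphere; there the Gaussian density is nearly constant and the distortion
  exceeds \<open>D\<close> by \<open>O(\<eta>)\<close> only.\<close>

lemma sphere_ball_upper:
  fixes p D \<eta> w :: real
  assumes "p > 0" "D > 0" "n > 0" "sqnorm n x = real n * w" "0 \<le> w + p - D" "w + p - D \<le> 4 * p"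
    and "0 < \<eta>" "\<eta> \<le> 1/2" "\<eta> \<le> p / 2" "1 \<le> real n * \<eta>"
    and "8 * p\<^sup>2 \<le> K" "p * w \<le> K" "12 * K \<le> real n * \<eta>\<^sup>2"
  shows "measure (sphere_unif n (sqrt (real n * p))) {y \<in> space (sphere_unif n (sqrt (real n * p))). distortion n x y \<le> D}
    \<le> exp (- real n * (ln ((p + D) / D) / 2 + (w - (p + D)) / (2 * (p + D)) - (2 * p / D + 3 / p + 2) * \<eta>))"
proof -
  define r where "r = sqrt (real n * p)"
  have r: "r > 0" "r\<^sup>2 = real n * p" using assms by (auto simp: r_def)
  let ?A = "{y \<in> space (lebn n). distortion n x y \<le> D}"
  have A: "?A \<in> sets (lebn n)" unfolding distortion_altdef by measurable
  define N where "N = sqrt (2 * pi * p) ^ n"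
  have N: "N > 0" using assms by (simp add: N_def)
  interpret prob_space "gauss p n" by (rule prob_space_gauss) fact
  have Bfin: "emeasure (lebn n) (ball_set n r) < \<infinity>" by (rule emeasure_ball_set_finite) fact
  have Bpos: "measure (lebn n) (ball_set n r) > 0"
    using Bfin emeasure_ball_set_pos[OF assms(3) r(1)] by (simp add: measure_def enn2real_positive_iff)
  have w: "w \<ge> 0" using assms(3,4) sqnorm_nonneg[of n x] by (simp add: zero_le_mult_iff)
  let ?C = "\<lambda>\<rho>. cone_set n r \<rho> ?A"
  define k where "k = 1 - \<eta>"
  have k: "0 < k" "k < 1" using assms by (auto simp: k_def)
  have kr: "(k * r)\<^sup>2 \<le> r\<^sup>2" using k r by (intro power_mono) (auto intro: mult_left_le_one_le)
  have Cfin: "emeasure (lebn n) (?C r) < \<infinity>"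
  proof (rule le_less_trans[OF emeasure_mono Bfin])
    show "?C r \<subseteq> ball_set n r" by (auto simp: cone_set_def ball_set_def)
  qed measurable
  have Csub: "?C (k * r) \<subseteq> ?C r" using kr by (auto simp: cone_set_def)
  let ?Sh = "?C r - ?C (k * r)"
  have Sh: "?Sh \<in> sets (lebn n)" using sets_cone_set[OF A] by auto
  have "measure (lebn n) ?Sh = measure (lebn n) (?C r) - measure (lebn n) (?C (k * r))"
    using sets_cone_set[OF A] Csub Cfin by (intro measure_Diff) auto
  also have "\<dots> = (1 - k ^ n) * measure (lebn n) (?C r)"
    using measure_cone_set_scale[OF k(1) r(1) A] by (simp add: algebra_simps)
  also have "\<dots> \<ge> (1/2) * measure (lebn n) (?C r)"
  proof (rule mult_right_mono)
    have "k ^ n \<le> exp (- \<eta>) ^ n"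
      using k exp_ge_add_one_self[of "- \<eta>"] by (intro power_mono) (auto simp: k_def)
    also have "\<dots> = exp (- (real n * \<eta>))" by (simp flip: exp_of_nat_mult)
    also have "\<dots> \<le> exp (- 1)" using assms by simp
    also have "\<dots> \<le> 1/2" using exp_ge_add_one_self[of "1::real"] by (simp add: exp_minus field_simps)
    finally show "1/2 \<le> 1 - k ^ n" by simp
  qed simp
  finally have C1: "measure (lebn n) (?C r) \<le> 2 * measure (lebn n) ?Sh" by simp
  define c where "c = (w + p - D) / 2"
  have c: "0 \<le> c" "c \<le> 2 * p" using assms by (auto simp: c_def)
  \<comment> \<open>On the shell the inner product is at least \<open>n * c * (1 - \<eta>)\<close>
    and the norm does not exceed that of the sphere, so the distortion grows by at most
    \<open>2 * \<eta> * c\<close>.\<close>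
  define D' where "D' = D + 2 * \<eta> * c"
  have sub: "?Sh \<subseteq> {y \<in> space (gauss p n). distortion n x y \<le> D'}"
  proof
    fix y assume y: "y \<in> ?Sh"
    have ysp: "y \<in> space (lebn n)" and y0: "0 < sqnorm n y" and yr: "sqnorm n y \<le> r\<^sup>2"
      and yA: "distortion n x (radial n r y) \<le> D" and yk: "(k * r)\<^sup>2 < sqnorm n y"
      using y by (auto simp: cone_set_def)
    have "real n * c \<le> iprod n x (radial n r y)"
      using yA assms(3) by (simp add: distortion_altdef sqnorm_radial[OF y0] r assms(4) divide_le_eq c_def algebra_simps)
    also have "\<dots> = r / sqrt (sqnorm n y) * iprod n x y" unfolding radial_def iprod_scale ..
    finally have "real n * c * (sqrt (sqnorm n y) / r) \<le> iprod n x y"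
      using y0 r by (simp add: field_simps)
    moreover have "real n * c * k \<le> real n * c * (sqrt (sqnorm n y) / r)"
    proof (rule mult_left_mono)
      have "k * r \<le> sqrt (sqnorm n y)" using yk by (intro real_le_rsqrt) simp
      then show "k \<le> sqrt (sqnorm n y) / r" using r by (simp add: le_divide_eq)
    qed (use c in simp)
    ultimately have "real n * c * k \<le> iprod n x y" by linarith
    then have "sqnorm n x - 2 * iprod n x y + sqnorm n y \<le> real n * w - 2 * (real n * c * k) + real n * p"
      using yr r assms(4) by simp
    also have "\<dots> = D' * real n" by (simp add: D'_def k_def c_def field_simps)
    finally show "y \<in> {y \<in> space (gauss p n). distortion n x y \<le> D'}"
      using ysp assms(3) by (simp add: distortion_altdef divide_le_eq space_lebn space_gauss)
  qed
  have "measure (lebn n) ?Sh \<le> N * exp (real n * p / (2 * p)) * measure (gauss p n) ?Sh"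
    unfolding N_def using assms(1) r Sh by (intro lebn_le_gauss) (auto simp: cone_set_def)
  also have "\<dots> \<le> N * exp (real n * p / (2 * p)) * measure (gauss p n) {y \<in> space (gauss p n). distortion n x y \<le> D'}"
    using N sub by (intro mult_left_mono finite_measure_mono) (auto simp: distortion_altdef)
  also have "\<dots> \<le> N * exp (real n * p / (2 * p)) *
      exp (- real n * (ln ((p + D) / D) / 2 + (sqnorm n x / real n - (p + D)) / (2 * (p + D)) - (D' - D) / (2 * D)))"
    using N by (intro mult_left_mono gauss_ball_upper assms) auto
  also have "sqnorm n x / real n = w" using assms(3,4) by simp
  also have "exp (real n * p / (2 * p)) = exp (real n / 2)" using assms(1) by simp
  finally have Sh_le: "measure (lebn n) ?Sh \<le> N * exp (real n / 2) *
      exp (- real n * (ln ((p + D) / D) / 2 + (w - (p + D)) / (2 * (p + D)) - (D' - D) / (2 * D)))" .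
  \<comment> \<open>The quotient also needs the ball from below. The window lemma with
    \<open>\<beta> = 0\<close>, that is without a shift towards \<open>x\<close>, gives the Gaussian
    mass of a shell inside the ball; the condition on the inner product merely shrinks that
    shell.\<close>
  let ?S = "{y \<in> space (gauss p n). real n * (p - 2 * \<eta>) \<le> sqnorm n y \<and> sqnorm n y \<le> real n * p \<and>
      real n * (w * 0 - \<eta>) \<le> iprod n x y \<and> iprod n x y \<le> real n * (w * 0 + \<eta>)}"
  have S: "?S \<in> sets (lebn n)" unfolding sets_lebn[folded sets_gauss[of p]] by measurable
  have Ssub: "?S \<subseteq> ball_set n r" using r by (auto simp: ball_set_def space_lebn space_gauss)
  have Sfin: "emeasure (lebn n) ?S < \<infinity>"
    by (rule le_less_trans[OF emeasure_mono[OF Ssub] Bfin]) measurable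
  have "exp (real n * (ln ((p - \<eta>) / p) / 2 - \<eta> * (1/2 + 0) / (p - \<eta>))) / 2 \<le> measure (gauss p n) ?S"
    using assms w by (intro gauss_window_lower[of _ _ _ _ _ _ _ K]) auto
  moreover have "exp (real n * (- (2 * \<eta> / p))) \<le> exp (real n * (ln ((p - \<eta>) / p) / 2 - \<eta> * (1/2 + 0) / (p - \<eta>)))"
  proof -
    have "- ln (1 - \<eta> / p) \<le> \<eta> / p + 2 * (\<eta> / p)\<^sup>2"
      using assms by (intro neg_ln_one_minus_le) (auto simp: field_simps)
    also have "2 * (\<eta> / p)\<^sup>2 \<le> \<eta> / p"
    proof -
      have "\<eta> / p * (\<eta> / p) \<le> 1/2 * (\<eta> / p)" using assms by (intro mult_right_mono) (auto simp: field_simps)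
      then show ?thesis by (simp add: power2_eq_square)
    qed
    finally have l: "- ln ((p - \<eta>) / p) \<le> 2 * (\<eta> / p)" using assms by (simp add: diff_divide_distrib)
    have "\<eta> * (1/2 + 0) / (p - \<eta>) \<le> \<eta> * (1/2) / (p / 2)" using assms by (intro frac_le) auto
    then have "- (2 * \<eta> / p) \<le> ln ((p - \<eta>) / p) / 2 - \<eta> * (1/2 + 0) / (p - \<eta>)" using l by simp
    then show ?thesis by (intro exp_mono mult_left_mono) auto
  qed
  ultimately have Sg: "exp (real n * (- (2 * \<eta> / p))) / 2 \<le> measure (gauss p n) ?S"
    by (meson divide_right_mono order_trans zero_le_numeral)
  have "N * exp (real n * (p - 2 * \<eta>) / (2 * p)) * (exp (real n * (- (2 * \<eta> / p))) / 2) \<le>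
      N * exp (real n * (p - 2 * \<eta>) / (2 * p)) * measure (gauss p n) ?S"
    using N Sg by (intro mult_left_mono) auto
  also have "\<dots> \<le> measure (lebn n) ?S"
    unfolding N_def by (rule gauss_le_lebn[OF assms(1) S _ Sfin]) blast
  also have "\<dots> \<le> measure (lebn n) (ball_set n r)"
    by (rule measure_mono_fmeasurable[OF Ssub S]) (use Bfin in \<open>auto simp: fmeasurable_def\<close>)
  \<comment> \<open>In \<open>3 / p\<close> one unit comes from the density at
    \<open>p - 2 * \<eta>\<close> and two from the mass of the shell.\<close>
  also have "N * exp (real n * (p - 2 * \<eta>) / (2 * p)) * (exp (real n * (- (2 * \<eta> / p))) / 2) =
      N * exp (real n / 2) * exp (- real n * (3 / p * \<eta>)) / 2"
  proof -
    have "exp (real n * (p - 2 * \<eta>) / (2 * p)) * exp (real n * (- (2 * \<eta> / p))) = exp (real n / 2) * exp (- real n * (3 / p * \<eta>))"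
      unfolding exp_add[symmetric] using assms(1) by (intro arg_cong[of _ _ exp]) (simp add: field_simps)
    then show ?thesis by simp
  qed
  finally have B_ge: "N * exp (real n / 2) * exp (- real n * (3 / p * \<eta>)) / 2 \<le> measure (lebn n) (ball_set n r)" .
  define E where "E = ln ((p + D) / D) / 2 + (w - (p + D)) / (2 * (p + D))"
  have "measure (lebn n) (?C r) \<le> 2 * (N * exp (real n / 2) * exp (- real n * (E - (D' - D) / (2 * D))))"
    using C1 Sh_le unfolding E_def by linarith
  also have "\<dots> = 4 * exp (- real n * (E - (D' - D) / (2 * D) - 3 / p * \<eta>)) * (N * exp (real n / 2) * exp (- real n * (3 / p * \<eta>)) / 2)"
  proof -
    have "exp (- real n * (E - (D' - D) / (2 * D))) = exp (- real n * (E - (D' - D) / (2 * D) - 3 / p * \<eta>)) * exp (- real n * (3 / p * \<eta>))"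
      unfolding exp_add[symmetric] by (intro arg_cong[of _ _ exp]) (simp add: algebra_simps)
    then show ?thesis by simp
  qed
  also have "\<dots> \<le> exp (- real n * (E - (2 * p / D + 3 / p + 2) * \<eta>)) * measure (lebn n) (ball_set n r)"
  proof (rule mult_mono[OF _ B_ge])
    \<comment> \<open>The 4 collects a factor 2 from the half of the cone and a factor 2 from
      \<open>B_ge\<close>. As \<open>1 \<le> real n * \<eta>\<close>, it is absorbed by
      \<open>exp (2 * (real n * \<eta>))\<close>, the source of the summand 2 in the
      constant.\<close>
    note four_le_exp_2
    also have "exp 2 \<le> exp (2 * (real n * \<eta>))" using assms(10) by simp
    finally have "4 * exp (- real n * (E - (D' - D) / (2 * D) - 3 / p * \<eta>)) \<le>
        exp (2 * (real n * \<eta>)) * exp (- real n * (E - (D' - D) / (2 * D) - 3 / p * \<eta>))"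
      by (intro mult_right_mono) auto
    also have "\<dots> \<le> exp (- real n * (E - (2 * p / D + 3 / p + 2) * \<eta>))"
      unfolding exp_add[symmetric]
    proof (rule exp_mono)
      have gen: "2 * (m * \<eta>) + - m * (E - X - b * \<eta>) \<le> - m * (E - (a + b + 2) * \<eta>)"
        if "m * X \<le> m * (\<eta> * a)" for m X a b :: real
        using that by (simp add: algebra_simps)
      have "(D' - D) / (2 * D) = \<eta> * (c / D)" using assms by (simp add: D'_def)
      also have "\<dots> \<le> \<eta> * (2 * p / D)" using c assms by (intro mult_left_mono divide_right_mono) auto
      finally have "real n * ((D' - D) / (2 * D)) \<le> real n * (\<eta> * (2 * p / D))" by (intro mult_left_mono) auto
      then show "2 * (real n * \<eta>) + - real n * (E - (D' - D) / (2 * D) - 3 / p * \<eta>) \<le>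
          - real n * (E - (2 * p / D + 3 / p + 2) * \<eta>)" by (rule gen)
    qed
    finally show "4 * exp (- real n * (E - (D' - D) / (2 * D) - 3 / p * \<eta>)) \<le>
        exp (- real n * (E - (2 * p / D + 3 / p + 2) * \<eta>))" .
  qed (use N in auto)
  finally have "measure (lebn n) (?C r) / measure (lebn n) (ball_set n r) \<le> exp (- real n * (E - (2 * p / D + 3 / p + 2) * \<eta>))"
    using Bpos by (simp add: divide_le_eq)
  then show ?thesis
    unfolding E_def r_def[symmetric] space_sphere_unif[OF assms(3) r(1)] measure_sphere_unif[OF assms(3) r(1) A] .
qed

section \<open>Rate bounds in a form common to both codebooks\<close>

definition psi :: "(nat \<Rightarrow> (nat \<Rightarrow> real) measure) \<Rightarrow> real \<Rightarrow> nat \<Rightarrow> (nat \<Rightarrow> real) \<Rightarrow> real" where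
  "psi Q D n x = measure (Q n) {y \<in> space (Q n). distortion n x y \<le> D}"

text \<open>Mass at most 1 is what puts \<open>1 - psi\<close> into the unit interval. Dimension 0
  is left out because the sphere then has radius 0.\<close>

definition regular_cb :: "(nat \<Rightarrow> (nat \<Rightarrow> real) measure) \<Rightarrow> bool" where
  "regular_cb Q \<longleftrightarrow> (\<forall>n>0. finite_measure (Q n) \<and> sets (Q n) = sets (PiM {..<n} (\<lambda>_. borel :: real measure)) \<and>
     (\<forall>A. measure (Q n) A \<le> 1))"

text \<open>Besides \<open>regular_cb\<close>, all that the final argument uses about a codebook.
  \<open>\<eta>\<close> stays free subject to \<open>c0 \<le> real n * \<eta>\<^sup>2\<close>, so
  that it can be tied to \<open>\<xi> n\<close> later. Only the lower bound has an error quadratic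
  in the deviation, since Chernoff's upper bound is linear in it.\<close>

definition ball_rate :: "real \<Rightarrow> real \<Rightarrow> (nat \<Rightarrow> (nat \<Rightarrow> real) measure) \<Rightarrow> bool" where
  "ball_rate s2 D Q \<longleftrightarrow> (\<exists>K c0 \<eta>0 \<delta>. 0 < K \<and> 0 < \<eta>0 \<and> 0 < \<delta> \<and>
     (\<forall>n x \<eta>. 0 < n \<longrightarrow> 0 < \<eta> \<longrightarrow> \<eta> \<le> \<eta>0 \<longrightarrow> c0 \<le> real n * \<eta>\<^sup>2 \<longrightarrow> \<bar>sqnorm n x / real n - s2\<bar> \<le> \<delta> \<longrightarrow>
       exp (- real n * (ln (s2 / D) / 2 + (sqnorm n x / real n - s2) / (2 * s2) +
         K * ((sqnorm n x / real n - s2)\<^sup>2 + \<eta>))) \<le> psi Q D n x \<and>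
       psi Q D n x \<le> exp (- real n * (ln (s2 / D) / 2 + (sqnorm n x / real n - s2) / (2 * s2) - K * \<eta>))))"

lemma regular_gaussian_cb:
  assumes "D < s2" shows "regular_cb (gaussian_cb s2 D)"
proof -
  interpret prob_space "gauss (s2 - D) n" for n using assms by (intro prob_space_gauss) simp
  show ?thesis
    by (auto simp: regular_cb_def gaussian_cb_eq_gauss sets_gauss intro: finite_measure_axioms)
qed

lemma regular_spherical_cb:
  assumes "D < s2" shows "regular_cb (spherical_cb s2 D)"
  using assms
  by (auto simp: regular_cb_def spherical_cb_def sets_sphere_unif sets_lebn
      intro!: finite_measure_sphere_unif measure_sphere_unif_le_1)

lemma ball_rate_codebooks:
  assumes "0 < D" "D < s2"
  shows "ball_rate s2 D (gaussian_cb s2 D)" "ball_rate s2 D (spherical_cb s2 D)"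
proof -
  define p where "p = s2 - D"
  have p: "p > 0" "s2 = p + D" using assms by (auto simp: p_def)
  define K1 where "K1 = (1 + 27 * (p + D)) / (p * D)"
  \<comment> \<open>Each summand pays for one loss: \<open>K1\<close> for the rate of the window, 1
    for a factor 1/2, \<open>1 / p\<close> for the passage to the sphere, and the rest for the
    spherical upper bound.\<close>
  define K where "K = K1 + 1 + 1 / p + 2 * p / D + 3 / p + 2"
  have K1: "K1 > 0" using p assms by (auto simp: K1_def intro!: divide_pos_pos add_pos_pos)
  have "0 < 1 / p" "0 < 3 / p" "0 < 2 * p / D" using p assms by auto
  then have KK: "K > 0" "K1 + 1 + 1 / p \<le> K" "2 * p / D + 3 / p + 2 \<le> K"
    using K1 unfolding K_def by linarith+
  \<comment> \<open>The second summand bounds \<open>p * w\<close>, as \<open>w \<le> 2 * s2\<close>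
    near the typical sphere. The threshold \<open>1 + 12 * K0\<close> for
    \<open>real n * \<eta>\<^sup>2\<close> used below yields the window hypothesis and also
    \<open>1 \<le> real n * \<eta>\<close>.\<close>
  define K0 where "K0 = 8 * p\<^sup>2 + 2 * p * s2"
  define \<eta>0 where "\<eta>0 = min (1/2) (p * D / (20 * (p + D)))"
  have eta0: "\<eta>0 > 0" using p assms by (simp add: \<eta>0_def)
  have K0: "8 * p\<^sup>2 \<le> K0" "K0 \<ge> 0" using p assms by (auto simp: K0_def)
  have *: "let w = sqnorm n x / real n; L = exp (- real n * (ln (s2 / D) / 2 + (w - s2) / (2 * s2) + K * ((w - s2)\<^sup>2 + \<eta>)));
        U = exp (- real n * (ln (s2 / D) / 2 + (w - s2) / (2 * s2) - K * \<eta>))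
      in L \<le> psi (gaussian_cb s2 D) D n x \<and> psi (gaussian_cb s2 D) D n x \<le> U \<and>
         L \<le> psi (spherical_cb s2 D) D n x \<and> psi (spherical_cb s2 D) D n x \<le> U"
    if n: "0 < n" and eta: "0 < \<eta>" "\<eta> \<le> \<eta>0" "1 + 12 * K0 \<le> real n * \<eta>\<^sup>2"
      and w: "\<bar>sqnorm n x / real n - s2\<bar> \<le> min p D" for n x \<eta>
  proof -
    define w where "w = sqnorm n x / real n"
    define u where "u = w - s2"
    have xw: "sqnorm n x = real n * w" using n by (simp add: w_def)
    have wu: "w = p + D + u" by (simp add: u_def p)
    have u: "\<bar>u\<bar> \<le> min p D" using w by (simp add: u_def w_def)
    have eta': "\<eta> \<le> p * D / (20 * (p + D))" "\<eta> \<le> 1/2" using eta by (auto simp: \<eta>0_def)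
    define \<beta> where "\<beta> = (p + u / 2 + \<eta>) / (p + D + u)"
    define t where "t = p - \<eta> - w * \<beta>\<^sup>2"
    note wr = window_rate[OF p(1) assms(1) u eta(1) eta'(1), folded wu, folded \<beta>_def[unfolded wu[symmetric]], folded t_def]
    have ne: "1 \<le> real n * \<eta>"
    proof -
      have "1 \<le> real n * \<eta>\<^sup>2" using eta K0 by simp
      also have "\<dots> \<le> real n * \<eta>" using eta eta' by (intro mult_left_mono) (auto simp: power2_eq_square mult_le_cancel_right1)
      finally show ?thesis .
    qed
    have etap: "\<eta> \<le> p / 2"
    proof -
      have "p * D / (20 * (p + D)) \<le> p * (p + D) / (20 * (p + D))" using p assms by (intro divide_right_mono mult_left_mono) auto
      also have "\<dots> = p / 20" using p assms by (simp add: field_simps)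
      finally show ?thesis using eta'(1) p(1) by linarith
    qed
    have pw: "p * w \<le> K0" using mult_left_mono[OF wr(5), of p] p by (simp add: K0_def add_increasing)
    have nK: "12 * K0 \<le> real n * \<eta>\<^sup>2" using eta by simp
    have wb: "w * \<beta> = p + u / 2 + \<eta>" using wr(3) by (simp add: \<beta>_def wu)
    have cc: "(w + p - D) / 2 = p + u / 2" by (simp add: wu)
    let ?S = "{y \<in> space (gauss p n). real n * (p - 2 * \<eta>) \<le> sqnorm n y \<and> sqnorm n y \<le> real n * p \<and>
      real n * (w * \<beta> - \<eta>) \<le> iprod n x y \<and> iprod n x y \<le> real n * (w * \<beta> + \<eta>)}"
    have S: "?S \<in> sets (gauss p n)" "?S \<in> sets (lebn n)"
      unfolding sets_lebn[folded sets_gauss[of p]] by measurable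
    interpret prob_space "gauss p n" by (rule prob_space_gauss) fact
    define R where "R = ln (s2 / D) / 2 + u / (2 * s2)"
    have "exp (- real n * (R + K1 * (u\<^sup>2 + \<eta>) + \<eta>)) \<le> exp (real n * (ln (t / p) / 2 - \<eta> * (1/2 + \<beta>) / t)) / 2"
    proof -
      have "exp (- real n * (R + K1 * (u\<^sup>2 + \<eta>) + \<eta>)) = exp (real n * - (R + K1 * (u\<^sup>2 + \<eta>))) * exp (- (real n * \<eta>))"
        by (simp add: algebra_simps flip: exp_add)
      also have "\<dots> \<le> exp (real n * (ln (t / p) / 2 - \<eta> * (1/2 + \<beta>) / t)) * (1/2)"
      proof (rule mult_mono)
        show "exp (real n * - (R + K1 * (u\<^sup>2 + \<eta>))) \<le> exp (real n * (ln (t / p) / 2 - \<eta> * (1/2 + \<beta>) / t))"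
          using wr(6) by (intro exp_mono mult_left_mono) (auto simp: R_def K1_def p(2))
        have "exp (- (real n * \<eta>)) \<le> exp (- 1)" using ne by simp
        also have "\<dots> \<le> 1/2" using exp_ge_add_one_self[of "1::real"] by (simp add: exp_minus field_simps)
        finally show "exp (- (real n * \<eta>)) \<le> 1/2" .
      qed auto
      finally show ?thesis by simp
    qed
    also have "\<dots> \<le> measure (gauss p n) ?S"
      using wr eta pw nK K0 by (intro gauss_window_lower[of _ _ _ _ _ _ _ K0]) (auto simp: xw t_def)
    finally have low: "exp (- real n * (R + K1 * (u\<^sup>2 + \<eta>) + \<eta>)) \<le> measure (gauss p n) ?S" .
    have Kle: "K1 * (u\<^sup>2 + \<eta>) + \<eta> + \<eta> / p \<le> K * (u\<^sup>2 + \<eta>)"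
    proof -
      have "K1 * (u\<^sup>2 + \<eta>) + \<eta> + \<eta> / p \<le> (K1 + 1 + 1 / p) * (u\<^sup>2 + \<eta>)"
        using p by (simp add: algebra_simps)
      also have "\<dots> \<le> K * (u\<^sup>2 + \<eta>)" using KK eta by (intro mult_right_mono) auto
      finally show ?thesis .
    qed
    have "measure (gauss p n) ?S \<le> psi (gaussian_cb s2 D) D n x"
      unfolding psi_def gaussian_cb_eq_gauss p_def[symmetric]
    proof (rule finite_measure_mono)
      show "{y \<in> space (gauss p n). distortion n x y \<le> D} \<in> sets (gauss p n)"
        unfolding distortion_altdef by measurable
      show "?S \<subseteq> {y \<in> space (gauss p n). distortion n x y \<le> D}"
      proof
        fix y assume y: "y \<in> ?S"
        then have "real n * (w + p - D) \<le> 2 * iprod n x y" "sqnorm n y \<le> real n * p"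
          unfolding wb by (auto simp: wu algebra_simps)
        then show "y \<in> {y \<in> space (gauss p n). distortion n x y \<le> D}"
          using y n by (simp add: distortion_altdef divide_le_eq xw algebra_simps)
      qed
    qed
    moreover have "exp (- real n * (R + K * (u\<^sup>2 + \<eta>))) \<le> exp (- real n * (R + K1 * (u\<^sup>2 + \<eta>) + \<eta>))"
    proof (rule exp_mono)
      have "R + K1 * (u\<^sup>2 + \<eta>) + \<eta> \<le> R + K * (u\<^sup>2 + \<eta>)" using Kle p eta by (smt (verit) divide_nonneg_pos)
      then show "- real n * (R + K * (u\<^sup>2 + \<eta>)) \<le> - real n * (R + K1 * (u\<^sup>2 + \<eta>) + \<eta>)"
        by (simp add: mult_left_mono)
    qed
    ultimately have g1: "exp (- real n * (R + K * (u\<^sup>2 + \<eta>))) \<le> psi (gaussian_cb s2 D) D n x"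
      using low by linarith
    have Ule: "exp (- real n * (R - k * \<eta>)) \<le> exp (- real n * (R - K * \<eta>))" if "k \<le> K" for k
    proof (rule exp_mono)
      have "R - K * \<eta> \<le> R - k * \<eta>" using that eta by (simp add: mult_right_mono)
      then show "- real n * (R - k * \<eta>) \<le> - real n * (R - K * \<eta>)" by (simp add: mult_left_mono)
    qed
    have "psi (gaussian_cb s2 D) D n x \<le> exp (- real n * (R - 0 * \<eta>))"
      unfolding psi_def gaussian_cb_eq_gauss p_def[symmetric]
      using gauss_ball_upper[OF p(1) assms(1) n, of x D] by (simp add: R_def p(2) u_def w_def)
    also have "\<dots> \<le> exp (- real n * (R - K * \<eta>))" using KK by (intro Ule) simp
    finally have g2: "psi (gaussian_cb s2 D) D n x \<le> exp (- real n * (R - K * \<eta>))" .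
    have "exp (- real n * (R + K * (u\<^sup>2 + \<eta>))) \<le> exp (- real n * (\<eta> / p)) * exp (- real n * (R + K1 * (u\<^sup>2 + \<eta>) + \<eta>))"
      unfolding exp_add[symmetric]
    proof (rule exp_mono)
      have "real n * (K1 * (u\<^sup>2 + \<eta>) + \<eta> + \<eta> / p) \<le> real n * (K * (u\<^sup>2 + \<eta>))"
        using Kle by (intro mult_left_mono) auto
      then show "- real n * (R + K * (u\<^sup>2 + \<eta>)) \<le> - real n * (\<eta> / p) + - real n * (R + K1 * (u\<^sup>2 + \<eta>) + \<eta>)"
        by (simp add: distrib_left)
    qed
    also have "\<dots> \<le> exp (- real n * (\<eta> / p)) * measure (gauss p n) ?S"
      using low by (intro mult_left_mono) auto
    also have "\<dots> \<le> psi (spherical_cb s2 D) D n x"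
      unfolding psi_def spherical_cb_def p_def[symmetric]
    proof (rule sphere_ball_lower[OF p(1) assms(1) n xw _ S(2)])
      show "w + p - D > 0" using wr(4) by (simp add: wu)
      have wbc: "w * \<beta> - \<eta> = (w + p - D) / 2" by (simp add: wb cc)
      show "real n * (p - 2 * \<eta>) \<le> sqnorm n y \<and> sqnorm n y \<le> real n * p \<and>
          real n * ((w + p - D) / 2) \<le> iprod n x y" if "y \<in> ?S" for y
        using that unfolding wbc by blast
    qed
    finally have s1: "exp (- real n * (R + K * (u\<^sup>2 + \<eta>))) \<le> psi (spherical_cb s2 D) D n x" .
    have "psi (spherical_cb s2 D) D n x \<le> exp (- real n * (R - (2 * p / D + 3 / p + 2) * \<eta>))"
      unfolding psi_def spherical_cb_def p_def[symmetric] R_def u_def p(2)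
      using sphere_ball_upper[OF p(1) assms(1) n xw _ _ eta(1) eta'(2) etap ne K0(1) pw nK] u
      by (auto simp: wu abs_le_iff)
    also have "\<dots> \<le> exp (- real n * (R - K * \<eta>))" using KK by (intro Ule) simp
    finally have s2: "psi (spherical_cb s2 D) D n x \<le> exp (- real n * (R - K * \<eta>))" .
    show ?thesis using g1 g2 s1 s2 unfolding Let_def w_def[symmetric] u_def[symmetric] R_def[symmetric] by blast
  qed
  have d: "0 < min p D" using p assms by simp
  show "ball_rate s2 D (gaussian_cb s2 D)"
    unfolding ball_rate_def
  proof (rule exI[of _ K], rule exI[of _ "1 + 12 * K0"], rule exI[of _ \<eta>0], rule exI[of _ "min p D"],
      rule conjI[OF KK(1)], rule conjI[OF eta0], rule conjI[OF d], intro allI impI)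
    fix n x \<eta>
    assume a: "0 < n" "0 < \<eta>" "\<eta> \<le> \<eta>0" "1 + 12 * K0 \<le> real n * \<eta>\<^sup>2"
      "\<bar>sqnorm n x / real n - s2\<bar> \<le> min p D"
    show "exp (- real n * (ln (s2 / D) / 2 + (sqnorm n x / real n - s2) / (2 * s2) +
          K * ((sqnorm n x / real n - s2)\<^sup>2 + \<eta>))) \<le> psi (gaussian_cb s2 D) D n x \<and>
        psi (gaussian_cb s2 D) D n x \<le>
          exp (- real n * (ln (s2 / D) / 2 + (sqnorm n x / real n - s2) / (2 * s2) - K * \<eta>))"
      using *[OF a] unfolding Let_def by (elim conjE) (intro conjI)
  qed
  show "ball_rate s2 D (spherical_cb s2 D)"
    unfolding ball_rate_def
  proof (rule exI[of _ K], rule exI[of _ "1 + 12 * K0"], rule exI[of _ \<eta>0], rule exI[of _ "min p D"],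
      rule conjI[OF KK(1)], rule conjI[OF eta0], rule conjI[OF d], intro allI impI)
    fix n x \<eta>
    assume a: "0 < n" "0 < \<eta>" "\<eta> \<le> \<eta>0" "1 + 12 * K0 \<le> real n * \<eta>\<^sup>2"
      "\<bar>sqnorm n x / real n - s2\<bar> \<le> min p D"
    show "exp (- real n * (ln (s2 / D) / 2 + (sqnorm n x / real n - s2) / (2 * s2) +
          K * ((sqnorm n x / real n - s2)\<^sup>2 + \<eta>))) \<le> psi (spherical_cb s2 D) D n x \<and>
        psi (spherical_cb s2 D) D n x \<le>
          exp (- real n * (ln (s2 / D) / 2 + (sqnorm n x / real n - s2) / (2 * s2) - K * \<eta>))"
      using *[OF a] unfolding Let_def by (elim conjE) (intro conjI)
  qed
qed

section \<open>Moderate deviations of the source\<close>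

lemma exp_taylor2_bound:
  fixes y :: real
  shows "\<bar>exp y - (1 + y + y\<^sup>2 / 2)\<bar> \<le> \<bar>y\<bar> ^ 3 * exp \<bar>y\<bar>"
proof -
  obtain t where t: "\<bar>t\<bar> \<le> \<bar>y\<bar>" "exp y = (\<Sum>m<3. y ^ m / fact m) + exp t / fact 3 * y ^ 3"
    using Maclaurin_exp_le[of y 3] by blast
  have "exp y - (1 + y + y\<^sup>2 / 2) = exp t / 6 * y ^ 3"
    using t(2) by (simp add: eval_nat_numeral)
  also have "\<bar>\<dots>\<bar> = exp t / 6 * \<bar>y\<bar> ^ 3" by (simp add: abs_mult power_abs)
  also have "\<dots> \<le> exp \<bar>y\<bar> * \<bar>y\<bar> ^ 3"
  proof (rule mult_right_mono)
    have "exp t / 6 \<le> exp t" by simp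
    also have "\<dots> \<le> exp \<bar>y\<bar>" using t(1) by simp
    finally show "exp t / 6 \<le> exp \<bar>y\<bar>" .
  qed simp
  finally show ?thesis by (simp add: mult.commute)
qed

lemma cube_le_exp:
  fixes z :: real
  assumes "z \<ge> 0" shows "z ^ 3 \<le> 27 * exp z"
proof -
  have "(z / 3) ^ 3 \<le> exp (z / 3) ^ 3"
    using assms exp_ge_add_one_self[of "z / 3"] by (intro power_mono) linarith+
  also have "\<dots> = exp z" by (simp flip: exp_of_nat_mult)
  finally show ?thesis by (simp add: power_divide)
qed

text \<open>The cumulant of the centred square of the source near 0, with \<open>v\<close> as its
  variance and a cubic error. Both directions are needed: the upper one for Chernoff bounds, the
  lower one for the normalizer of the tilted source.\<close>

definition mgf_quadratic :: "real measure \<Rightarrow> real \<Rightarrow> real \<Rightarrow> real \<Rightarrow> real \<Rightarrow> bool" where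
  "mgf_quadratic P s2 v C l0 \<longleftrightarrow> (\<forall>l. \<bar>l\<bar> \<le> l0 \<longrightarrow> integrable P (\<lambda>x. exp (l * (x\<^sup>2 - s2))) \<and>
     exp (l\<^sup>2 * v / 2 - C * \<bar>l\<bar> ^ 3) \<le> (\<integral>x. exp (l * (x\<^sup>2 - s2)) \<partial>P) \<and>
     (\<integral>x. exp (l * (x\<^sup>2 - s2)) \<partial>P) \<le> exp (l\<^sup>2 * v / 2 + C * \<bar>l\<bar> ^ 3))"

text \<open>Taylor expansion under the integral: the exponential moment of the square dominates the
  third-order remainder uniformly in \<open>l\<close>, and the first two moments of \<open>Z\<close>
  are 0 and \<open>v\<close>.\<close>

lemma mgf_quadratic_exists:
  fixes P :: "real measure" and \<theta> :: real
  assumes "prob_space P" "sets P = sets borel"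
    and i2: "integrable P (\<lambda>x. x^2)" and i4: "integrable P (\<lambda>x. x^4)"
    and "\<theta> > 0" and ie: "integrable P (\<lambda>x. exp (\<theta> * x^2))"
  defines "s2 \<equiv> (\<integral>x. x^2 \<partial>P)" and "v \<equiv> (\<integral>x. x^4 \<partial>P) - (\<integral>x. x^2 \<partial>P)\<^sup>2"
  shows "\<exists>C l0. 0 \<le> C \<and> 0 < l0 \<and> mgf_quadratic P s2 v C l0"
proof -
  interpret prob_space P by fact
  note assms(2)[measurable_cong]
  have s2: "s2 \<ge> 0" unfolding s2_def by simp
  define Z where "Z = (\<lambda>x::real. x\<^sup>2 - s2)"
  have Zm[measurable]: "Z \<in> borel_measurable P" unfolding Z_def by measurable
  have iZ: "integrable P Z" unfolding Z_def using i2 by simp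
  have eZ: "(\<integral>x. Z x \<partial>P) = 0" unfolding Z_def using i2 by (simp add: s2_def prob_space)
  have Z2: "(Z x)\<^sup>2 = x ^ 4 - 2 * s2 * x\<^sup>2 + s2\<^sup>2" for x
    by (simp add: Z_def power2_diff flip: power_mult)
  have iZ2: "integrable P (\<lambda>x. (Z x)\<^sup>2)" unfolding Z2 using i2 i4 by simp
  have eZ2: "(\<integral>x. (Z x)\<^sup>2 \<partial>P) = v"
    unfolding Z2 using i2 i4 by (simp add: v_def s2_def prob_space power2_eq_square)
  have v: "v \<ge> 0" unfolding eZ2[symmetric] by simp
  define W where "W = (\<lambda>x::real. exp (\<theta> * x\<^sup>2) * exp (\<theta> * s2))"
  have iW: "integrable P W" unfolding W_def using ie by simp
  have W0: "W x \<ge> 0" for x by (simp add: W_def)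
  have ZW: "exp (\<theta> * \<bar>Z x\<bar>) \<le> W x" for x
  proof -
    have "\<bar>Z x\<bar> \<le> x\<^sup>2 + s2" using s2 by (simp add: Z_def abs_le_iff)
    then have "\<theta> * \<bar>Z x\<bar> \<le> \<theta> * (x\<^sup>2 + s2)" using assms(5) by (intro mult_left_mono) auto
    then show ?thesis by (simp add: W_def distrib_left flip: exp_add)
  qed
  \<comment> \<open>Half of \<open>\<theta>\<close> absorbs the cube in the remainder, through
    \<open>cube_le_exp\<close>, and half its exponential.\<close>
  define k where "k = \<theta> / 2"
  have k: "k > 0" using assms(5) by (simp add: k_def)
  define C0 where "C0 = 27 / k ^ 3 * (\<integral>x. W x \<partial>P)"
  have C0: "C0 \<ge> 0" using k W0 by (auto simp: C0_def intro!: mult_nonneg_nonneg integral_nonneg)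
  have im: "integrable P (\<lambda>x. exp (l * Z x))" if l: "\<bar>l\<bar> \<le> k" for l
  proof (rule Bochner_Integration.integrable_bound[OF iW])
    show "AE x in P. norm (exp (l * Z x)) \<le> norm (W x)"
    proof (intro AE_I2)
      fix x
      have "l * Z x \<le> \<bar>l\<bar> * \<bar>Z x\<bar>" by (metis abs_ge_self abs_mult)
      also have "\<dots> \<le> \<theta> * \<bar>Z x\<bar>" using l k by (intro mult_right_mono) (auto simp: k_def)
      finally have "exp (l * Z x) \<le> exp (\<theta> * \<bar>Z x\<bar>)" by simp
      from order_trans[OF this ZW] show "norm (exp (l * Z x)) \<le> norm (W x)" using W0[of x] by simp
    qed
  qed measurable
  have main: "\<bar>(\<integral>x. exp (l * Z x) \<partial>P) - (1 + l\<^sup>2 * v / 2)\<bar> \<le> C0 * \<bar>l\<bar> ^ 3" if l: "\<bar>l\<bar> \<le> k" for l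
  proof -
    have pt: "\<bar>exp (l * Z x) - (1 + l * Z x + (l * Z x)\<^sup>2 / 2)\<bar> \<le> \<bar>l\<bar> ^ 3 * (27 / k ^ 3) * W x" for x
    proof -
      have "\<bar>exp (l * Z x) - (1 + l * Z x + (l * Z x)\<^sup>2 / 2)\<bar> \<le> \<bar>l * Z x\<bar> ^ 3 * exp \<bar>l * Z x\<bar>"
        by (rule exp_taylor2_bound)
      also have "\<dots> = \<bar>l\<bar> ^ 3 * (1 / k ^ 3) * ((k * \<bar>Z x\<bar>) ^ 3 * exp \<bar>l * Z x\<bar>)"
        using k by (simp add: abs_mult power_mult_distrib)
      also have "\<dots> \<le> \<bar>l\<bar> ^ 3 * (1 / k ^ 3) * ((27 * exp (k * \<bar>Z x\<bar>)) * exp (k * \<bar>Z x\<bar>))"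
        using k l by (intro mult_left_mono mult_mono cube_le_exp)
          (auto simp: abs_mult intro!: mult_right_mono)
      also have "\<dots> = \<bar>l\<bar> ^ 3 * (27 / k ^ 3) * exp (\<theta> * \<bar>Z x\<bar>)"
      proof -
        have "exp (k * \<bar>Z x\<bar>) * exp (k * \<bar>Z x\<bar>) = exp (\<theta> * \<bar>Z x\<bar>)"
          by (simp add: k_def flip: exp_add)
        then show ?thesis by simp
      qed
      also have "\<dots> \<le> \<bar>l\<bar> ^ 3 * (27 / k ^ 3) * W x" using k ZW by (intro mult_left_mono) auto
      finally show ?thesis .
    qed
    have int: "integrable P (\<lambda>x. 1 + l * Z x + (l * Z x)\<^sup>2 / 2)"
      using iZ iZ2 by (simp add: power_mult_distrib)
    have "(\<integral>x. 1 + l * Z x + (l * Z x)\<^sup>2 / 2 \<partial>P) = 1 + l\<^sup>2 * v / 2"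
      using iZ iZ2 eZ eZ2 by (simp add: power_mult_distrib prob_space)
    then have "\<bar>(\<integral>x. exp (l * Z x) \<partial>P) - (1 + l\<^sup>2 * v / 2)\<bar> =
        \<bar>\<integral>x. exp (l * Z x) - (1 + l * Z x + (l * Z x)\<^sup>2 / 2) \<partial>P\<bar>"
      using im[OF l] int by (subst Bochner_Integration.integral_diff) auto
    also have "\<dots> \<le> (\<integral>x. \<bar>exp (l * Z x) - (1 + l * Z x + (l * Z x)\<^sup>2 / 2)\<bar> \<partial>P)"
      by (rule integral_abs_bound)
    also have "\<dots> \<le> (\<integral>x. \<bar>l\<bar> ^ 3 * (27 / k ^ 3) * W x \<partial>P)"
      using pt iW im[OF l] int by (intro integral_mono integrable_abs Bochner_Integration.integrable_diff) auto
    also have "\<dots> = C0 * \<bar>l\<bar> ^ 3" by (simp add: C0_def)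
    finally show ?thesis .
  qed
  \<comment> \<open>For the lower bound, \<open>1 + y \<ge> exp (y - 2 * y\<^sup>2)\<close> when
    \<open>\<bar>y\<bar> \<le> 1/2\<close>. Since \<open>\<bar>y\<bar> \<le> l\<^sup>2 * A\<close>,
    the loss is of order \<open>l ^ 4\<close> and thus again cubic, which explains
    \<open>2 * A\<^sup>2\<close> in \<open>C\<close>; \<open>l0\<close> ensures
    \<open>\<bar>l\<bar> \<le> 1\<close> and \<open>\<bar>y\<bar> \<le> 1/2\<close>.\<close>
  define A where "A = v / 2 + C0"
  have A: "A \<ge> 0" using v C0 by (simp add: A_def)
  define C where "C = C0 + 2 * A\<^sup>2"
  define l0 where "l0 = min k (1 / (2 * A + 2))"
  have l0: "l0 > 0" using k A by (simp add: l0_def add_nonneg_pos)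
  have "mgf_quadratic P s2 v C l0"
    unfolding mgf_quadratic_def
  proof (intro allI impI)
    fix l :: real assume "\<bar>l\<bar> \<le> l0"
    then have l: "\<bar>l\<bar> \<le> k" "\<bar>l\<bar> \<le> 1 / (2 * A + 2)" by (auto simp: l0_def)
    have lA: "\<bar>l\<bar> * (2 * A + 2) \<le> 1" using l(2) A by (simp add: le_divide_eq)
    have l1: "\<bar>l\<bar> \<le> 1"
    proof -
      have "\<bar>l\<bar> * 1 \<le> \<bar>l\<bar> * (2 * A + 2)" using A by (intro mult_left_mono) auto
      then show ?thesis using lA by simp
    qed
    let ?m = "\<integral>x. exp (l * Z x) \<partial>P"
    have l3: "\<bar>l\<bar> ^ 3 \<le> l\<^sup>2"
      using l1 power_decreasing[of 2 3 "\<bar>l\<bar>"] by simp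
    have l4: "l ^ 4 \<le> \<bar>l\<bar> ^ 3"
      using l1 power_decreasing[of 3 4 "\<bar>l\<bar>"] by (simp add: power_even_abs)
    have up: "?m \<le> exp (l\<^sup>2 * v / 2 + C * \<bar>l\<bar> ^ 3)"
    proof -
      have "?m \<le> 1 + (l\<^sup>2 * v / 2 + C0 * \<bar>l\<bar> ^ 3)" using main[OF l(1)] by linarith
      also have "\<dots> \<le> exp (l\<^sup>2 * v / 2 + C0 * \<bar>l\<bar> ^ 3)" by (rule exp_ge_add_one_self)
      also have "\<dots> \<le> exp (l\<^sup>2 * v / 2 + C * \<bar>l\<bar> ^ 3)"
        by (intro exp_mono add_left_mono mult_right_mono) (auto simp: C_def)
      finally show ?thesis .
    qed
    define y where "y = l\<^sup>2 * v / 2 - C0 * \<bar>l\<bar> ^ 3"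
    have ya: "\<bar>y\<bar> \<le> l\<^sup>2 * A"
    proof -
      have "\<bar>y\<bar> \<le> \<bar>l\<^sup>2 * v / 2\<bar> + \<bar>C0 * \<bar>l\<bar> ^ 3\<bar>" unfolding y_def by (rule abs_triangle_ineq4)
      also have "\<dots> = l\<^sup>2 * v / 2 + C0 * \<bar>l\<bar> ^ 3" using v C0 by (simp add: abs_mult)
      also have "\<dots> \<le> l\<^sup>2 * v / 2 + C0 * l\<^sup>2" using C0 l3 by (intro add_left_mono mult_left_mono) auto
      finally show ?thesis by (simp add: A_def algebra_simps)
    qed
    have y12: "\<bar>y\<bar> \<le> 1/2"
    proof -
      have "l\<^sup>2 * A = \<bar>l\<bar> * (\<bar>l\<bar> * A)" by (simp add: power2_eq_square)
      also have "\<dots> \<le> 1 * (\<bar>l\<bar> * A)" using l1 A by (intro mult_right_mono) auto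
      also have "\<dots> \<le> 1/2" using lA by (simp add: distrib_left)
      finally show ?thesis using ya by simp
    qed
    have "y\<^sup>2 \<le> (l\<^sup>2 * A)\<^sup>2" using ya by (metis abs_ge_zero power2_abs power_mono)
    also have "\<dots> = l ^ 4 * A\<^sup>2" by (simp add: power_mult_distrib flip: power_mult)
    also have "\<dots> \<le> \<bar>l\<bar> ^ 3 * A\<^sup>2" using l4 by (intro mult_right_mono) auto
    finally have y2: "y\<^sup>2 \<le> \<bar>l\<bar> ^ 3 * A\<^sup>2" .
    have "- ln (1 - (- y)) \<le> - y + 2 * (- y)\<^sup>2" using y12 by (intro neg_ln_one_minus_le) auto
    then have "y - 2 * y\<^sup>2 \<le> ln (1 + y)" by simp
    moreover have "l\<^sup>2 * v / 2 - C * \<bar>l\<bar> ^ 3 = y - 2 * (\<bar>l\<bar> ^ 3 * A\<^sup>2)"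
      by (simp add: y_def C_def algebra_simps)
    ultimately have "l\<^sup>2 * v / 2 - C * \<bar>l\<bar> ^ 3 \<le> ln (1 + y)" using y2 by linarith
    then have "exp (l\<^sup>2 * v / 2 - C * \<bar>l\<bar> ^ 3) \<le> exp (ln (1 + y))" by simp
    also have "\<dots> = 1 + y" using y12 by (intro exp_ln) linarith
    also have "\<dots> \<le> ?m" using main[OF l(1)] unfolding y_def by linarith
    finally have "exp (l\<^sup>2 * v / 2 - C * \<bar>l\<bar> ^ 3) \<le> ?m" .
    then show "integrable P (\<lambda>x. exp (l * (x\<^sup>2 - s2))) \<and>
     exp (l\<^sup>2 * v / 2 - C * \<bar>l\<bar> ^ 3) \<le> (\<integral>x. exp (l * (x\<^sup>2 - s2)) \<partial>P) \<and>
     (\<integral>x. exp (l * (x\<^sup>2 - s2)) \<partial>P) \<le> exp (l\<^sup>2 * v / 2 + C * \<bar>l\<bar> ^ 3)"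
      using up im[OF l(1)] unfolding Z_def by simp
  qed
  moreover have "0 \<le> C" using C0 by (simp add: C_def)
  ultimately show ?thesis using l0 by blast
qed

lemma source_mgf:
  assumes "prob_space P" "mgf_quadratic P s2 v C l0" "\<bar>l\<bar> \<le> l0"
  shows "integrable (PiM {..<n} (\<lambda>_. P)) (\<lambda>x. exp (l * (sqnorm n x - real n * s2)))" (is ?I)
    and "exp (real n * (l\<^sup>2 * v / 2 - C * \<bar>l\<bar> ^ 3)) \<le> (\<integral>x. exp (l * (sqnorm n x - real n * s2)) \<partial>PiM {..<n} (\<lambda>_. P))" (is ?L)
    and "(\<integral>x. exp (l * (sqnorm n x - real n * s2)) \<partial>PiM {..<n} (\<lambda>_. P)) \<le> exp (real n * (l\<^sup>2 * v / 2 + C * \<bar>l\<bar> ^ 3))" (is ?U)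
proof -
  interpret prob_space P by fact
  interpret product_sigma_finite "\<lambda>_::nat. P" by unfold_locales
  let ?m = "\<integral>x. exp (l * (x\<^sup>2 - s2)) \<partial>P"
  have m: "integrable P (\<lambda>x. exp (l * (x\<^sup>2 - s2)))" "exp (l\<^sup>2 * v / 2 - C * \<bar>l\<bar> ^ 3) \<le> ?m"
    "?m \<le> exp (l\<^sup>2 * v / 2 + C * \<bar>l\<bar> ^ 3)"
    using assms(2,3) unfolding mgf_quadratic_def by blast+
  have pr: "exp (l * (sqnorm n x - real n * s2)) = (\<Prod>i<n. exp (l * ((x i)\<^sup>2 - s2)))" for x
    by (simp add: sqnorm_def sum_subtractf flip: exp_sum sum_distrib_left)
  show ?I unfolding pr using m(1) by (intro product_integrable_prod) auto
  have e: "(\<integral>x. exp (l * (sqnorm n x - real n * s2)) \<partial>PiM {..<n} (\<lambda>_. P)) = ?m ^ n"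
    unfolding pr using m(1) by (subst product_integral_prod) auto
  show ?L unfolding e exp_of_nat_mult using m(2) by (intro power_mono) auto
  show ?U unfolding e exp_of_nat_mult using m(2,3) by (intro power_mono) (auto intro: order_trans[OF exp_ge_zero])
qed

text \<open>The sign of \<open>l\<close> is free, so that one statement serves both tails.\<close>

lemma source_chernoff:
  assumes "prob_space P" "sets P = sets borel" "mgf_quadratic P s2 v C l0" "\<bar>l\<bar> \<le> l0"
  shows "measure (PiM {..<n} (\<lambda>_. P)) {x \<in> space (PiM {..<n} (\<lambda>_. P)). real n * r \<le> l * (sqnorm n x - real n * s2)}
    \<le> exp (real n * (l\<^sup>2 * v / 2 + C * \<bar>l\<bar> ^ 3 - r))"
proof -
  let ?M = "PiM {..<n} (\<lambda>_. P)"
  let ?A = "{x \<in> space ?M. real n * r \<le> l * (sqnorm n x - real n * s2)}"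
  interpret prob_space ?M by (intro prob_space_PiM assms)
  have [measurable_cong]: "sets ?M = sets (PiM {..<n} (\<lambda>_. borel))" by (intro sets_PiM_cong) (auto simp: assms)
  have A: "?A \<in> sets ?M" by measurable
  note m = source_mgf[OF assms(1,3,4), of n]
  have "measure ?M ?A = (\<integral>x. indicator ?A x \<partial>?M)" using A by simp
  also have "\<dots> \<le> (\<integral>x. exp (l * (sqnorm n x - real n * s2)) * exp (- real n * r) \<partial>?M)"
  proof (rule integral_mono)
    show "integrable ?M (indicator ?A :: _ \<Rightarrow> real)"
      using A by (intro integrable_real_indicator) (auto simp: emeasure_eq_measure)
    show "integrable ?M (\<lambda>x. exp (l * (sqnorm n x - real n * s2)) * exp (- real n * r))" using m(1) by simp
    show "indicator ?A x \<le> exp (l * (sqnorm n x - real n * s2)) * exp (- real n * r)" for x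
      by (cases "x \<in> ?A") (auto simp flip: exp_add)
  qed
  also have "\<dots> \<le> exp (real n * (l\<^sup>2 * v / 2 + C * \<bar>l\<bar> ^ 3)) * exp (- real n * r)"
    using m by simp
  finally show ?thesis by (simp add: algebra_simps flip: exp_add)
qed

text \<open>Tilting by \<open>(t + \<eta>)/v\<close> moves the mean of
  \<open>sqnorm n x / n - s2\<close> to about \<open>t + \<eta>\<close>, the middle of the window; a
  further shift by \<open>\<eta>/v\<close> bounds either exit by a quarter of the tilted mass.
  \<open>h\<close> is the largest parameter that occurs, so \<open>C * h ^ 3\<close> bounds every
  cubic error. The last hypothesis lets the Chernoff gain \<open>\<eta>\<^sup>2/(2 v)\<close> beat
  two such errors, one in the exit and one in the normalizer, leaving the exponent -2 with exp (-2)
  at most 1/4.\<close>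

lemma source_window_lower:
  fixes t \<eta> v C l0 :: real
  assumes "prob_space P" "sets P = sets borel" "mgf_quadratic P s2 v C l0" "0 \<le> C" "v > 0" "t > 0" "\<eta> > 0"
  defines "h \<equiv> (t + 2 * \<eta>) / v"
  assumes "h \<le> l0" "2 \<le> real n * (\<eta>\<^sup>2 / (2 * v) - 2 * (C * h ^ 3))"
  shows "exp (- real n * ((t + 3 * \<eta>)\<^sup>2 / (2 * v) + C * h ^ 3)) / 2 \<le>
    measure (PiM {..<n} (\<lambda>_. P)) {x \<in> space (PiM {..<n} (\<lambda>_. P)).
      real n * t \<le> sqnorm n x - real n * s2 \<and> sqnorm n x - real n * s2 \<le> real n * (t + 2 * \<eta>)}"
    (is "_ \<le> measure ?M ?S")
proof -
  interpret prob_space ?M by (intro prob_space_PiM assms)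
  have [measurable_cong]: "sets ?M = sets (PiM {..<n} (\<lambda>_. borel))" by (intro sets_PiM_cong) (auto simp: assms)
  define l s where "l = (t + \<eta>) / v" and "s = \<eta> / v"
  have l: "0 < l" "0 < s" "0 \<le> l - s" "l + s = h"
    using assms(5-7) by (simp_all add: l_def s_def h_def flip: diff_divide_distrib add_divide_distrib)
  have lh: "\<bar>l\<bar> \<le> h" "\<bar>l + s\<bar> \<le> h" "\<bar>l - s\<bar> \<le> h" using l by auto
  define b where "b = C * h ^ 3"
  have cub: "C * \<bar>k\<bar> ^ 3 \<le> b" if "\<bar>k\<bar> \<le> h" for k
    unfolding b_def using that assms(4) by (intro mult_left_mono power_mono) auto
  have ml: "exp (real n * (k\<^sup>2 * v / 2 - b)) \<le> (\<integral>x. exp (k * (sqnorm n x - real n * s2)) \<partial>?M)"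
    if "\<bar>k\<bar> \<le> h" for k
  proof -
    have "exp (real n * (k\<^sup>2 * v / 2 - b)) \<le> exp (real n * (k\<^sup>2 * v / 2 - C * \<bar>k\<bar> ^ 3))"
      using cub[OF that] by (intro exp_mono mult_left_mono) auto
    also have "\<dots> \<le> (\<integral>x. exp (k * (sqnorm n x - real n * s2)) \<partial>?M)"
      using that assms by (intro source_mgf(2)[OF assms(1,3)]) auto
    finally show ?thesis .
  qed
  have mu: "(\<integral>x. exp (k * (sqnorm n x - real n * s2)) \<partial>?M) \<le> exp (real n * (k\<^sup>2 * v / 2 + b))"
    if "\<bar>k\<bar> \<le> h" for k
  proof -
    have "(\<integral>x. exp (k * (sqnorm n x - real n * s2)) \<partial>?M) \<le> exp (real n * (k\<^sup>2 * v / 2 + C * \<bar>k\<bar> ^ 3))"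
      using that assms by (intro source_mgf(3)[OF assms(1,3)]) auto
    also have "\<dots> \<le> exp (real n * (k\<^sup>2 * v / 2 + b))"
      using cub[OF that] by (intro exp_mono mult_left_mono) auto
    finally show ?thesis .
  qed
  have mi: "integrable ?M (\<lambda>x. exp (k * (sqnorm n x - real n * s2)))" if "\<bar>k\<bar> \<le> h" for k
    using that assms by (intro source_mgf(1)[OF assms(1,3)]) auto
  define Z where "Z = (\<integral>x. exp (l * (sqnorm n x - real n * s2)) \<partial>?M)"
  have Zlow: "exp (real n * (l\<^sup>2 * v / 2 - b)) \<le> Z" unfolding Z_def by (rule ml) (use lh in simp)
  have quarter: "exp (real n * (l\<^sup>2 * v / 2 + b - \<eta>\<^sup>2 / (2 * v))) \<le> Z / 4"
  proof -
    have "exp (real n * (l\<^sup>2 * v / 2 + b - \<eta>\<^sup>2 / (2 * v))) =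
        exp (real n * (l\<^sup>2 * v / 2 - b)) * exp (- (real n * (\<eta>\<^sup>2 / (2 * v) - 2 * b)))"
      by (simp add: algebra_simps flip: exp_add)
    also have "\<dots> \<le> Z * (1/4)"
    proof (rule mult_mono[OF Zlow])
      have "exp (- (real n * (\<eta>\<^sup>2 / (2 * v) - 2 * b))) \<le> exp (- 2)" using assms(10) by (simp add: b_def)
      also have "\<dots> \<le> 1/4" using four_le_exp_2 by (simp add: exp_minus field_simps)
      finally show "exp (- (real n * (\<eta>\<^sup>2 / (2 * v) - 2 * b))) \<le> 1/4" .
    qed (auto simp: Z_def)
    finally show ?thesis by simp
  qed
  define g where "g = (\<lambda>(k, c) x. exp (k * (sqnorm n x - real n * s2)) * exp (real n * c))"
  define J where "J = {(l - s, s * t), (l + s, - s * (t + 2 * \<eta>))}"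
  have lv: "l * v = t + \<eta>" "s * v = \<eta>" using assms(5) by (auto simp: l_def s_def)
  have gJ: "integrable ?M (g j) \<and> (\<integral>x. g j x \<partial>?M) \<le> Z / 4" if "j \<in> J" for j
  proof -
    have sq: "s\<^sup>2 * v = s * \<eta>" "s * \<eta> = \<eta>\<^sup>2 / v" "\<eta>\<^sup>2 / (2 * v) = s * \<eta> / 2"
      using lv assms(5) by (auto simp: power2_eq_square s_def)
    from that consider "j = (l - s, s * t)" | "j = (l + s, - s * (t + 2 * \<eta>))" unfolding J_def by blast
    then show ?thesis
    proof cases
      case 1
      have "(\<integral>x. g j x \<partial>?M) \<le> exp (real n * ((l - s)\<^sup>2 * v / 2 + b)) * exp (real n * (s * t))"
        unfolding 1 g_def using mu[OF lh(3)] by simp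
      also have "\<dots> = exp (real n * ((l - s)\<^sup>2 * v / 2 + b + s * t))"
        by (simp add: distrib_left exp_add)
      also have "(l - s)\<^sup>2 * v / 2 + b + s * t = l\<^sup>2 * v / 2 + b - \<eta>\<^sup>2 / (2 * v)"
      proof -
        have "(l - s)\<^sup>2 * v / 2 = l\<^sup>2 * v / 2 - s * (l * v) + s\<^sup>2 * v / 2"
          by (simp add: power2_eq_square field_simps)
        also have "\<dots> = l\<^sup>2 * v / 2 - s * t - s * \<eta> / 2" unfolding lv sq(1) by (simp add: field_simps)
        finally show ?thesis using sq(3) by linarith
      qed
      also note quarter
      finally show ?thesis using mi[OF lh(3)] unfolding 1 g_def by simp
    next
      case 2
      have "(\<integral>x. g j x \<partial>?M) \<le> exp (real n * ((l + s)\<^sup>2 * v / 2 + b)) * exp (real n * (- s * (t + 2 * \<eta>)))"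
        unfolding 2 g_def using mu[OF lh(2)] by simp
      also have "\<dots> = exp (real n * ((l + s)\<^sup>2 * v / 2 + b + - s * (t + 2 * \<eta>)))"
        by (simp only: distrib_left exp_add)
      also have "(l + s)\<^sup>2 * v / 2 + b + - s * (t + 2 * \<eta>) = l\<^sup>2 * v / 2 + b - \<eta>\<^sup>2 / (2 * v)"
      proof -
        have "(l + s)\<^sup>2 * v / 2 = l\<^sup>2 * v / 2 + s * (l * v) + s\<^sup>2 * v / 2"
          by (simp add: power2_eq_square field_simps)
        also have "\<dots> = l\<^sup>2 * v / 2 + s * (t + 2 * \<eta>) - s * \<eta> / 2" unfolding lv sq(1) by (simp add: field_simps)
        finally show ?thesis using sq(3) by linarith
      qed
      also note quarter
      finally show ?thesis using mi[OF lh(2)] unfolding 2 g_def by simp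
    qed
  qed
  define B where "B = exp (real n * (l * (t + 2 * \<eta>)))"
  have "Z \<le> B * measure ?M ?S + (\<Sum>j\<in>J. \<integral>x. g j x \<partial>?M)"
    unfolding Z_def
  proof (rule window_bound)
    show "finite_measure ?M" by (rule finite_measure_axioms)
    show "?S \<in> sets ?M" by measurable
    show "integrable ?M (\<lambda>x. exp (l * (sqnorm n x - real n * s2)))" by (rule mi) (use lh in simp)
    show "finite J" by (simp add: J_def)
    show "integrable ?M (g j)" if "j \<in> J" for j using gJ[OF that] by blast
    show "0 \<le> g j x" for j x by (cases j) (simp add: g_def)
    show "exp (l * (sqnorm n x - real n * s2)) \<le> B" if "x \<in> ?S" for x
    proof -
      have "l * (sqnorm n x - real n * s2) \<le> l * (real n * (t + 2 * \<eta>))"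
        using that l by (intro mult_left_mono) auto
      then show ?thesis by (simp add: B_def mult.left_commute)
    qed
    show "\<exists>j\<in>J. exp (l * (sqnorm n x - real n * s2)) \<le> g j x" if "x \<in> space ?M" "x \<notin> ?S" for x
    proof -
      from that consider "sqnorm n x - real n * s2 \<le> real n * t" | "real n * (t + 2 * \<eta>) \<le> sqnorm n x - real n * s2"
        by fastforce
      then show ?thesis
      proof cases
        case 1
        then have "s * (sqnorm n x - real n * s2) \<le> s * (real n * t)" using l by (intro mult_left_mono) auto
        then have "exp (l * (sqnorm n x - real n * s2)) \<le> g (l - s, s * t) x"
          by (simp add: g_def algebra_simps flip: exp_add)
        then show ?thesis by (auto simp: J_def)
      next
        case 2
        then have "s * (real n * (t + 2 * \<eta>)) \<le> s * (sqnorm n x - real n * s2)" using l by (intro mult_left_mono) auto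
        then have "exp (l * (sqnorm n x - real n * s2)) \<le> g (l + s, - s * (t + 2 * \<eta>)) x"
          by (simp add: g_def algebra_simps flip: exp_add)
        then show ?thesis by (auto simp: J_def)
      qed
    qed
  qed
  moreover have "(\<Sum>j\<in>J. \<integral>x. g j x \<partial>?M) \<le> 2 * (Z / 4)"
  proof -
    have "(\<Sum>j\<in>J. \<integral>x. g j x \<partial>?M) \<le> real (card J) * (Z / 4)"
      using gJ by (intro sum_bounded_above) auto
    also have "\<dots> \<le> 2 * (Z / 4)"
    proof (rule mult_right_mono)
      have "card J \<le> 2" unfolding J_def by (auto simp: card_insert_if)
      then show "real (card J) \<le> 2" by simp
    qed (simp add: Z_def)
    finally show ?thesis .
  qed
  ultimately have "Z / 2 \<le> B * measure ?M ?S" by simp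
  then have 1: "Z / B / 2 \<le> measure ?M ?S" by (simp add: B_def field_simps)
  have 2: "exp (- real n * ((t + 3 * \<eta>)\<^sup>2 / (2 * v) + C * h ^ 3)) \<le> Z / B"
  proof -
    \<comment> \<open>The exponent that arises is the product
      \<open>(t + \<eta>) * (t + 3 * \<eta>)\<close> over \<open>2 * v\<close>; it is rounded up to
      a square.\<close>
    have "- ((t + 3 * \<eta>)\<^sup>2 / (2 * v)) \<le> - ((t + \<eta>) * (t + 3 * \<eta>) / (2 * v))"
    proof -
      have "(t + \<eta>) * (t + 3 * \<eta>) \<le> (t + 3 * \<eta>) * (t + 3 * \<eta>)" using assms(6,7) by (intro mult_right_mono) auto
      then show ?thesis using assms(5) by (simp add: power2_eq_square divide_right_mono)
    qed
    also have "\<dots> = l\<^sup>2 * v / 2 - l * (t + 2 * \<eta>)"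
      using assms(5) by (simp add: l_def power2_eq_square field_simps)
    finally have "- ((t + 3 * \<eta>)\<^sup>2 / (2 * v) + C * h ^ 3) \<le> (l\<^sup>2 * v / 2 - b) - l * (t + 2 * \<eta>)"
      by (simp add: b_def)
    then have "real n * - ((t + 3 * \<eta>)\<^sup>2 / (2 * v) + C * h ^ 3) \<le> real n * ((l\<^sup>2 * v / 2 - b) - l * (t + 2 * \<eta>))"
      by (intro mult_left_mono) auto
    then have "exp (- real n * ((t + 3 * \<eta>)\<^sup>2 / (2 * v) + C * h ^ 3)) \<le> exp (real n * (l\<^sup>2 * v / 2 - b)) / B"
      unfolding B_def exp_diff[symmetric] by (simp add: right_diff_distrib distrib_left)
    also have "\<dots> \<le> Z / B" using Zlow by (intro divide_right_mono) (auto simp: B_def)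
    finally show ?thesis .
  qed
  show ?thesis by (rule order_trans[OF divide_right_mono[OF 2] 1]) simp
qed

section \<open>The excess-distortion probability\<close>

lemma ball_rateE:
  assumes "ball_rate s2 D Q"
  obtains K c0 \<eta>0 \<delta> where "0 < K" "0 < \<eta>0" "0 < \<delta>"
    and "\<And>n x \<eta>. 0 < n \<Longrightarrow> 0 < \<eta> \<Longrightarrow> \<eta> \<le> \<eta>0 \<Longrightarrow> c0 \<le> real n * \<eta>\<^sup>2 \<Longrightarrow> \<bar>sqnorm n x / real n - s2\<bar> \<le> \<delta> \<Longrightarrow>
       exp (- real n * (ln (s2 / D) / 2 + (sqnorm n x / real n - s2) / (2 * s2) +
         K * ((sqnorm n x / real n - s2)\<^sup>2 + \<eta>))) \<le> psi Q D n x"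
    and "\<And>n x \<eta>. 0 < n \<Longrightarrow> 0 < \<eta> \<Longrightarrow> \<eta> \<le> \<eta>0 \<Longrightarrow> c0 \<le> real n * \<eta>\<^sup>2 \<Longrightarrow> \<bar>sqnorm n x / real n - s2\<bar> \<le> \<delta> \<Longrightarrow>
       psi Q D n x \<le> exp (- real n * (ln (s2 / D) / 2 + (sqnorm n x / real n - s2) / (2 * s2) - K * \<eta>))"
proof -
  obtain K c0 \<eta>0 \<delta> where pos: "0 < K" "0 < \<eta>0" "0 < \<delta>"
    and br: "\<forall>n x \<eta>. 0 < n \<longrightarrow> 0 < \<eta> \<longrightarrow> \<eta> \<le> \<eta>0 \<longrightarrow> c0 \<le> real n * \<eta>\<^sup>2 \<longrightarrow> \<bar>sqnorm n x / real n - s2\<bar> \<le> \<delta> \<longrightarrow>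
       exp (- real n * (ln (s2 / D) / 2 + (sqnorm n x / real n - s2) / (2 * s2) +
         K * ((sqnorm n x / real n - s2)\<^sup>2 + \<eta>))) \<le> psi Q D n x \<and>
       psi Q D n x \<le> exp (- real n * (ln (s2 / D) / 2 + (sqnorm n x / real n - s2) / (2 * s2) - K * \<eta>))"
    using assms unfolding ball_rate_def by (elim exE conjE) (rule that)
  show ?thesis
    by (rule that[OF pos br[rule_format, THEN conjunct1] br[rule_format, THEN conjunct2]])
qed

lemma psi_bounds:
  assumes "regular_cb Q" "n > 0" shows "0 \<le> psi Q D n x" "psi Q D n x \<le> 1"
  using assms by (auto simp: psi_def regular_cb_def)

lemma measurable_psi:
  assumes "regular_cb Q" "n > 0" shows "psi Q D n \<in> borel_measurable (PiM {..<n} (\<lambda>_. borel))"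
  unfolding psi_def[abs_def] using assms by (intro measurable_measure_distortion) (auto simp: regular_cb_def)

lemma integrable_excess:
  assumes "prob_space P" "sets P = sets borel" "regular_cb Q" "n > 0"
  shows "integrable (PiM {..<n} (\<lambda>_. P)) (\<lambda>x. (1 - psi Q D n x) ^ M)"
proof -
  let ?M = "PiM {..<n} (\<lambda>_. P)"
  interpret prob_space ?M by (intro prob_space_PiM assms)
  have [measurable_cong]: "sets ?M = sets (PiM {..<n} (\<lambda>_. borel))" by (intro sets_PiM_cong) (auto simp: assms)
  note [measurable] = measurable_psi[OF assms(3,4)]
  show ?thesis
    by (rule integrable_const_bound[of _ 1])
      (use psi_bounds[OF assms(3,4)] in \<open>auto simp: power_abs intro!: power_le_one AE_I2\<close>)
qed

lemma eventually_mult_le: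
  fixes \<xi> :: "nat \<Rightarrow> real"
  assumes "\<xi> \<longlonglongrightarrow> 0" "d > 0" shows "eventually (\<lambda>n. c * \<xi> n \<le> d) sequentially"
proof -
  have "(\<lambda>n. c * \<xi> n) \<longlonglongrightarrow> c * 0" by (intro tendsto_intros assms)
  then have "eventually (\<lambda>n. c * \<xi> n < d) sequentially" using assms(2) by (intro order_tendstoD) auto
  then show ?thesis by eventually_elim simp
qed

lemma eventually_ge_mult:
  fixes f :: "nat \<Rightarrow> real"
  assumes "filterlim f at_top sequentially" "c > 0" shows "eventually (\<lambda>n. d \<le> c * f n) sequentially"
proof -
  have "eventually (\<lambda>n. d / c \<le> f n) sequentially" using assms(1) by (simp add: filterlim_at_top)
  then show ?thesis by eventually_elim (use assms(2) in \<open>simp add: field_simps\<close>)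
qed

text \<open>The sources split into three parts: the upper tail \<open>?S1\<close>, which has the
  claimed order; the far lower tail \<open>?S2\<close>, of probability at most
  \<open>exp (- n \<gamma>)\<close> with \<open>\<gamma>\<close> fixed; and the rest, where the
  integrand is at most \<open>exp (- n \<epsilon> \<xi> n / 2)\<close>. Because
  \<open>\<xi> n\<close> tends to 0, the last two exponents eventually exceed any multiple of
  \<open>n (\<xi> n)\<^sup>2\<close>.\<close>

lemma excess_prob_upper:
  fixes \<xi> :: "nat \<Rightarrow> real" and s2 v D C l0 \<epsilon> :: real
  assumes P: "prob_space P" "sets P = sets borel" and mgf: "mgf_quadratic P s2 v C l0" "0 \<le> C" "0 < l0" "v > 0"
    and D: "0 < D" "D < s2" and Q: "regular_cb Q" "ball_rate s2 D Q"
    and \<xi>: "\<And>n. \<xi> n > 0" "\<xi> \<longlonglongrightarrow> 0" "filterlim (\<lambda>n. real n * (\<xi> n)\<^sup>2) at_top sequentially"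
    and \<epsilon>: "0 < \<epsilon>" "\<epsilon> < 1"
  shows "eventually (\<lambda>n. excess_prob P Q D n (cb_size s2 D (\<xi> n) n) \<le>
    3 * exp (- (real n * (\<xi> n)\<^sup>2) * (2 * s2\<^sup>2 * (1 - \<epsilon>)\<^sup>2 / v - \<epsilon>))) sequentially"
proof -
  have s2: "s2 > 0" using D by simp
  obtain K c0 \<eta>0 \<delta> where K: "0 < K" "0 < \<eta>0" "0 < \<delta>"
    and br: "\<And>n x \<eta>. 0 < n \<Longrightarrow> 0 < \<eta> \<Longrightarrow> \<eta> \<le> \<eta>0 \<Longrightarrow> c0 \<le> real n * \<eta>\<^sup>2 \<Longrightarrow> \<bar>sqnorm n x / real n - s2\<bar> \<le> \<delta> \<Longrightarrow>
       exp (- real n * (ln (s2 / D) / 2 + (sqnorm n x / real n - s2) / (2 * s2) +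
         K * ((sqnorm n x / real n - s2)\<^sup>2 + \<eta>))) \<le> psi Q D n x"
    by (rule ball_rateE[OF Q(2)]) (rule that)
  \<comment> \<open>For \<open>u\<close> between 0 and \<open>t\<close> the linear term uses up
    \<open>(1 - \<epsilon>) * x\<close>, while \<open>K * \<eta>\<close> with
    \<open>\<eta> = \<kappa> * x\<close> and \<open>K * u\<^sup>2\<close> take
    \<open>\<epsilon> / 4 * x\<close> each; a margin \<open>\<epsilon> / 2 * x\<close> remains below
    \<open>x\<close>.\<close>
  define \<kappa> where "\<kappa> = \<epsilon> / (4 * K)"
  have \<kappa>: "\<kappa> > 0" using K \<epsilon> by (simp add: \<kappa>_def)
  \<comment> \<open>For negative \<open>u\<close> down to \<open>- \<delta>1\<close> the error
    \<open>K * u\<^sup>2\<close> is at most \<open>\<bar>u\<bar> / (2 * s2)\<close>, hence swallowed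
    by the linear gain.\<close>
  define \<delta>1 where "\<delta>1 = min \<delta> (1 / (2 * s2 * K))"
  have \<delta>1: "\<delta>1 > 0" "\<delta>1 \<le> \<delta>" "\<delta>1 \<le> 1 / (2 * s2 * K)" using K s2 by (auto simp: \<delta>1_def)
  \<comment> \<open>A fixed Chernoff parameter for the lower tail:
    \<open>l1 * (v + 2 * C) \<le> \<delta>1\<close> keeps the cumulant below half of
    \<open>l1 * \<delta>1\<close>, and \<open>\<gamma>\<close> is the other half.\<close>
  define l1 where "l1 = min l0 (min 1 (\<delta>1 / (v + 2 * C)))"
  have vC: "v + 2 * C > 0" using mgf by simp
  have l1: "0 < l1" "l1 \<le> l0" "l1 \<le> 1" "l1 \<le> \<delta>1 / (v + 2 * C)" using mgf \<delta>1 vC by (auto simp: l1_def)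
  define \<gamma> where "\<gamma> = l1 * \<delta>1 / 2"
  have \<gamma>: "\<gamma> > 0" using l1 \<delta>1 by (simp add: \<gamma>_def)
  have l1\<gamma>: "l1\<^sup>2 * v / 2 + C * l1 ^ 3 - l1 * \<delta>1 \<le> - \<gamma>"
  proof -
    have "C * l1 ^ 3 \<le> C * l1\<^sup>2" using l1 mgf by (intro mult_left_mono power_decreasing) auto
    then have "l1\<^sup>2 * v / 2 + C * l1 ^ 3 \<le> l1 / 2 * (l1 * (v + 2 * C))" by (simp add: power2_eq_square algebra_simps)
    also have "\<dots> \<le> l1 / 2 * \<delta>1" using l1 vC by (intro mult_left_mono) (auto simp: le_divide_eq)
    finally show ?thesis by (simp add: \<gamma>_def)
  qed
  \<comment> \<open>Negative for \<open>\<epsilon>\<close> near 1, hence the absolute values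
    below.\<close>
  define A where "A = 2 * s2\<^sup>2 * (1 - \<epsilon>)\<^sup>2 / v - \<epsilon>"
  note ev = eventually_mult_le[OF \<xi>(2)]
  have ev1: "eventually (\<lambda>n. n > 0 \<and> \<kappa> * \<xi> n \<le> \<eta>0 \<and> c0 \<le> \<kappa>\<^sup>2 * (real n * (\<xi> n)\<^sup>2) \<and> (2 * s2) * \<xi> n \<le> \<delta>1 \<and>
      (16 * K * s2\<^sup>2) * \<xi> n \<le> \<epsilon> \<and> (2 * s2 / v) * \<xi> n \<le> l0 \<and> \<bar>A\<bar> * \<xi> n \<le> \<epsilon> / 2 \<and> \<bar>A\<bar> * \<xi> n \<le> \<gamma> \<and> 1 * \<xi> n \<le> 1 \<and>
      (C * (2 * s2 / v) ^ 3) * \<xi> n \<le> \<epsilon>) sequentially"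
    using \<epsilon> K \<delta>1 \<gamma> mgf \<kappa> by (intro eventually_conj ev eventually_ge_mult[OF \<xi>(3)] eventually_gt_at_top) auto
  then show ?thesis
  proof eventually_elim
    case (elim n)
    define x where "x = \<xi> n"
    have x: "x > 0" using \<xi>(1) by (simp add: x_def)
    have n: "n > 0" and e1: "\<kappa> * x \<le> \<eta>0" and e2: "c0 \<le> real n * (\<kappa> * x)\<^sup>2" and e3: "2 * s2 * x \<le> \<delta>1"
      and e4: "16 * K * s2\<^sup>2 * x \<le> \<epsilon>" and e5: "2 * s2 / v * x \<le> l0" and e6: "\<bar>A\<bar> * x \<le> \<epsilon> / 2" and e7: "\<bar>A\<bar> * x \<le> \<gamma>"
      and e8: "x \<le> 1" and e9: "C * (2 * s2 / v) ^ 3 * x \<le> \<epsilon>"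
      using elim by (auto simp: x_def power_mult_distrib mult_ac)
    define M where "M = cb_size s2 D (\<xi> n) n"
    let ?P = "PiM {..<n} (\<lambda>_. P)"
    interpret prob_space ?P by (intro prob_space_PiM P)
    have [measurable_cong]: "sets ?P = sets (PiM {..<n} (\<lambda>_. borel))" by (intro sets_PiM_cong) (auto simp: P)
    define R0 where "R0 = ln (s2 / D) / 2"
    define t where "t = 2 * s2 * (1 - \<epsilon>) * x"
    have t: "t > 0" "t \<le> 2 * s2 * x"
    proof -
      show "t > 0" using s2 \<epsilon> x by (simp add: t_def)
      have "2 * s2 * x * (1 - \<epsilon>) \<le> 2 * s2 * x * 1" using s2 x \<epsilon> by (intro mult_left_mono) auto
      then show "t \<le> 2 * s2 * x" by (simp add: t_def mult_ac)
    qed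
    \<comment> \<open>Maximizes \<open>l * t - l\<^sup>2 * v / 2\<close>, the Chernoff exponent
      without its cubic error.\<close>
    define l where "l = t / v"
    have l: "l > 0" "\<bar>l\<bar> \<le> l0"
    proof -
      show "l > 0" using t mgf by (simp add: l_def)
      moreover have "l \<le> 2 * s2 * x / v" unfolding l_def using t mgf by (intro divide_right_mono) auto
      ultimately show "\<bar>l\<bar> \<le> l0" using e5 by simp
    qed
    let ?S1 = "{y \<in> space ?P. real n * (l * t) \<le> l * (sqnorm n y - real n * s2)}"
    let ?S2 = "{y \<in> space ?P. real n * (l1 * \<delta>1) \<le> - l1 * (sqnorm n y - real n * s2)}"
    have S: "?S1 \<in> sets ?P" "?S2 \<in> sets ?P" by measurable
    have pt: "(1 - psi Q D n y) ^ M \<le> exp (- (real n * (\<epsilon> / 2 * x))) + indicator ?S1 y + indicator ?S2 y"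
      if y: "y \<in> space ?P" for y
    proof (cases "y \<in> ?S1 \<or> y \<in> ?S2")
      case True
      have "(1 - psi Q D n y) ^ M \<le> 1" using psi_bounds[OF Q(1) n, of D y] by (intro power_le_one) auto
      also have "1 \<le> indicator ?S1 y + (indicator ?S2 y :: real)" using True by (auto simp: indicator_def)
      finally show ?thesis using exp_ge_zero[of "- (real n * (\<epsilon> / 2 * x))"] by linarith
    next
      case False
      define u where "u = sqnorm n y / real n - s2"
      have nu: "sqnorm n y - real n * s2 = real n * u" using n by (simp add: u_def field_simps)
      have u1: "u < t"
      proof (rule ccontr)
        assume "\<not> u < t"
        then have "real n * (l * t) \<le> real n * (l * u)" using l by (intro mult_left_mono) auto
        then show False using False y by (simp add: nu mult.left_commute)
      qed
      have u2: "- \<delta>1 < u"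
      proof (rule ccontr)
        assume "\<not> - \<delta>1 < u"
        then have "real n * (l1 * \<delta>1) \<le> real n * (l1 * - u)" using l1 by (intro mult_left_mono) auto
        then show False using False y by (simp add: nu mult.left_commute)
      qed
      have "\<bar>u\<bar> \<le> \<delta>" using u1 u2 t e3 \<delta>1 by (simp add: abs_le_iff)
      then have psl: "exp (- real n * (R0 + u / (2 * s2) + K * (u\<^sup>2 + \<kappa> * x))) \<le> psi Q D n y"
        using br[OF n _ e1 e2, of y] \<kappa> x by (simp add: u_def R0_def)
      have K\<kappa>: "K * (\<kappa> * x) = \<epsilon> / 4 * x" using K by (simp add: \<kappa>_def)
      have rate: "u / (2 * s2) + K * (u\<^sup>2 + \<kappa> * x) \<le> (1 - \<epsilon> / 2) * x"
      proof (cases "u \<ge> 0")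
        case True
        have "u / (2 * s2) \<le> t / (2 * s2)" using u1 s2 by (intro divide_right_mono) auto
        also have "\<dots> = (1 - \<epsilon>) * x" using s2 by (simp add: t_def)
        finally have 1: "u / (2 * s2) \<le> (1 - \<epsilon>) * x" .
        have "u\<^sup>2 \<le> (2 * s2 * x)\<^sup>2" using True u1 t by (intro power_mono) auto
        then have "K * u\<^sup>2 \<le> K * (2 * s2 * x)\<^sup>2" using K by (intro mult_left_mono) auto
        also have "\<dots> = (16 * K * s2\<^sup>2 * x) * (x / 4)" by (simp add: power2_eq_square)
        also have "\<dots> \<le> \<epsilon> * (x / 4)" using e4 x by (intro mult_right_mono) auto
        finally have "K * u\<^sup>2 \<le> \<epsilon> / 4 * x" by simp
        then show ?thesis using 1 unfolding distrib_left K\<kappa> by (simp add: left_diff_distrib)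
      next
        case False
        have "K * u\<^sup>2 = (- u) * (K * (- u))" by (simp add: power2_eq_square)
        also have "\<dots> \<le> (- u) * (K * (1 / (2 * s2 * K)))"
          using False u2 \<delta>1 K by (intro mult_left_mono) auto
        also have "\<dots> = - (u / (2 * s2))" using K s2 by simp
        finally have "u / (2 * s2) + K * (u\<^sup>2 + \<kappa> * x) \<le> \<epsilon> / 4 * x" unfolding distrib_left K\<kappa> by simp
        also have "\<dots> \<le> (1 - \<epsilon> / 2) * x" using \<epsilon> x by (intro mult_right_mono) auto
        finally show ?thesis .
      qed
      have Mge: "exp (real n * (R0 + x)) \<le> real M"
        unfolding M_def cb_size_def R0_def x_def by (rule real_nat_ceiling_ge)
      \<comment> \<open>\<open>M * psi\<close> is even exponentially large; keeping only the linear
        bound still leaves an exponent of order \<open>n * x\<close>, which outweighs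
        \<open>n * x\<^sup>2\<close>.\<close>
      have "real n * (\<epsilon> / 2 * x) \<le> exp (real n * (\<epsilon> / 2 * x))"
        using exp_ge_add_one_self[of "real n * (\<epsilon> / 2 * x)"] by linarith
      also have "\<dots> \<le> exp (real n * (R0 + x)) * exp (- real n * (R0 + u / (2 * s2) + K * (u\<^sup>2 + \<kappa> * x)))"
        unfolding exp_add[symmetric]
      proof (rule exp_mono)
        have "real n * (u / (2 * s2) + K * (u\<^sup>2 + \<kappa> * x)) \<le> real n * ((1 - \<epsilon> / 2) * x)"
          using rate by (intro mult_left_mono) auto
        then show "real n * (\<epsilon> / 2 * x) \<le> real n * (R0 + x) + - real n * (R0 + u / (2 * s2) + K * (u\<^sup>2 + \<kappa> * x))"
          by (simp add: algebra_simps)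
      qed
      also have "\<dots> \<le> real M * psi Q D n y" using Mge psl by (intro mult_mono) auto
      finally have Mp: "real n * (\<epsilon> / 2 * x) \<le> real M * psi Q D n y" .
      have "(1 - psi Q D n y) ^ M \<le> exp (- psi Q D n y) ^ M"
        using psi_bounds[OF Q(1) n, of D y] exp_ge_add_one_self[of "- psi Q D n y"] by (intro power_mono) auto
      also have "\<dots> = exp (- (real M * psi Q D n y))" by (simp flip: exp_of_nat_mult)
      also have "\<dots> \<le> exp (- (real n * (\<epsilon> / 2 * x)))" using Mp by simp
      finally show ?thesis using False by (simp add: indicator_def)
    qed
    have "excess_prob P Q D n M = (\<integral>y. (1 - psi Q D n y) ^ M \<partial>?P)"
      by (simp add: excess_prob_def psi_def)
    also have "\<dots> \<le> (\<integral>y. exp (- (real n * (\<epsilon> / 2 * x))) + indicator ?S1 y + indicator ?S2 y \<partial>?P)"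
      using S pt by (intro integral_mono integrable_excess P Q n)
        (auto intro!: Bochner_Integration.integrable_add integrable_real_indicator simp: emeasure_eq_measure)
    also have "\<dots> = exp (- (real n * (\<epsilon> / 2 * x))) + measure ?P ?S1 + measure ?P ?S2"
      using S by (simp add: prob_space Bochner_Integration.integral_add integrable_real_indicator emeasure_eq_measure)
    finally have tot: "excess_prob P Q D n M \<le> exp (- (real n * (\<epsilon> / 2 * x))) + measure ?P ?S1 + measure ?P ?S2" .
    have "exp (- (real n * (\<epsilon> / 2 * x))) \<le> exp (- (real n * x\<^sup>2) * A)"
    proof (rule exp_mono)
      have "A * x \<le> \<bar>A\<bar> * x" using x by (intro mult_right_mono) auto
      with e6 have "A * x \<le> \<epsilon> / 2" by linarith
      then have "x * (A * x) \<le> x * (\<epsilon> / 2)" using x by (intro mult_left_mono) auto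
      then have "real n * (x * (A * x)) \<le> real n * (x * (\<epsilon> / 2))" by (rule mult_left_mono) simp
      then show "- (real n * (\<epsilon> / 2 * x)) \<le> - (real n * x\<^sup>2) * A" by (simp add: power2_eq_square mult_ac)
    qed
    moreover have "measure ?P ?S1 \<le> exp (- (real n * x\<^sup>2) * A)"
    proof -
      have "measure ?P ?S1 \<le> exp (real n * (l\<^sup>2 * v / 2 + C * \<bar>l\<bar> ^ 3 - l * t))"
        by (rule source_chernoff[OF P mgf(1) l(2)])
      also have "\<dots> \<le> exp (real n * (- (x\<^sup>2 * A)))"
      proof (intro exp_mono mult_left_mono)
        have "l\<^sup>2 * v / 2 - l * t = - (t\<^sup>2 / (2 * v))" using mgf by (simp add: l_def power2_eq_square field_simps)
        also have "t\<^sup>2 / (2 * v) = x\<^sup>2 * (A + \<epsilon>)" using mgf by (simp add: t_def A_def power_mult_distrib field_simps power2_eq_square)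
        finally have 1: "l\<^sup>2 * v / 2 - l * t = - (x\<^sup>2 * (A + \<epsilon>))" .
        have "C * \<bar>l\<bar> ^ 3 \<le> C * (2 * s2 / v * x) ^ 3"
          using l t mgf by (intro mult_left_mono power_mono) (auto simp: l_def intro!: divide_right_mono)
        also have "\<dots> = (C * (2 * s2 / v) ^ 3 * x) * x\<^sup>2" by (simp add: power_mult_distrib power2_eq_square power3_eq_cube)
        also have "\<dots> \<le> \<epsilon> * x\<^sup>2" using e9 by (intro mult_right_mono) auto
        finally show "l\<^sup>2 * v / 2 + C * \<bar>l\<bar> ^ 3 - l * t \<le> - (x\<^sup>2 * A)" using 1 by (simp add: algebra_simps)
      qed simp
      finally show ?thesis by (simp add: mult.assoc)
    qed
    moreover have "measure ?P ?S2 \<le> exp (- (real n * x\<^sup>2) * A)"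
    proof -
      have "measure ?P ?S2 \<le> exp (real n * ((- l1)\<^sup>2 * v / 2 + C * \<bar>- l1\<bar> ^ 3 - l1 * \<delta>1))"
        by (rule source_chernoff[OF P mgf(1)]) (use l1 in simp)
      also have "\<dots> \<le> exp (real n * (- (x\<^sup>2 * A)))"
      proof (intro exp_mono mult_left_mono)
        have "x\<^sup>2 * A \<le> x * (\<bar>A\<bar> * x)" using x by (simp add: power2_eq_square mult_left_mono)
        also have "\<dots> \<le> 1 * \<gamma>" using e7 e8 x by (intro mult_mono) auto
        finally show "(- l1)\<^sup>2 * v / 2 + C * \<bar>- l1\<bar> ^ 3 - l1 * \<delta>1 \<le> - (x\<^sup>2 * A)"
          using l1\<gamma> l1(1) by simp
      qed simp
      finally show ?thesis by (simp add: mult.assoc)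
    qed
    ultimately have "excess_prob P Q D n M \<le> 3 * exp (- (real n * x\<^sup>2) * A)" using tot by linarith
    then show ?case unfolding M_def x_def A_def .
  qed
qed

text \<open>The integral is restricted to a window just above the critical deviation. Its upper edge
  keeps \<open>u\<close> within \<open>\<delta>\<close>, where the rate bound holds; its lower edge
  makes \<open>M * psi\<close> at most 1/2, so that Bernoulli's inequality bounds the integrand
  below by 1/2. The window lemma loses another 1/2, hence the 4.\<close>

lemma excess_prob_lower:
  fixes \<xi> :: "nat \<Rightarrow> real" and s2 v D C l0 \<epsilon> :: real
  assumes P: "prob_space P" "sets P = sets borel" and mgf: "mgf_quadratic P s2 v C l0" "0 \<le> C" "0 < l0" "v > 0"
    and D: "0 < D" "D < s2" and Q: "regular_cb Q" "ball_rate s2 D Q"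
    and \<xi>: "\<And>n. \<xi> n > 0" "\<xi> \<longlonglongrightarrow> 0" "filterlim (\<lambda>n. real n * (\<xi> n)\<^sup>2) at_top sequentially"
    and \<epsilon>: "0 < \<epsilon>"
  shows "eventually (\<lambda>n. exp (- (real n * (\<xi> n)\<^sup>2) * ((2 * s2 * (1 + \<epsilon>) + 3 * \<epsilon>)\<^sup>2 / (2 * v) + \<epsilon>)) / 4 \<le>
    excess_prob P Q D n (cb_size s2 D (\<xi> n) n)) sequentially"
proof -
  have s2: "s2 > 0" using D by simp
  obtain K c0 \<eta>0 \<delta> where K: "0 < K" "0 < \<eta>0" "0 < \<delta>"
    and br: "\<And>n x \<eta>. 0 < n \<Longrightarrow> 0 < \<eta> \<Longrightarrow> \<eta> \<le> \<eta>0 \<Longrightarrow> c0 \<le> real n * \<eta>\<^sup>2 \<Longrightarrow> \<bar>sqnorm n x / real n - s2\<bar> \<le> \<delta> \<Longrightarrow>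
       psi Q D n x \<le> exp (- real n * (ln (s2 / D) / 2 + (sqnorm n x / real n - s2) / (2 * s2) - K * \<eta>))"
    by (rule ball_rateE[OF Q(2)]) (rule that)
  \<comment> \<open>\<open>K * \<eta>\<close> with \<open>\<eta> = \<kappa> * x\<close> takes half
    of the margin \<open>\<epsilon> * x\<close>, leaving \<open>\<epsilon> / 2 * x\<close> to make
    \<open>M * psi\<close> small.\<close>
  define \<kappa> where "\<kappa> = \<epsilon> / (2 * K)"
  have \<kappa>: "\<kappa> > 0" using K \<epsilon> by (simp add: \<kappa>_def)
  define a where "a = 2 * s2 * (1 + \<epsilon>)"
  have a: "a > 0" using s2 \<epsilon> by (simp add: a_def)
  define hc where "hc = (a + 2 * \<epsilon>) / v"
  note ev = eventually_mult_le[OF \<xi>(2)]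
  have ev1: "eventually (\<lambda>n. n > 0 \<and> \<kappa> * \<xi> n \<le> \<eta>0 \<and> c0 \<le> \<kappa>\<^sup>2 * (real n * (\<xi> n)\<^sup>2) \<and> hc * \<xi> n \<le> l0 \<and>
      (C * hc ^ 3) * \<xi> n \<le> \<epsilon> \<and> (C * hc ^ 3) * \<xi> n \<le> \<epsilon>\<^sup>2 / (8 * v) \<and> 2 \<le> (\<epsilon>\<^sup>2 / (4 * v)) * (real n * (\<xi> n)\<^sup>2) \<and>
      (a + 2 * \<epsilon>) * \<xi> n \<le> \<delta> \<and> 1 * \<xi> n \<le> 1 \<and> 2 \<le> (\<epsilon> / 2) * (real n * (\<xi> n)\<^sup>2)) sequentially"
    using \<epsilon> K mgf \<kappa> by (intro eventually_conj ev eventually_ge_mult[OF \<xi>(3)] eventually_gt_at_top) auto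
  then show ?thesis
  proof eventually_elim
    case (elim n)
    define x where "x = \<xi> n"
    have x: "x > 0" using \<xi>(1) by (simp add: x_def)
    have n: "n > 0" and e1: "\<kappa> * x \<le> \<eta>0" and e2: "c0 \<le> real n * (\<kappa> * x)\<^sup>2" and e3: "hc * x \<le> l0"
      and e4: "C * hc ^ 3 * x \<le> \<epsilon>" and e5: "C * hc ^ 3 * x \<le> \<epsilon>\<^sup>2 / (8 * v)"
      and e6: "2 \<le> \<epsilon>\<^sup>2 / (4 * v) * (real n * x\<^sup>2)" and e7: "(a + 2 * \<epsilon>) * x \<le> \<delta>"
      and e8: "x \<le> 1" and e9: "2 \<le> (\<epsilon> / 2) * (real n * x\<^sup>2)"
      using elim by (auto simp: x_def power_mult_distrib mult_ac)
    define M where "M = cb_size s2 D (\<xi> n) n"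
    let ?P = "PiM {..<n} (\<lambda>_. P)"
    interpret prob_space ?P by (intro prob_space_PiM P)
    have [measurable_cong]: "sets ?P = sets (PiM {..<n} (\<lambda>_. borel))" by (intro sets_PiM_cong) (auto simp: P)
    define R0 where "R0 = ln (s2 / D) / 2"
    have R0: "R0 \<ge> 0" using D by (simp add: R0_def)
    define t \<eta> where "t = a * x" and "\<eta> = \<epsilon> * x"
    have t: "t > 0" "\<eta> > 0" using a x \<epsilon> by (auto simp: t_def \<eta>_def)
    define h where "h = (t + 2 * \<eta>) / v"
    have hx: "h = hc * x" by (simp add: h_def hc_def t_def \<eta>_def algebra_simps)
    \<comment> \<open>The cubic error has one factor \<open>x\<close> more than the terms of order
      \<open>x\<^sup>2\<close> and is therefore eventually a small fraction of them.\<close>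
    have Ch: "C * h ^ 3 = (C * hc ^ 3 * x) * x\<^sup>2" by (simp add: hx power_mult_distrib power2_eq_square power3_eq_cube)
    let ?S = "{y \<in> space ?P. real n * t \<le> sqnorm n y - real n * s2 \<and> sqnorm n y - real n * s2 \<le> real n * (t + 2 * \<eta>)}"
    have S: "?S \<in> sets ?P" by measurable
    have big: "2 \<le> real n * (\<eta>\<^sup>2 / (2 * v) - 2 * (C * h ^ 3))"
    proof -
      have "C * h ^ 3 \<le> \<epsilon>\<^sup>2 / (8 * v) * x\<^sup>2" unfolding Ch using e5 by (intro mult_right_mono) auto
      moreover have "\<eta>\<^sup>2 / (2 * v) - 2 * (\<epsilon>\<^sup>2 / (8 * v) * x\<^sup>2) = \<epsilon>\<^sup>2 / (4 * v) * x\<^sup>2"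
        using mgf by (simp add: \<eta>_def power_mult_distrib field_simps)
      ultimately have "\<epsilon>\<^sup>2 / (4 * v) * x\<^sup>2 \<le> \<eta>\<^sup>2 / (2 * v) - 2 * (C * h ^ 3)" by linarith
      then have "real n * (\<epsilon>\<^sup>2 / (4 * v) * x\<^sup>2) \<le> real n * (\<eta>\<^sup>2 / (2 * v) - 2 * (C * h ^ 3))" by (intro mult_left_mono) auto
      then show ?thesis using e6 by (simp add: mult_ac)
    qed
    have low: "exp (- real n * ((t + 3 * \<eta>)\<^sup>2 / (2 * v) + C * h ^ 3)) / 2 \<le> measure ?P ?S"
      using e3 big unfolding hx[symmetric] h_def
      by (intro source_window_lower[OF P mgf(1,2,4) t])
    have nx: "2 \<le> real n * (\<epsilon> / 2 * x)"
    proof -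
      have "x\<^sup>2 \<le> x" using x e8 by (simp add: power2_eq_square mult_le_cancel_right1)
      then have "\<epsilon> / 2 * (real n * x\<^sup>2) \<le> \<epsilon> / 2 * (real n * x)" using \<epsilon> by (intro mult_left_mono) auto
      then show ?thesis using e9 by (simp add: mult_ac)
    qed
    have pt: "1/2 * indicator ?S y \<le> (1 - psi Q D n y) ^ M" if y: "y \<in> space ?P" for y
    proof (cases "y \<in> ?S")
      case True
      define u where "u = sqnorm n y / real n - s2"
      have nu: "sqnorm n y - real n * s2 = real n * u" using n by (simp add: u_def field_simps)
      have u: "t \<le> u" "u \<le> t + 2 * \<eta>" using True n by (auto simp: nu)
      have "\<bar>u\<bar> \<le> \<delta>" using u t e7 by (simp add: t_def \<eta>_def algebra_simps)
      then have "psi Q D n y \<le> exp (- real n * (R0 + u / (2 * s2) - K * (\<kappa> * x)))"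
        using br[OF n _ e1 e2, of y] \<kappa> x by (simp add: u_def R0_def)
      also have "\<dots> \<le> exp (- real n * (R0 + x + \<epsilon> / 2 * x))"
      proof (rule exp_mono)
        have K\<kappa>: "K * (\<kappa> * x) = \<epsilon> / 2 * x" using K by (simp add: \<kappa>_def)
        have "(1 + \<epsilon>) * x \<le> u / (2 * s2)" using u s2 by (simp add: t_def a_def le_divide_eq mult_ac)
        then have "R0 + x + \<epsilon> / 2 * x \<le> R0 + u / (2 * s2) - K * (\<kappa> * x)"
          unfolding K\<kappa> by (simp add: distrib_right)
        then have "real n * (R0 + x + \<epsilon> / 2 * x) \<le> real n * (R0 + u / (2 * s2) - K * (\<kappa> * x))" by (intro mult_left_mono) auto
        then show "- real n * (R0 + u / (2 * s2) - K * (\<kappa> * x)) \<le> - real n * (R0 + x + \<epsilon> / 2 * x)"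
          unfolding minus_mult_left[symmetric] by (rule le_imp_neg_le)
      qed
      finally have ps: "psi Q D n y \<le> exp (- real n * (R0 + x + \<epsilon> / 2 * x))" .
      \<comment> \<open>The ceiling adds at most 1, and the exponential is at least 1 because the
        rate and \<open>x\<close> are nonnegative; so rounding costs at most a factor 2.\<close>
      have Mle: "real M \<le> 2 * exp (real n * (R0 + x))"
      proof -
        have "real M \<le> exp (real n * (R0 + x)) + 1"
          unfolding M_def cb_size_def R0_def x_def
          using of_int_ceiling_le_add_one[of "exp (real n * (ln (s2 / D) / 2 + \<xi> n))"] by simp
        moreover have "1 \<le> exp (real n * (R0 + x))" using R0 x by simp
        ultimately show ?thesis by linarith
      qed
      have "real M * psi Q D n y \<le> (2 * exp (real n * (R0 + x))) * exp (- real n * (R0 + x + \<epsilon> / 2 * x))"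
        using Mle ps psi_bounds[OF Q(1) n] by (intro mult_mono) auto
      also have "\<dots> = 2 * exp (- (real n * (\<epsilon> / 2 * x)))"
        by (simp add: algebra_simps flip: exp_add)
      also have "\<dots> \<le> 2 * exp (- 2)" using nx by simp
      also have "\<dots> \<le> 1/2" using four_le_exp_2 by (simp add: exp_minus field_simps)
      finally have "1/2 \<le> 1 + real M * (- psi Q D n y)" by simp
      also have "\<dots> \<le> (1 + - psi Q D n y) ^ M"
        using psi_bounds[OF Q(1) n, of D y] by (intro Bernoulli_inequality) simp
      finally show ?thesis using True by simp
    next
      case False
      then show ?thesis using psi_bounds[OF Q(1) n, of D y] by simp
    qed
    have "1/2 * measure ?P ?S = (\<integral>y. 1/2 * indicator ?S y \<partial>?P)" using S by simp
    also have "\<dots> \<le> (\<integral>y. (1 - psi Q D n y) ^ M \<partial>?P)"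
      using S pt by (intro integral_mono integrable_excess P Q n)
        (auto intro!: integrable_real_indicator simp: emeasure_eq_measure)
    also have "\<dots> = excess_prob P Q D n M" by (simp add: excess_prob_def psi_def)
    finally have ex: "1/2 * measure ?P ?S \<le> excess_prob P Q D n M" .
    have "exp (- (real n * x\<^sup>2) * ((a + 3 * \<epsilon>)\<^sup>2 / (2 * v) + \<epsilon>)) \<le> exp (- real n * ((t + 3 * \<eta>)\<^sup>2 / (2 * v) + C * h ^ 3))"
    proof (rule exp_mono)
      have "C * h ^ 3 \<le> \<epsilon> * x\<^sup>2" unfolding Ch using e4 by (intro mult_right_mono) auto
      moreover have "(t + 3 * \<eta>)\<^sup>2 / (2 * v) = (a + 3 * \<epsilon>)\<^sup>2 / (2 * v) * x\<^sup>2"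
        by (simp add: t_def \<eta>_def power2_eq_square algebra_simps)
      moreover have "x\<^sup>2 * ((a + 3 * \<epsilon>)\<^sup>2 / (2 * v) + \<epsilon>) = (a + 3 * \<epsilon>)\<^sup>2 / (2 * v) * x\<^sup>2 + \<epsilon> * x\<^sup>2"
        by (simp only: distrib_left mult.commute[of "x\<^sup>2"])
      ultimately have "(t + 3 * \<eta>)\<^sup>2 / (2 * v) + C * h ^ 3 \<le> x\<^sup>2 * ((a + 3 * \<epsilon>)\<^sup>2 / (2 * v) + \<epsilon>)" by linarith
      then have "real n * ((t + 3 * \<eta>)\<^sup>2 / (2 * v) + C * h ^ 3) \<le> real n * (x\<^sup>2 * ((a + 3 * \<epsilon>)\<^sup>2 / (2 * v) + \<epsilon>))"
        by (intro mult_left_mono) auto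
      then show "- (real n * x\<^sup>2) * ((a + 3 * \<epsilon>)\<^sup>2 / (2 * v) + \<epsilon>) \<le> - real n * ((t + 3 * \<eta>)\<^sup>2 / (2 * v) + C * h ^ 3)"
        by (simp add: mult.assoc)
    qed
    then show ?case using low ex unfolding M_def x_def a_def by linarith
  qed
qed

text \<open>For fixed \<open>\<epsilon>\<close> the prefactors 3 and 1/4 vanish after division by
  \<open>N n\<close>, which tends to infinity; then \<open>\<epsilon>\<close> tends to 0 in both
  exponents. The outcome is a limit, not only a lower limit.\<close>

lemma excess_exponent_tendsto:
  fixes \<xi> :: "nat \<Rightarrow> real" and s2 v D C l0 :: real
  assumes P: "prob_space P" "sets P = sets borel" and mgf: "mgf_quadratic P s2 v C l0" "0 \<le> C" "0 < l0" "v > 0"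
    and D: "0 < D" "D < s2" and Q: "regular_cb Q" "ball_rate s2 D Q"
    and \<xi>: "\<And>n. \<xi> n > 0" "\<xi> \<longlonglongrightarrow> 0" "filterlim (\<lambda>n. real n * (\<xi> n)\<^sup>2) at_top sequentially"
  shows "(\<lambda>n. - ln (excess_prob P Q D n (cb_size s2 D (\<xi> n) n)) / (real n * (\<xi> n)\<^sup>2)) \<longlonglongrightarrow> 2 * s2\<^sup>2 / v"
proof -
  define E where "E n = excess_prob P Q D n (cb_size s2 D (\<xi> n) n)" for n
  define N where "N n = real n * (\<xi> n)\<^sup>2" for n
  define A where "A \<epsilon> = 2 * s2\<^sup>2 * (1 - \<epsilon>)\<^sup>2 / v - \<epsilon>" for \<epsilon>
  define B where "B \<epsilon> = (2 * s2 * (1 + \<epsilon>) + 3 * \<epsilon>)\<^sup>2 / (2 * v) + \<epsilon>" for \<epsilon>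
  note ups = excess_prob_upper[OF P mgf D Q \<xi>, folded E_def N_def A_def]
  note lows = excess_prob_lower[OF P mgf D Q \<xi>, folded E_def N_def B_def]
  have A: "(A \<longlongrightarrow> 2 * s2\<^sup>2 / v) (at_right 0)"
    unfolding A_def using mgf(4) by (auto intro!: tendsto_eq_intros)
  have B: "(B \<longlongrightarrow> 2 * s2\<^sup>2 / v) (at_right 0)"
    unfolding B_def using mgf(4) by (auto intro!: tendsto_eq_intros simp: power_mult_distrib)
  have small: "eventually (\<lambda>\<epsilon>::real. 0 < \<epsilon> \<and> \<epsilon> < 1) (at_right 0)"
    by (auto simp: eventually_at_right_field intro: exI[of _ 1])
  have Ntop: "filterlim N at_top sequentially" using \<xi>(3) by (simp add: N_def[abs_def])
  have Nev: "eventually (\<lambda>n. 0 < N n \<and> c < d * N n) sequentially" if "d > 0" for c d :: real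
  proof -
    have "eventually (\<lambda>n. 1 \<le> 1 * N n) sequentially" by (rule eventually_ge_mult[OF Ntop]) simp
    moreover have "eventually (\<lambda>n. c + 1 \<le> d * N n) sequentially" by (rule eventually_ge_mult[OF Ntop that])
    ultimately show ?thesis by eventually_elim auto
  qed
  have "(\<lambda>n. - ln (E n) / N n) \<longlonglongrightarrow> 2 * s2\<^sup>2 / v"
  proof (rule order_tendstoI)
    fix a assume "a < 2 * s2\<^sup>2 / v"
    with A have "eventually (\<lambda>\<epsilon>. a < A \<epsilon>) (at_right 0)" by (rule order_tendstoD)
    then obtain \<epsilon> where \<epsilon>: "a < A \<epsilon>" "0 < \<epsilon>" "\<epsilon> < 1"
      using eventually_happens[OF eventually_conj[OF _ small]] by (force simp: trivial_limit_at_right_real)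
    have "eventually (\<lambda>n. 0 < N n \<and> ln 3 < (A \<epsilon> - a) * N n) sequentially" by (rule Nev) (use \<epsilon> in simp)
    with ups[OF \<epsilon>(2,3)] lows[OF \<epsilon>(2)]
    show "eventually (\<lambda>n. a < - ln (E n) / N n) sequentially"
    proof eventually_elim
      case (elim n)
      \<comment> \<open>Positivity of \<open>E n\<close> has to come from the lower estimate:
        \<open>ln 0\<close> is 0, so the upper estimate alone would not bound the logarithm.\<close>
      have "0 < exp (- N n * B \<epsilon>) / 4" by simp
      also note elim(2)
      finally have E0: "0 < E n" .
      then have "ln (E n) \<le> ln (3 * exp (- N n * A \<epsilon>))" using elim(1) by simp
      also have "\<dots> = ln 3 - N n * A \<epsilon>" by (subst ln_mult) auto
      finally have "a * N n < - ln (E n)" using elim(3) by (simp add: algebra_simps)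
      then show ?case using elim(3) pos_less_divide_eq[of "N n" a "- ln (E n)"] by blast
    qed
  next
    fix a assume "2 * s2\<^sup>2 / v < a"
    with B have "eventually (\<lambda>\<epsilon>. B \<epsilon> < a) (at_right 0)" by (rule order_tendstoD)
    then obtain \<epsilon> where \<epsilon>: "B \<epsilon> < a" "0 < \<epsilon>" "\<epsilon> < 1"
      using eventually_happens[OF eventually_conj[OF _ small]] by (force simp: trivial_limit_at_right_real)
    have "eventually (\<lambda>n. 0 < N n \<and> ln 4 < (a - B \<epsilon>) * N n) sequentially" by (rule Nev) (use \<epsilon> in simp)
    with lows[OF \<epsilon>(2)]
    show "eventually (\<lambda>n. - ln (E n) / N n < a) sequentially"
    proof eventually_elim
      case (elim n)
      have "- N n * B \<epsilon> - ln 4 = ln (exp (- N n * B \<epsilon>) / 4)" by (subst ln_div) auto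
      also have "\<dots> \<le> ln (E n)" using elim(1) by (intro ln_mono) auto
      finally have "- ln (E n) < a * N n" using elim(2) by (simp add: algebra_simps)
      then show ?case using elim(2) pos_divide_less_eq[of "N n" "- ln (E n)" a] by blast
    qed
  qed
  then show ?thesis by (simp only: E_def N_def)
qed

text \<open>\<open>real n * (\<xi> n)\<^sup>2\<close> is the square of the given expression times
  \<open>ln (real n)\<close>, and this logarithm is at least 1 from \<open>n = 3\<close> on, as e <
  3. Taking \<open>Y \<ge> 1\<close> gives \<open>Z \<le> Y * Y\<close>.\<close>

lemma moderate_scale_at_top:
  fixes \<xi> :: "nat \<Rightarrow> real"
  assumes "filterlim (\<lambda>n. sqrt (real n / ln (real n)) * \<xi> n) at_top sequentially"
  shows "filterlim (\<lambda>n. real n * (\<xi> n)\<^sup>2) at_top sequentially"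
  unfolding filterlim_at_top
proof
  fix Z :: real
  define Y where "Y = max 1 Z"
  have "eventually (\<lambda>n. Y \<le> sqrt (real n / ln (real n)) * \<xi> n) sequentially"
    using assms by (simp add: filterlim_at_top)
  moreover have "eventually (\<lambda>n. n \<ge> 3) sequentially" by (rule eventually_ge_at_top)
  ultimately show "eventually (\<lambda>n. Z \<le> real n * (\<xi> n)\<^sup>2) sequentially"
  proof eventually_elim
    case (elim n)
    have ln1: "1 \<le> ln (real n)"
    proof -
      have "exp 1 \<le> real n" using e_less_272 elim(2) by linarith
      then show ?thesis using elim(2) by (simp add: ln_ge_iff)
    qed
    have "Z \<le> Y * Y"
    proof -
      have "Y * 1 \<le> Y * Y" by (intro mult_left_mono) (auto simp: Y_def)
      then show ?thesis by (simp add: Y_def)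
    qed
    also have "\<dots> \<le> (sqrt (real n / ln (real n)) * \<xi> n) * (sqrt (real n / ln (real n)) * \<xi> n)"
      using elim(1) by (intro mult_mono) (auto simp: Y_def)
    also have "\<dots> = (sqrt (real n / ln (real n)))\<^sup>2 * (\<xi> n)\<^sup>2" by (simp only: power2_eq_square mult_ac)
    also have "\<dots> = real n / ln (real n) * (\<xi> n)\<^sup>2" using ln1 by simp
    also have "\<dots> \<le> real n * (\<xi> n)\<^sup>2"
      using ln1 elim(2) by (intro mult_right_mono) (auto simp: divide_le_eq mult_le_cancel_left1)
    finally show ?case .
  qed
qed

theorem theorem2:
  fixes P :: "real measure" and D \<theta> :: real and \<xi> :: "nat \<Rightarrow> real"
  defines "s2 \<equiv> (\<integral>x. x^2 \<partial>P)"
      and "z \<equiv> (\<integral>x. x^4 \<partial>P)"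
  assumes "prob_space P" and "sets P = sets borel"
      and "integrable P (\<lambda>x. x^2)" and "integrable P (\<lambda>x. x^4)"
      and "integrable P (\<lambda>x. x^6)"
      and "\<theta> > 0" and "integrable P (\<lambda>x. exp (\<theta> * x^2))"
      and "dispersion s2 z > 0"
      and "0 < D" and "D < s2"
      and "\<And>n. \<xi> n > 0"
      and "\<xi> \<longlonglongrightarrow> 0"
      and "filterlim (\<lambda>n. sqrt (real n / ln (real n)) * \<xi> n) at_top sequentially"
  shows "(liminf (\<lambda>n. ereal (- ln (excess_prob P (spherical_cb s2 D) D n (cb_size s2 D (\<xi> n) n))
                           / (real n * (\<xi> n)^2)))
           = ereal (1 / (2 * dispersion s2 z))) \<and>
         (liminf (\<lambda>n. ereal (- ln (excess_prob P (gaussian_cb s2 D) D n (cb_size s2 D (\<xi> n) n))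
                           / (real n * (\<xi> n)^2)))
           = ereal (1 / (2 * dispersion s2 z)))"
proof -
  define v where "v = z - s2\<^sup>2"
  have s2: "s2 > 0" using \<open>0 < D\<close> \<open>D < s2\<close> by simp
  have v: "v > 0" using \<open>dispersion s2 z > 0\<close> s2 by (simp add: dispersion_def v_def zero_less_divide_iff)
  \<comment> \<open>The dispersion is \<open>v / (4 * s2\<^sup>2)\<close>, with \<open>v\<close> the
    variance of the squared source.\<close>
  have const: "1 / (2 * dispersion s2 z) = 2 * s2\<^sup>2 / v"
    unfolding dispersion_def v_def[symmetric] using s2 v by simp
  obtain C l0 where mgf: "mgf_quadratic P s2 v C l0" "0 \<le> C" "0 < l0"
    using mgf_quadratic_exists[OF assms(3-6,8,9)] unfolding v_def s2_def z_def by blast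
  note lim = excess_exponent_tendsto[OF assms(3,4) mgf v \<open>0 < D\<close> \<open>D < s2\<close> _ _
      assms(13,14) moderate_scale_at_top[OF assms(15)]]
  have "liminf (\<lambda>n. ereal (- ln (excess_prob P Q D n (cb_size s2 D (\<xi> n) n)) / (real n * (\<xi> n)^2)))
      = ereal (1 / (2 * dispersion s2 z))" if "regular_cb Q" "ball_rate s2 D Q" for Q
    unfolding const
    by (rule lim_imp_Liminf[OF trivial_limit_sequentially tendsto_ereal[OF lim[OF that]]])
  then show ?thesis
    using regular_spherical_cb regular_gaussian_cb ball_rate_codebooks \<open>0 < D\<close> \<open>D < s2\<close> by blast
qed

end
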